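(* Let $(\mathfrak g_0,\langle\cdot,\cdot\rangle_0,\Phi_0)$, $\Phi_0=(D_0,\theta_0)$, be an extrinsic symmetric triple and let $R$ be a finite-dimensional real vector space, regarded as a trivial $\mathfrak g_0$-module. Then the isomorphism classes of weak extrinsic symmetric triples $(\mathfrak g,\langle\cdot,\cdot\rangle,\Phi)$ with metric radical $R$ (up to linear isomorphism) for which the quotient of $\mathfrak g$ by its metric radical is isomorphic to $(\mathfrak g_0,\langle\cdot,\cdot\rangle_0,\Phi_0)$ are in bijective correspondence with the elements of $$H^2(\mathfrak g_0,R)^{D_0}_-\big/\big(\mathrm{Aut}(\mathfrak g_0,\langle\cdot,\cdot\rangle_0,\Phi_0)\times\mathrm{GL}(R)\big),$$ the correspondence being given by assigning to a cocycle $\omega\in Z^2(\mathfrak g_0,R)$ with $\theta_0^*\omega=-\omega$ and $D_0\omega=0$ the central extension of $\mathfrak g_0$ by $R$ defined by $\omega$ (with the structure described in the context).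
   Context: All vector spaces and Lie algebras are real and finite-dimensional. Triples. For a Lie algebra $\mathfrak g$ with involution $\theta$, $\mathfrak g_\pm$ are the $\pm1$-eigenspaces of $\theta$. If $D$ is a derivation of $\mathfrak g$ with $D^3=-D$ and $D\theta=-\theta D$, put $\mathfrak g^+=\ker D$, $\mathfrak g^-=\{X\mid D^2X=-X\}$, and $\mathfrak g_+^+=\mathfrak g_+\cap\mathfrak g^+$, $\mathfrak g_+^-=\mathfrak g_+\cap\mathfrak g^-$, $\mathfrak g_-^+=\mathfrak g_-\cap\mathfrak g^+$, $\mathfrak g_-^-=\mathfrak g_-\cap\mathfrak g^-$. An extrinsic symmetric triple $(\mathfrak g,\langle\cdot,\cdot\rangle,\Phi)$ consists of a Lie algebra $\mathfrak g$, a non-degenerate $\operatorname{ad}(\mathfrak g)$-invariant symmetric bilinear form $\langle\cdot,\cdot\rangle$ on $\mathfrak g$ and a pair $\Phi=(D,\theta)$, where $\theta$ is an involutive automorphism of $\mathfrak g$ preserving $\langle\cdot,\cdot\rangle$ and $D$ is a derivation, anti-symmetric with respect to $\langle\cdot,\cdot\rangle$, with $D^3=-D$, $D\theta=-\theta D$ and $[\mathfrak g_+^-,\mathfrak g_+^-]=\mathfrak g_+^+$. A weak extrinsic symmetric triple is defined in the same way, except that $\langle\cdot,\cdot\rangle$ is only required to be non-degenerate on $\mathfrak g_+\oplus\mathfrak g_-^-$. Two (weak) extrinsic symmetric triples $(\mathfrak g_i,\langle\cdot,\cdot\rangle_i,(D_i,\theta_i))$, $i=1,2$, are isomorphic if there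 is a Lie algebra isomorphism $h:\mathfrak g_1\to\mathfrak g_2$ with $\langle\cdot,\cdot\rangle_1=h^*\langle\cdot,\cdot\rangle_2$, $D_2=hD_1h^{-1}$, $\theta_2=h\theta_1h^{-1}$. $\mathrm{Aut}(\mathfrak g_0,\langle\cdot,\cdot\rangle_0,\Phi_0)$ is the group of isomorphisms of the triple to itself. Metric radical. The metric radical of a weak extrinsic symmetric triple is $\mathfrak g\cap\mathfrak g^\perp$; it is contained in $\mathfrak g_-^+$ and in the centre of $\mathfrak g$, and the quotient of $\mathfrak g$ by it, with the induced inner product and induced maps, is an extrinsic symmetric triple. Cohomology. $Z^2(\mathfrak g_0,R)$ and $H^2(\mathfrak g_0,R)$ are the 2-cocycles and second cohomology of $\mathfrak g_0$ with values in the trivial module $R$. For $\omega\in Z^2(\mathfrak g_0,R)$ put $(\theta_0^*\omega)(X,Y)=\omega(\theta_0X,\theta_0Y)$ and $(D_0\omega)(X,Y)=\omega(D_0X,Y)+\omega(X,D_0Y)$; this induces maps $\theta_0[\omega]=[\theta_0^*\omega]$, $D_0[\omega]=[D_0\omega]$ on $H^2(\mathfrak g_0,R)$, and $$H^2(\mathfrak g_0,R)^{D_0}_-=\{a\in H^2(\mathfrak g_0,R)\mid\theta_0(a)=-a,\ D_0a=0\}.$$ The group $\mathrm{Aut}(\mathfrak g_0,\langle\cdot,\cdot\rangle_0,\Phi_0)\times\mathrm{GL}(R)$ acts on it in the natural way, $(\varphi,A)\cdot[\omega]=[A\circ(\varphi^{-1})^*\omega]$. Extension defined by $\omega$. For $\omega\in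 Z^2(\mathfrak g_0,R)$ with $\theta_0^*\omega=-\omega$, $D_0\omega=0$, it is the Lie algebra $\mathfrak g=\mathfrak g_0\oplus R$ with $R$ central and $[X,Y]=[X,Y]_{\mathfrak g_0}+\omega(X,Y)$ for $X,Y\in\mathfrak g_0$, equipped with $\langle\cdot,\cdot\rangle=\langle\cdot,\cdot\rangle_0\oplus0$ and $\Phi=(D_0\oplus0,\ \theta_0\oplus-\mathrm{id}_R)$; this is a weak extrinsic symmetric triple. *)

theory Defs
  imports
    "Jordan_Normal_Form.VS_Connect"
    "HOL-Algebra.Bij"
    "HOL-Algebra.Group_Action"
    "HOL-Algebra.QuotRing"
begin

hide_const (open) Modules.module_hom

text \<open>
  Vector spaces are carrier-based modules over \<^term>\<open>class_ring :: real ring\<close>, so that quotients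
  and direct sums are again structures of the same kind. Only the behaviour of operations on the
  carrier is meaningful; the fields \<^const>\<open>mult\<close> and \<^const>\<open>one\<close>, which the record type
  inherits from rings, are never used.
\<close>

abbreviation \<R> :: "real ring" where
  "\<R> \<equiv> class_ring"

definition real_space :: "(real, real) module" where
  "real_space = \<lparr>carrier = UNIV, mult = (*), one = 1, zero = 0, add = (+), smult = (*)\<rparr>"

definition bilinear_map ::
  "(real, 'a, 'm) module_scheme \<Rightarrow> (real, 'b, 'n) module_scheme \<Rightarrow> (real, 'c, 'k) module_scheme
    \<Rightarrow> ('a \<Rightarrow> 'b \<Rightarrow> 'c) \<Rightarrow> bool" where
  "bilinear_map U V W f \<longleftrightarrow>
    (\<forall>x\<in>carrier U. f x \<in> module_hom \<R> V W) \<and>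
    (\<forall>y\<in>carrier V. (\<lambda>x. f x y) \<in> module_hom \<R> U W)"

definition linear_isos ::
  "(real, 'a, 'm) module_scheme \<Rightarrow> (real, 'b, 'n) module_scheme \<Rightarrow> ('a \<Rightarrow> 'b) set" where
  "linear_isos V W = {h \<in> module_hom \<R> V W. bij_betw h (carrier V) (carrier W)}"

definition GL :: "(real, 'a, 'm) module_scheme \<Rightarrow> ('a \<Rightarrow> 'a) monoid" where
  "GL V = BijGroup (carrier V) \<lparr>carrier := Bij (carrier V) \<inter> linear_isos V V\<rparr>"


section \<open>Quotients\<close>

definition quot_module :: "('k, 'a, 'm) module_scheme \<Rightarrow> 'a set \<Rightarrow> ('k, 'a set) module" where
  "quot_module M H =
    \<lparr>carrier = a_rcosets\<^bsub>M\<^esub> H, mult = (\<lambda>_ _. H), one = H, zero = H, add = set_add M,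
     smult = (\<lambda>c A. \<Union>a\<in>A. H +>\<^bsub>M\<^esub> (c \<odot>\<^bsub>M\<^esub> a))\<rparr>"

text \<open>The map induced on cosets, in the style of \<^const>\<open>rcoset_mult\<close>.\<close>
definition quot_map :: "('k, 'a, 'm) module_scheme \<Rightarrow> 'a set \<Rightarrow> ('a \<Rightarrow> 'a) \<Rightarrow> 'a set \<Rightarrow> 'a set" where
  "quot_map M H f A = (\<Union>a\<in>A. H +>\<^bsub>M\<^esub> f a)"

definition quot_map2 ::
  "('k, 'a, 'm) module_scheme \<Rightarrow> 'a set \<Rightarrow> ('a \<Rightarrow> 'a \<Rightarrow> 'a) \<Rightarrow> 'a set \<Rightarrow> 'a set \<Rightarrow> 'a set" where
  "quot_map2 M H f A B = (\<Union>a\<in>A. \<Union>b\<in>B. H +>\<^bsub>M\<^esub> f a b)"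


section \<open>Extrinsic symmetric triples\<close>

record 'a lie = "(real, 'a) module" +
  lie_bracket :: "'a \<Rightarrow> 'a \<Rightarrow> 'a"

record 'a lie_triple = "'a lie" +
  form :: "'a \<Rightarrow> 'a \<Rightarrow> real"
  dmap :: "'a \<Rightarrow> 'a"
  theta :: "'a \<Rightarrow> 'a"

locale lie_algebra = vectorspace \<R> L for L :: "('a, 'm) lie_scheme" (structure) +
  assumes finite_dimensional: fin_dim
    and bracket_bilinear: "bilinear_map L L L (lie_bracket L)"
    and bracket_alternating: "x \<in> carrier L \<Longrightarrow> lie_bracket L x x = \<zero>"
    and jacobi: "\<lbrakk>x \<in> carrier L; y \<in> carrier L; z \<in> carrier L\<rbrakk> \<Longrightarrow>
      lie_bracket L (lie_bracket L x y) z \<oplus> lie_bracket L (lie_bracket L y z) x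
        \<oplus> lie_bracket L (lie_bracket L z x) y = \<zero>"

text \<open>
  Subscripts (eigenspaces of \<^const>\<open>theta\<close>) are written \<open>lower\<close>, superscripts (determined by
  \<^const>\<open>dmap\<close>) are written \<open>upper\<close>.
\<close>

definition lower_plus :: "('a, 'm) lie_triple_scheme \<Rightarrow> 'a set" where
  "lower_plus T = {x \<in> carrier T. theta T x = x}"

definition lower_minus :: "('a, 'm) lie_triple_scheme \<Rightarrow> 'a set" where
  "lower_minus T = {x \<in> carrier T. theta T x = \<ominus>\<^bsub>T\<^esub> x}"

definition upper_plus :: "('a, 'm) lie_triple_scheme \<Rightarrow> 'a set" where
  "upper_plus T = {x \<in> carrier T. dmap T x = \<zero>\<^bsub>T\<^esub>}"

definition upper_minus :: "('a, 'm) lie_triple_scheme \<Rightarrow> 'a set" where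
  "upper_minus T = {x \<in> carrier T. dmap T (dmap T x) = \<ominus>\<^bsub>T\<^esub> x}"

definition nondegenerate_on :: "('a, 'm) lie_triple_scheme \<Rightarrow> 'a set \<Rightarrow> bool" where
  "nondegenerate_on T W \<longleftrightarrow> (\<forall>x\<in>W. (\<forall>y\<in>W. form T x y = 0) \<longrightarrow> x = \<zero>\<^bsub>T\<^esub>)"

text \<open>
  Everything common to extrinsic and weak extrinsic symmetric triples, that is, all
  conditions except non-degeneracy of the form. The bracket of two subspaces is the linear span
  of the brackets of their elements, and an involution is a map squaring to the identity (the
  zero algebra is not excluded).
\<close>

locale pre_triple = lie_algebra T for T :: "('a, 'm) lie_triple_scheme" (structure) +
  assumes form_bilinear: "bilinear_map T T real_space (form T)"
    and form_symmetric: "\<lbrakk>x \<in> carrier T; y \<in> carrier T\<rbrakk> \<Longrightarrow> form T x y = form T y x"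
    and form_ad_invariant: "\<lbrakk>x \<in> carrier T; y \<in> carrier T; z \<in> carrier T\<rbrakk> \<Longrightarrow>
      form T (lie_bracket T x y) z = - form T y (lie_bracket T x z)"
    and theta_linear: "theta T \<in> module_hom \<R> T T"
    and theta_bracket: "\<lbrakk>x \<in> carrier T; y \<in> carrier T\<rbrakk> \<Longrightarrow>
      theta T (lie_bracket T x y) = lie_bracket T (theta T x) (theta T y)"
    and theta_involutive: "x \<in> carrier T \<Longrightarrow> theta T (theta T x) = x"
    and theta_form: "\<lbrakk>x \<in> carrier T; y \<in> carrier T\<rbrakk> \<Longrightarrow> form T (theta T x) (theta T y) = form T x y"
    and dmap_linear: "dmap T \<in> module_hom \<R> T T"
    and dmap_derivation: "\<lbrakk>x \<in> carrier T; y \<in> carrier T\<rbrakk> \<Longrightarrow>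
      dmap T (lie_bracket T x y) = lie_bracket T (dmap T x) y \<oplus> lie_bracket T x (dmap T y)"
    and dmap_antisymmetric: "\<lbrakk>x \<in> carrier T; y \<in> carrier T\<rbrakk> \<Longrightarrow>
      form T (dmap T x) y = - form T x (dmap T y)"
    and dmap_cubed: "x \<in> carrier T \<Longrightarrow> dmap T (dmap T (dmap T x)) = \<ominus> dmap T x"
    and dmap_theta: "x \<in> carrier T \<Longrightarrow> dmap T (theta T x) = \<ominus> theta T (dmap T x)"
    and bracket_generates:
      "span {lie_bracket T x y | x y.
          x \<in> lower_plus T \<inter> upper_minus T \<and> y \<in> lower_plus T \<inter> upper_minus T}
        = lower_plus T \<inter> upper_plus T"

locale extrinsic_symmetric_triple = pre_triple +
  assumes nondegenerate: "nondegenerate_on T (carrier T)"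

locale weak_extrinsic_symmetric_triple = pre_triple +
  assumes weakly_nondegenerate:
    "nondegenerate_on T (submodule_sum (lower_plus T) (lower_minus T \<inter> upper_minus T))"

definition triple_isos ::
  "('a, 'm) lie_triple_scheme \<Rightarrow> ('b, 'n) lie_triple_scheme \<Rightarrow> ('a \<Rightarrow> 'b) set" where
  "triple_isos S T = {h \<in> linear_isos S T.
    (\<forall>x\<in>carrier S. \<forall>y\<in>carrier S. h (lie_bracket S x y) = lie_bracket T (h x) (h y)) \<and>
    (\<forall>x\<in>carrier S. \<forall>y\<in>carrier S. form S x y = form T (h x) (h y)) \<and>
    (\<forall>x\<in>carrier S. dmap T (h x) = h (dmap S x)) \<and>
    (\<forall>x\<in>carrier S. theta T (h x) = h (theta S x))}"

definition isomorphic_triples ::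
  "('a, 'm) lie_triple_scheme \<Rightarrow> ('b, 'n) lie_triple_scheme \<Rightarrow> bool" (infix \<open>\<cong>\<^sub>t\<close> 50) where
  "S \<cong>\<^sub>t T \<longleftrightarrow> triple_isos S T \<noteq> {}"

definition Aut :: "('a, 'm) lie_triple_scheme \<Rightarrow> ('a \<Rightarrow> 'a) monoid" where
  "Aut T = BijGroup (carrier T) \<lparr>carrier := Bij (carrier T) \<inter> triple_isos T T\<rparr>"

definition metric_radical :: "('a, 'm) lie_triple_scheme \<Rightarrow> 'a set" where
  "metric_radical T = {x \<in> carrier T. \<forall>y\<in>carrier T. form T x y = 0}"

definition radical_quotient :: "('a, 'm) lie_triple_scheme \<Rightarrow> 'a set lie_triple" where
  "radical_quotient T = (let N = metric_radical T in
    lie.extend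
      (module.extend (quot_module T N) (lie.fields (quot_map2 T N (lie_bracket T))))
      (lie_triple.fields
        (\<lambda>A B. THE c. \<exists>a\<in>A. \<exists>b\<in>B. c = form T a b)
        (quot_map T N (dmap T))
        (quot_map T N (theta T))))"


section \<open>Second cohomology with trivial coefficients\<close>

text \<open>Cochains are extensional functions on pairs, so that cohomology classes are honest cosets.\<close>

definition cocycles :: "('a, 'm) lie_scheme \<Rightarrow> (real, 'r, 'n) module_scheme \<Rightarrow> ('a \<times> 'a \<Rightarrow> 'r) set" where
  "cocycles L R = {\<omega> \<in> extensional (carrier L \<times> carrier L).
    bilinear_map L L R (curry \<omega>) \<and>
    (\<forall>x\<in>carrier L. \<omega> (x, x) = \<zero>\<^bsub>R\<^esub>) \<and>
    (\<forall>x\<in>carrier L. \<forall>y\<in>carrier L. \<forall>z\<in>carrier L.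
      \<omega> (lie_bracket L x y, z) \<oplus>\<^bsub>R\<^esub> \<omega> (lie_bracket L y z, x) \<oplus>\<^bsub>R\<^esub> \<omega> (lie_bracket L z x, y) = \<zero>\<^bsub>R\<^esub>)}"

definition Z2 :: "('a, 'm) lie_scheme \<Rightarrow> (real, 'r, 'n) module_scheme \<Rightarrow> (real, 'a \<times> 'a \<Rightarrow> 'r) module" where
  "Z2 L R = (let P = carrier L \<times> carrier L; z = (\<lambda>p\<in>P. \<zero>\<^bsub>R\<^esub>) in
    \<lparr>carrier = cocycles L R, mult = (\<lambda>_ _. z), one = z, zero = z,
     add = (\<lambda>\<omega> \<omega>'. \<lambda>p\<in>P. \<omega> p \<oplus>\<^bsub>R\<^esub> \<omega>' p),
     smult = (\<lambda>c \<omega>. \<lambda>p\<in>P. c \<odot>\<^bsub>R\<^esub> \<omega> p)\<rparr>)"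

definition B2 :: "('a, 'm) lie_scheme \<Rightarrow> (real, 'r, 'n) module_scheme \<Rightarrow> ('a \<times> 'a \<Rightarrow> 'r) set" where
  "B2 L R = {(\<lambda>(x, y)\<in>carrier L \<times> carrier L. \<ominus>\<^bsub>R\<^esub> \<eta> (lie_bracket L x y)) | \<eta>. \<eta> \<in> module_hom \<R> L R}"

definition H2 :: "('a, 'm) lie_scheme \<Rightarrow> (real, 'r, 'n) module_scheme \<Rightarrow> (real, ('a \<times> 'a \<Rightarrow> 'r) set) module" where
  "H2 L R = quot_module (Z2 L R) (B2 L R)"

definition cohomology_class ::
  "('a, 'm) lie_scheme \<Rightarrow> (real, 'r, 'n) module_scheme \<Rightarrow> ('a \<times> 'a \<Rightarrow> 'r) \<Rightarrow> ('a \<times> 'a \<Rightarrow> 'r) set" where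
  "cohomology_class L R \<omega> = B2 L R +>\<^bsub>Z2 L R\<^esub> \<omega>"

definition pullback :: "('a, 'm) lie_scheme \<Rightarrow> ('a \<Rightarrow> 'a) \<Rightarrow> ('a \<times> 'a \<Rightarrow> 'r) \<Rightarrow> 'a \<times> 'a \<Rightarrow> 'r" where
  "pullback L f \<omega> = (\<lambda>(x, y)\<in>carrier L \<times> carrier L. \<omega> (f x, f y))"

definition D_cochain ::
  "('a, 'm) lie_triple_scheme \<Rightarrow> (real, 'r, 'n) module_scheme \<Rightarrow> ('a \<times> 'a \<Rightarrow> 'r) \<Rightarrow> 'a \<times> 'a \<Rightarrow> 'r" where
  "D_cochain T R \<omega> =
    (\<lambda>(x, y)\<in>carrier T \<times> carrier T. \<omega> (dmap T x, y) \<oplus>\<^bsub>R\<^esub> \<omega> (x, dmap T y))"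

definition invariant_cocycles ::
  "('a, 'm) lie_triple_scheme \<Rightarrow> (real, 'r, 'n) module_scheme \<Rightarrow> ('a \<times> 'a \<Rightarrow> 'r) set" where
  "invariant_cocycles T R = {\<omega> \<in> carrier (Z2 T R).
    pullback T (theta T) \<omega> = \<ominus>\<^bsub>Z2 T R\<^esub> \<omega> \<and> D_cochain T R \<omega> = \<zero>\<^bsub>Z2 T R\<^esub>}"

definition H2_D_minus ::
  "('a, 'm) lie_triple_scheme \<Rightarrow> (real, 'r, 'n) module_scheme \<Rightarrow> ('a \<times> 'a \<Rightarrow> 'r) set set" where
  "H2_D_minus T R = {a \<in> carrier (H2 T R).
    quot_map (Z2 T R) (B2 T R) (pullback T (theta T)) a = \<ominus>\<^bsub>H2 T R\<^esub> a \<and>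
    quot_map (Z2 T R) (B2 T R) (D_cochain T R) a = \<zero>\<^bsub>H2 T R\<^esub>}"

definition cohomology_action ::
  "('a, 'm) lie_triple_scheme \<Rightarrow> (real, 'r, 'n) module_scheme \<Rightarrow> ('a \<Rightarrow> 'a) \<times> ('r \<Rightarrow> 'r)
    \<Rightarrow> ('a \<times> 'a \<Rightarrow> 'r) set \<Rightarrow> ('a \<times> 'a \<Rightarrow> 'r) set" where
  "cohomology_action T R = (\<lambda>(\<phi>, A).
    quot_map (Z2 T R) (B2 T R)
      (\<lambda>\<omega>. compose (carrier T \<times> carrier T) A (pullback T (inv_into (carrier T) \<phi>) \<omega>)))"


section \<open>Extensions\<close>

definition extension ::
  "('a, 'm) lie_triple_scheme \<Rightarrow> (real, 'r, 'n) module_scheme \<Rightarrow> ('a \<times> 'a \<Rightarrow> 'r) \<Rightarrow> ('a \<times> 'r) lie_triple" where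
  "extension T R \<omega> =
    lie.extend
      (module.extend (direct_sum T R)
        (lie.fields (\<lambda>(x, r) (y, s). (lie_bracket T x y, \<omega> (x, y)))))
      (lie_triple.fields
        (\<lambda>(x, r) (y, s). form T x y)
        (\<lambda>(x, r). (dmap T x, \<zero>\<^bsub>R\<^esub>))
        (\<lambda>(x, r). (theta T x, \<ominus>\<^bsub>R\<^esub> r)))"

text \<open>
  The weak triples with metric radical linearly isomorphic to \<open>R\<close> and quotient isomorphic to
  \<open>T0\<close>. Isomorphism classes need an ambient type: \<open>'u\<close> is arbitrary, and carriers are
  subsets of it.
\<close>
definition weak_triples_over :: "'a lie_triple \<Rightarrow> (real, 'r) module \<Rightarrow> 'u lie_triple set" where
  "weak_triples_over T0 R = {T. weak_extrinsic_symmetric_triple T \<and>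
    linear_isos (T\<lparr>carrier := metric_radical T\<rparr>) R \<noteq> {} \<and>
    radical_quotient T \<cong>\<^sub>t T0}"

definition iso_relation :: "'u lie_triple set \<Rightarrow> ('u lie_triple \<times> 'u lie_triple) set" where
  "iso_relation W = {(S, T). S \<in> W \<and> T \<in> W \<and> S \<cong>\<^sub>t T}"

end

theory Submission
  imports Defs
begin

text \<open>
  An extension of \<open>T0\<close> by \<open>R\<close> remembers its cocycle only up to coordinates. The proof consists of
  three comparisons between cocycles and triples.

  Every class in \<open>H2_D_minus\<close> has a representative \<open>\<omega>\<close> with \<open>\<theta>\<^sup>*\<omega> = -\<omega>\<close> and \<open>D\<omega> = 0\<close>
  (\<open>invariant_representative\<close>). This holds because \<open>D\<close> and \<open>\<theta>\<close> act semisimply, and explicit averaging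
  formulas replace representation theory. Such an \<open>\<omega>\<close> defines a weak triple whose radical is the
  copy of \<open>R\<close> inside the extension (\<open>model_weak_triple\<close>, \<open>mem_radical\<close>).

  Conversely, let \<open>T\<close> be a weak triple over \<open>T0\<close> with metric radical \<open>N\<close>. Weak non-degeneracy forces
  \<open>\<theta> = -1\<close> and \<open>D = 0\<close> on \<open>N\<close>, and then \<open>N\<close> is central. A linear map \<open>p\<close> from \<open>T\<close> to \<open>R\<close> that
  is bijective on \<open>N\<close> and compatible with \<open>D\<close> and \<open>\<theta>\<close> exhibits \<open>T\<close> as the extension defined by the
  cocycle \<open>p [x, y]\<close> (\<open>weak_triple_is_model\<close>).

  An isomorphism between two extensions preserves the metric radical, so it is triangular: it is given by an
  automorphism \<open>\<phi>\<close> of \<open>T0\<close>, an element \<open>A\<close> of \<open>GL R\<close> and a linear map from \<open>T0\<close> to \<open>R\<close>. The last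
  datum changes the cocycle by a coboundary and the first two act on its class. Conversely each
  equality \<open>[\<omega>'] = (\<phi>, A) \<cdot> [\<omega>]\<close> yields an isomorphism, because the coboundary that relates the
  invariant representatives can be averaged as well (\<open>orbit_of_class\<close>). So orbits correspond to
  isomorphism classes. An injection of \<open>T0 \<times> R\<close> into \<open>'u\<close> provides a copy of each extension on the
  type \<open>'u\<close> (\<open>copy_is_model\<close>).

  Vector spaces live on carrier sets here. Equations between vectors are proved by applying linear functionals
  (\<open>dual_separates\<close>), so that the computations take place in the real numbers.
\<close>

section \<open>Linear maps and functionals\<close>

abbreviation linear_maps ::
  "(real, 'a, 'm) module_scheme \<Rightarrow> (real, 'b, 'n) module_scheme \<Rightarrow> ('a \<Rightarrow> 'b) set" where
  "linear_maps \<equiv> module_hom \<R>"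

lemma linear_mapsI:
  assumes "\<And>x. x \<in> carrier U \<Longrightarrow> f x \<in> carrier V"
    and "\<And>x y. x \<in> carrier U \<Longrightarrow> y \<in> carrier U \<Longrightarrow> f (x \<oplus>\<^bsub>U\<^esub> y) = f x \<oplus>\<^bsub>V\<^esub> f y"
    and "\<And>c x. x \<in> carrier U \<Longrightarrow> f (c \<odot>\<^bsub>U\<^esub> x) = c \<odot>\<^bsub>V\<^esub> f x"
  shows "f \<in> linear_maps U V"
  using assms by (auto simp: LinearCombinations.module_hom_def)

lemma linear_map_closed: "f \<in> linear_maps U V \<Longrightarrow> x \<in> carrier U \<Longrightarrow> f x \<in> carrier V"
  by (auto simp: LinearCombinations.module_hom_def)

lemma linear_map_add:
  "f \<in> linear_maps U V \<Longrightarrow> x \<in> carrier U \<Longrightarrow> y \<in> carrier U \<Longrightarrow> f (x \<oplus>\<^bsub>U\<^esub> y) = f x \<oplus>\<^bsub>V\<^esub> f y"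
  by (auto simp: LinearCombinations.module_hom_def)

lemma linear_map_smult:
  "f \<in> linear_maps U V \<Longrightarrow> x \<in> carrier U \<Longrightarrow> f (c \<odot>\<^bsub>U\<^esub> x) = c \<odot>\<^bsub>V\<^esub> f x"
  by (auto simp: LinearCombinations.module_hom_def)

lemma vectorspace_real_space: "vectorspace \<R> real_space"
  by (rule vs_criteria)
    (auto simp: real_space_def class_field.field_axioms algebra_simps intro: exI[of _ "- _"])

locale real_vs = vectorspace \<R> V for V :: "(real, 'a, 'm) module_scheme" (structure)
begin

lemma smult_closed' [simp, intro]: "x \<in> carrier V \<Longrightarrow> (c::real) \<odot> x \<in> carrier V"
  using smult_closed[of c x] by simp

lemma smult_add_left: "x \<in> carrier V \<Longrightarrow> (c + d :: real) \<odot> x = c \<odot> x \<oplus> d \<odot> x"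
  using smult_l_distr[of c d x] by simp

lemma smult_add_right: "x \<in> carrier V \<Longrightarrow> y \<in> carrier V \<Longrightarrow> (c::real) \<odot> (x \<oplus> y) = c \<odot> x \<oplus> c \<odot> y"
  using smult_r_distr[of c x y] by simp

lemma smult_smult: "x \<in> carrier V \<Longrightarrow> (c::real) \<odot> (d \<odot> x) = (c * d) \<odot> x"
  using smult_assoc1[of c d x] by simp

lemma smult_1: "x \<in> carrier V \<Longrightarrow> (1::real) \<odot> x = x"
  using smult_one[of x] by simp

lemma smult_0: "x \<in> carrier V \<Longrightarrow> (0::real) \<odot> x = \<zero>"
  using lmult_0[of x] by simp

lemma smult_uminus_1: "x \<in> carrier V \<Longrightarrow> (-1::real) \<odot> x = \<ominus> x"
  using smult_add_left[of x "-1" 1] minus_equality[of "(-1) \<odot> x" x] smult_0[of x] smult_1[of x] by simp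

lemma submoduleI:
  assumes "N \<subseteq> carrier V" "\<zero> \<in> N" "\<And>x y. x \<in> N \<Longrightarrow> y \<in> N \<Longrightarrow> x \<oplus> y \<in> N" "\<And>c x. x \<in> N \<Longrightarrow> (c::real) \<odot> x \<in> N"
  shows "submodule \<R> N V"
  using assms module_axioms by (auto intro!: submodule.intro)

end

lemma linear_map_zero:
  assumes "f \<in> linear_maps U V" "vectorspace \<R> U" "vectorspace \<R> V"
  shows "f \<zero>\<^bsub>U\<^esub> = \<zero>\<^bsub>V\<^esub>"
proof -
  interpret U: vectorspace \<R> U by fact
  interpret V: vectorspace \<R> V by fact
  interpret mod_hom \<R> U V f using assms(1) by unfold_locales
  show ?thesis by simp
qed

lemma linear_map_uminus:
  assumes "f \<in> linear_maps U V" "vectorspace \<R> U" "vectorspace \<R> V" "x \<in> carrier U"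
  shows "f (\<ominus>\<^bsub>U\<^esub> x) = \<ominus>\<^bsub>V\<^esub> f x"
proof -
  interpret U: vectorspace \<R> U by fact
  interpret V: vectorspace \<R> V by fact
  interpret mod_hom \<R> U V f using assms(1) by unfold_locales
  show ?thesis using assms by simp
qed

text \<open>
  If \<open>v \<notin> N\<close>, a vector \<open>x\<close> of \<open>N + \<real> v\<close> determines the number \<open>k\<close> with
  \<open>x + k v \<in> N\<close>, and \<open>x \<mapsto> f (x + k v)\<close> is the extension of \<open>f\<close> that vanishes on \<open>v\<close>.
\<close>
lemma (in real_vs) extend_linear_map_by_one_vector:
  fixes W :: "(real, 'b, 'n) module_scheme"
  assumes N: "submodule \<R> N V" and W: "vectorspace \<R> W"
    and f: "f \<in> linear_maps (V\<lparr>carrier := N\<rparr>) W" and v: "v \<in> carrier V"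
  shows "\<exists>N' g. submodule \<R> N' V \<and> N \<subseteq> N' \<and> v \<in> N' \<and> g \<in> linear_maps (V\<lparr>carrier := N'\<rparr>) W \<and>
    (\<forall>x\<in>N. g x = f x)"
proof (cases "v \<in> N")
  case True
  then show ?thesis using N f by blast
next
  case False
  interpret N: submodule \<R> N V by fact
  interpret W: real_vs W using W by (simp add: real_vs_def)
  have smN: "c \<odot> x \<in> N" if "x \<in> N" for c x using N.smult_closed[of c x] that by simp
  have NV: "x \<in> carrier V" if "x \<in> N" for x using N.subset that by auto
  let ?P = "\<lambda>x c. x \<oplus> c \<odot> v \<in> N"
  have unique: "c = d" if x: "x \<in> carrier V" and "?P x c" "?P x d" for x c d
  proof (rule ccontr)
    assume "c \<noteq> d"
    have "(x \<oplus> c \<odot> v) \<oplus> (-1) \<odot> (x \<oplus> d \<odot> v) \<in> N"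
      using that smN N.m_closed by blast
    also have "(x \<oplus> c \<odot> v) \<oplus> (-1) \<odot> (x \<oplus> d \<odot> v) = (x \<oplus> (-1) \<odot> x) \<oplus> (c \<odot> v \<oplus> (-d) \<odot> v)"
      using x v by (simp add: smult_add_right smult_smult a_ac)
    also have "\<dots> = (c - d) \<odot> v"
      using x v by (simp add: smult_add_left[symmetric] smult_uminus_1 r_neg)
    finally have "(1 / (c - d)) \<odot> ((c - d) \<odot> v) \<in> N" using smN by blast
    then show False using False v \<open>c \<noteq> d\<close> by (simp add: smult_smult smult_1)
  qed
  define k where "k x = (SOME c. ?P x c)" for x
  define N' where "N' = {x \<in> carrier V. \<exists>c. ?P x c}"
  define g where "g x = f (x \<oplus> k x \<odot> v)" for x
  have kP: "?P x (k x)" if "x \<in> N'" for x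
    using that someI_ex[of "?P x"] unfolding N'_def k_def by blast
  have k_eq: "k x = c" if "x \<in> carrier V" "?P x c" for x c
    using that unique kP by (metis (mono_tags, lifting) N'_def mem_Collect_eq)
  have P_add: "(x \<oplus> y) \<oplus> (c + d) \<odot> v = (x \<oplus> c \<odot> v) \<oplus> (y \<oplus> d \<odot> v)"
    if "x \<in> carrier V" "y \<in> carrier V" for x y c d
    using that v by (simp add: smult_add_left a_ac)
  have P_smult: "c \<odot> x \<oplus> (c * d) \<odot> v = c \<odot> (x \<oplus> d \<odot> v)" if "x \<in> carrier V" for x c d
    using that v by (simp add: smult_add_right smult_smult)
  have N'V: "x \<in> carrier V" if "x \<in> N'" for x using that by (simp add: N'_def)
  have P0: "?P x 0" if "x \<in> N" for x using that v NV by (simp add: smult_0)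
  have NN': "N \<subseteq> N'" using P0 NV by (auto simp: N'_def)
  have addP: "?P (x \<oplus> y) (k x + k y)" if "x \<in> N'" "y \<in> N'" for x y
    using that kP N'V by (simp add: P_add N.m_closed)
  have smP: "?P (c \<odot> x) (c * k x)" if "x \<in> N'" for x c
    using that kP N'V smN by (simp add: P_smult)
  have add': "x \<oplus> y \<in> N'" if "x \<in> N'" "y \<in> N'" for x y
    using addP[OF that] N'V that by (auto simp: N'_def)
  have sm': "c \<odot> x \<in> N'" if "x \<in> N'" for x c
    using smP[OF that] N'V that by (auto simp: N'_def)
  have "submodule \<R> N' V"
    using N'V subsetD[OF NN' N.zero_closed] add' sm' by (intro submoduleI) auto
  moreover have "v \<in> N'"
  proof -
    have "v \<oplus> (-1) \<odot> v = \<zero>" using v by (simp add: smult_uminus_1 r_neg)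
    then show ?thesis using v N.zero_closed by (auto simp: N'_def intro: exI[of _ "-1"])
  qed
  moreover have "g \<in> linear_maps (V\<lparr>carrier := N'\<rparr>) W"
  proof (rule linear_mapsI)
    fix x assume "x \<in> carrier (V\<lparr>carrier := N'\<rparr>)"
    then show "g x \<in> carrier W"
      using kP linear_map_closed[OF f] by (simp add: g_def)
  next
    fix x y assume "x \<in> carrier (V\<lparr>carrier := N'\<rparr>)" "y \<in> carrier (V\<lparr>carrier := N'\<rparr>)"
    then have xy: "x \<in> N'" "y \<in> N'" by auto
    have "k (x \<oplus> y) = k x + k y" using k_eq addP xy N'V by simp
    then show "g (x \<oplus>\<^bsub>V\<lparr>carrier := N'\<rparr>\<^esub> y) = g x \<oplus>\<^bsub>W\<^esub> g y"
      using xy kP N'V linear_map_add[OF f, of "x \<oplus> k x \<odot> v" "y \<oplus> k y \<odot> v"]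
      by (simp add: g_def P_add)
  next
    fix c x assume "x \<in> carrier (V\<lparr>carrier := N'\<rparr>)"
    then have x: "x \<in> N'" by auto
    have "k (c \<odot> x) = c * k x" using k_eq smP x N'V by simp
    then show "g (c \<odot>\<^bsub>V\<lparr>carrier := N'\<rparr>\<^esub> x) = c \<odot>\<^bsub>W\<^esub> g x"
      using x kP N'V linear_map_smult[OF f, of "x \<oplus> k x \<odot> v"] by (simp add: g_def P_smult)
  qed
  moreover have "g x = f x" if "x \<in> N" for x
    using k_eq[OF _ P0] that NV v by (simp add: g_def smult_0)
  ultimately show ?thesis using NN' by blast
qed

text \<open>
  The vectors of a finite generating set are adjoined to \<open>N\<close> one after the other.
\<close>
lemma extend_linear_map:
  fixes V :: "(real, 'a, 'm) module_scheme" and W :: "(real, 'b, 'n) module_scheme"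
  assumes V: "vectorspace \<R> V" and fd: "vectorspace.fin_dim \<R> V" and W: "vectorspace \<R> W"
    and N: "submodule \<R> N V" and f: "f \<in> linear_maps (V\<lparr>carrier := N\<rparr>) W"
  obtains g where "g \<in> linear_maps V W" "\<And>x. x \<in> N \<Longrightarrow> g x = f x"
proof -
  interpret real_vs V using V by (simp add: real_vs_def)
  obtain A where A: "finite A" "A \<subseteq> carrier V" "span A = carrier V"
    using fd unfolding fin_dim_def by blast
  have "\<exists>N' g. submodule \<R> N' V \<and> N \<subseteq> N' \<and> B \<subseteq> N' \<and> g \<in> linear_maps (V\<lparr>carrier := N'\<rparr>) W \<and>
    (\<forall>x\<in>N. g x = f x)" if "finite B" "B \<subseteq> carrier V" for B
    using that
  proof (induction B)
    case empty
    then show ?case using N f by blast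
  next
    case (insert v B)
    then obtain N1 g1 where 1: "submodule \<R> N1 V" "N \<subseteq> N1" "B \<subseteq> N1"
      "g1 \<in> linear_maps (V\<lparr>carrier := N1\<rparr>) W" "\<forall>x\<in>N. g1 x = f x" by auto
    obtain N2 g2 where 2: "submodule \<R> N2 V" "N1 \<subseteq> N2" "v \<in> N2"
      "g2 \<in> linear_maps (V\<lparr>carrier := N2\<rparr>) W" "\<forall>x\<in>N1. g2 x = g1 x"
      using extend_linear_map_by_one_vector[OF 1(1) W 1(4), of v] insert.prems by auto
    show ?case using 1 2 by (intro exI[of _ N2] exI[of _ g2]) auto
  qed
  from this[OF A(1,2)] obtain N' g where g: "submodule \<R> N' V" "A \<subseteq> N'"
    "g \<in> linear_maps (V\<lparr>carrier := N'\<rparr>) W" "\<forall>x\<in>N. g x = f x" by blast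
  have "N' = carrier V"
    using span_is_subset[OF g(2,1)] A(3) submodule.subset[OF g(1)] by auto
  then show ?thesis using g by (intro that[of g]) auto
qed

abbreviation dual :: "(real, 'a, 'm) module_scheme \<Rightarrow> ('a \<Rightarrow> real) set" where
  "dual V \<equiv> linear_maps V real_space"

lemma dual_add: "f \<in> dual V \<Longrightarrow> x \<in> carrier V \<Longrightarrow> y \<in> carrier V \<Longrightarrow> f (x \<oplus>\<^bsub>V\<^esub> y) = f x + f y"
  by (simp add: linear_map_add real_space_def)

lemma dual_smult: "f \<in> dual V \<Longrightarrow> x \<in> carrier V \<Longrightarrow> f (c \<odot>\<^bsub>V\<^esub> x) = c * f x"
  by (simp add: linear_map_smult real_space_def)

lemma dual_zero: "f \<in> dual V \<Longrightarrow> vectorspace \<R> V \<Longrightarrow> f \<zero>\<^bsub>V\<^esub> = 0"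
  using linear_map_zero[of f V real_space] vectorspace_real_space by (simp add: real_space_def)

lemma dual_uminus:
  assumes "f \<in> dual V" "vectorspace \<R> V" "x \<in> carrier V"
  shows "f (\<ominus>\<^bsub>V\<^esub> x) = - f x"
proof -
  interpret real_vs V using assms by (simp add: real_vs_def)
  show ?thesis using dual_smult[OF assms(1), of x "-1"] assms smult_uminus_1[of x] by simp
qed

lemma dual_minus:
  assumes "f \<in> dual V" "vectorspace \<R> V" "x \<in> carrier V" "y \<in> carrier V"
  shows "f (x \<ominus>\<^bsub>V\<^esub> y) = f x - f y"
proof -
  interpret real_vs V using assms by (simp add: real_vs_def)
  show ?thesis using assms by (simp add: a_minus_def dual_add dual_uminus)
qed

text \<open>
  This makes real arithmetic available for equations between vectors: both sides are compared
  under an arbitrary functional. A functional that distinguishes \<open>x\<close> from \<open>y\<close> is obtained by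
  extending the coordinate on the line through \<open>x - y\<close>.
\<close>
lemma dual_separates:
  fixes V :: "(real, 'a, 'm) module_scheme"
  assumes V: "vectorspace \<R> V" and fd: "vectorspace.fin_dim \<R> V"
    and x: "x \<in> carrier V" and y: "y \<in> carrier V" and eq: "\<And>f. f \<in> dual V \<Longrightarrow> f x = f y"
  shows "x = y"
proof (rule ccontr)
  interpret real_vs V using V by (simp add: real_vs_def)
  assume "x \<noteq> y"
  let ?d = "x \<ominus>\<^bsub>V\<^esub> y"
  have d: "?d \<in> carrier V" "?d \<noteq> \<zero>\<^bsub>V\<^esub>" using x y \<open>x \<noteq> y\<close> by auto
  have 0: "submodule \<R> {\<zero>\<^bsub>V\<^esub>} V"
    by (rule submoduleI) (auto simp: smult_0)
  have 1: "(\<lambda>_. 0) \<in> linear_maps (V\<lparr>carrier := {\<zero>\<^bsub>V\<^esub>}\<rparr>) real_space"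
    by (rule linear_mapsI) (auto simp: real_space_def)
  define N where "N = range (\<lambda>c::real. c \<odot>\<^bsub>V\<^esub> (?d))"
  have inj: "c = c'" if "c \<odot>\<^bsub>V\<^esub> (?d) = c' \<odot>\<^bsub>V\<^esub> (?d)" for c c' :: real
  proof (rule ccontr)
    assume "c \<noteq> c'"
    have "(c - c') \<odot>\<^bsub>V\<^esub> (?d) = c \<odot>\<^bsub>V\<^esub> (?d) \<oplus>\<^bsub>V\<^esub> (-c') \<odot>\<^bsub>V\<^esub> (?d)"
      using smult_add_left[OF d(1), of c "-c'"] by simp
    also have "\<dots> = (c' + - c') \<odot>\<^bsub>V\<^esub> (?d)" using d(1) that by (simp only: smult_add_left)
    also have "\<dots> = \<zero>\<^bsub>V\<^esub>" using d(1) by (simp add: smult_0)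
    finally have "(1 / (c - c')) \<odot>\<^bsub>V\<^esub> ((c - c') \<odot>\<^bsub>V\<^esub> (?d)) = \<zero>\<^bsub>V\<^esub>" by simp
    then show False using d \<open>c \<noteq> c'\<close> by (simp add: smult_smult smult_1)
  qed
  define k where "k z = (THE c. z = c \<odot>\<^bsub>V\<^esub> (?d))" for z
  have k: "k (c \<odot>\<^bsub>V\<^esub> (?d)) = c" for c
    unfolding k_def using inj by (intro the_equality) auto
  have N: "submodule \<R> N V"
    using d(1) smult_0[OF d(1)] unfolding N_def
    by (intro submoduleI) (auto simp: smult_smult smult_add_left[symmetric] image_iff intro: exI[of _ 0])
  have "k \<in> linear_maps (V\<lparr>carrier := N\<rparr>) real_space"
    using d(1) by (intro linear_mapsI)
      (auto simp: real_space_def N_def smult_smult smult_add_left[symmetric] k)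
  from extend_linear_map[OF V fd vectorspace_real_space N this]
  obtain g where g: "g \<in> dual V" "\<And>z. z \<in> N \<Longrightarrow> g z = k z" by blast
  have "?d \<in> N" unfolding N_def using smult_1[OF d(1)] by (metis rangeI)
  moreover have "k (?d) = 1" using k[of 1] smult_1[OF d(1)] by simp
  ultimately have "g (?d) = 1" using g by simp
  then show False using eq[OF g(1)] dual_minus[OF g(1) V x y] by simp
qed

section \<open>Spans, transport of structure and quotients\<close>

lemma (in real_vs) submodule_vimage:
  assumes f: "f \<in> linear_maps V W" and W: "vectorspace \<R> W" and N: "submodule \<R> N W"
  shows "submodule \<R> {x \<in> carrier V. f x \<in> N} V"
proof -
  interpret N: submodule \<R> N W by fact
  show ?thesis
    using linear_map_add[OF f] linear_map_smult[OF f] linear_map_zero[OF f vectorspace_axioms W]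
      N.m_closed N.smult_closed N.zero_closed
    by (intro submoduleI) auto
qed

lemma (in real_vs) submodule_image:
  assumes f: "f \<in> linear_maps V W" and W: "vectorspace \<R> W" and N: "submodule \<R> N V"
  shows "submodule \<R> (f ` N) W"
proof -
  interpret N: submodule \<R> N V by fact
  interpret W: real_vs W using W by (simp add: real_vs_def)
  have NV: "x \<in> carrier V" if "x \<in> N" for x using that N.subset by auto
  show ?thesis
  proof (rule W.submoduleI)
    show "f ` N \<subseteq> carrier W" using NV linear_map_closed[OF f] by auto
    show "\<zero>\<^bsub>W\<^esub> \<in> f ` N"
      using linear_map_zero[OF f vectorspace_axioms W] N.zero_closed by (metis imageI)
    show "x \<oplus>\<^bsub>W\<^esub> y \<in> f ` N" if "x \<in> f ` N" "y \<in> f ` N" for x y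
      using that NV linear_map_add[OF f, symmetric] N.m_closed by auto
    show "c \<odot>\<^bsub>W\<^esub> x \<in> f ` N" if "x \<in> f ` N" for c x
      using that NV linear_map_smult[OF f, symmetric] N.smult_closed by auto
  qed
qed

lemma (in real_vs) image_span:
  assumes f: "f \<in> linear_maps V W" and W: "vectorspace \<R> W" and S: "S \<subseteq> carrier V"
  shows "f ` span S = LinearCombinations.module.span \<R> W (f ` S)"
proof -
  interpret W: real_vs W using W by (simp add: real_vs_def)
  have fS: "f ` S \<subseteq> carrier W" using S linear_map_closed[OF f] by auto
  have "span S \<subseteq> {x \<in> carrier V. f x \<in> W.span (f ` S)}"
    using W.in_own_span[OF fS] S
    by (intro span_is_subset submodule_vimage[OF f W W.span_is_submodule[OF fS]]) auto
  moreover have "W.span (f ` S) \<subseteq> f ` span S"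
    using in_own_span[OF S]
    by (intro W.span_is_subset submodule_image[OF f W span_is_submodule[OF S]]) auto
  ultimately show ?thesis by auto
qed

lemma fin_dim_image:
  assumes "f \<in> linear_maps U V" "vectorspace \<R> U" "vectorspace \<R> V" "vectorspace.fin_dim \<R> U"
    "f ` carrier U = carrier V"
  shows "vectorspace.fin_dim \<R> V"
proof -
  interpret U: vectorspace \<R> U by fact
  interpret V: vectorspace \<R> V by fact
  interpret linear_map \<R> U V f using assms(1) by unfold_locales
  show ?thesis using rank_nullity_main(2)[OF assms(4,5)] .
qed

lemma fin_dim_direct_sum:
  fixes U :: "(real, 'a, 'm) module_scheme" and V :: "(real, 'b, 'n) module_scheme"
  assumes U: "vectorspace \<R> U" "vectorspace.fin_dim \<R> U"
    and V: "vectorspace \<R> V" "vectorspace.fin_dim \<R> V"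
  shows "vectorspace.fin_dim \<R> (direct_sum U V)"
proof -
  interpret U: real_vs U using U by (simp add: real_vs_def)
  interpret V: real_vs V using V by (simp add: real_vs_def)
  have ds: "vectorspace \<R> (direct_sum U V)" using U V by (intro direct_sum_is_vs)
  interpret D: real_vs "direct_sum U V" using ds by (simp add: real_vs_def)
  obtain A where A: "finite A" "A \<subseteq> carrier U" "U.span A = carrier U"
    using U(2) unfolding U.fin_dim_def by blast
  obtain B where B: "finite B" "B \<subseteq> carrier V" "V.span B = carrier V"
    using V(2) unfolding V.fin_dim_def by blast
  let ?i = "\<lambda>x. (x, \<zero>\<^bsub>V\<^esub>)" and ?j = "\<lambda>y. (\<zero>\<^bsub>U\<^esub>, y)"
  have i: "?i \<in> linear_maps U (direct_sum U V)" and j: "?j \<in> linear_maps V (direct_sum U V)"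
    using V.smult_r_null U.smult_r_null by (auto intro!: linear_mapsI simp: direct_sum_def)
  let ?S = "?i ` A \<union> ?j ` B"
  have S: "?S \<subseteq> carrier (direct_sum U V)" using A B by (auto simp: direct_sum_def)
  have "carrier (direct_sum U V) \<subseteq> D.span ?S"
  proof
    fix z assume "z \<in> carrier (direct_sum U V)"
    then obtain x y where z: "z = (x, y)" "x \<in> carrier U" "y \<in> carrier V"
      by (auto simp: direct_sum_def)
    have "?i x \<in> D.span (?i ` A)"
      using U.image_span[OF i ds A(2)] A(3) z by blast
    then have 1: "?i x \<in> D.span ?S" using D.span_is_monotone[of "?i ` A" ?S] by blast
    have "?j y \<in> D.span (?j ` B)"
      using V.image_span[OF j ds B(2)] B(3) z by blast
    then have 2: "?j y \<in> D.span ?S" using D.span_is_monotone[of "?j ` B" ?S] by blast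
    have "z = ?i x \<oplus>\<^bsub>direct_sum U V\<^esub> ?j y" using z by (simp add: direct_sum_def)
    then show "z \<in> D.span ?S" using D.span_add1[OF S 1 2] by simp
  qed
  then show ?thesis unfolding D.fin_dim_def using A(1) B(1) S D.span_is_subset2[OF S]
    by (intro exI[of _ ?S]) auto
qed

text \<open>
  Applied to records that carry more fields than the vector space they are modelled on, such as
  extensions compared with direct sums, and to copies of a structure on another type.
\<close>
lemma vectorspace_transport:
  fixes U :: "(real, 'a, 'm) module_scheme" and V :: "(real, 'b, 'n) module_scheme"
  assumes V: "vectorspace \<R> V" and g: "bij_betw g (carrier U) (carrier V)"
    and zero: "\<zero>\<^bsub>U\<^esub> \<in> carrier U" "g \<zero>\<^bsub>U\<^esub> = \<zero>\<^bsub>V\<^esub>"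
    and add: "\<And>x y. x \<in> carrier U \<Longrightarrow> y \<in> carrier U \<Longrightarrow>
      x \<oplus>\<^bsub>U\<^esub> y \<in> carrier U \<and> g (x \<oplus>\<^bsub>U\<^esub> y) = g x \<oplus>\<^bsub>V\<^esub> g y"
    and smult: "\<And>c x. x \<in> carrier U \<Longrightarrow>
      c \<odot>\<^bsub>U\<^esub> x \<in> carrier U \<and> g (c \<odot>\<^bsub>U\<^esub> x) = c \<odot>\<^bsub>V\<^esub> g x"
  shows "vectorspace \<R> U"
proof -
  interpret V: real_vs V using V by (simp add: real_vs_def)
  have gc: "g x \<in> carrier V" if "x \<in> carrier U" for x using g that by (auto simp: bij_betw_def)
  have eqI: "x = y" if "x \<in> carrier U" "y \<in> carrier U" "g x = g y" for x y
    using g that by (auto simp: bij_betw_def inj_on_def)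
  show ?thesis
  proof (rule vs_criteria)
    show "field \<R>" by (rule class_field.field_axioms)
    show "\<forall>v\<in>carrier U. \<exists>w\<in>carrier U. v \<oplus>\<^bsub>U\<^esub> w = \<zero>\<^bsub>U\<^esub>"
    proof
      fix v assume v: "v \<in> carrier U"
      then have "\<ominus>\<^bsub>V\<^esub> g v \<in> g ` carrier U" using g gc by (auto simp: bij_betw_def)
      then obtain w where w: "w \<in> carrier U" "g w = \<ominus>\<^bsub>V\<^esub> g v" by auto
      then have "v \<oplus>\<^bsub>U\<^esub> w = \<zero>\<^bsub>U\<^esub>" using v zero add gc by (intro eqI) (auto simp: V.r_neg)
      with w show "\<exists>w\<in>carrier U. v \<oplus>\<^bsub>U\<^esub> w = \<zero>\<^bsub>U\<^esub>" by blast
    qed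
    show "\<forall>v w. v \<in> carrier U \<and> w \<in> carrier U \<longrightarrow> v \<oplus>\<^bsub>U\<^esub> w = w \<oplus>\<^bsub>U\<^esub> v"
      using add gc by (intro allI impI eqI) (auto simp: V.add.m_comm)
    show "\<forall>v w x. v \<in> carrier U \<and> w \<in> carrier U \<and> x \<in> carrier U \<longrightarrow>
        v \<oplus>\<^bsub>U\<^esub> w \<oplus>\<^bsub>U\<^esub> x = v \<oplus>\<^bsub>U\<^esub> (w \<oplus>\<^bsub>U\<^esub> x)"
      using add gc by (intro allI impI eqI) (auto simp: V.add.m_assoc)
    show "\<forall>v\<in>carrier U. v \<oplus>\<^bsub>U\<^esub> \<zero>\<^bsub>U\<^esub> = v"
      using add gc zero by (intro ballI eqI) auto
    show "\<forall>a b v. a \<in> carrier \<R> \<and> b \<in> carrier \<R> \<and> v \<in> carrier U \<longrightarrow>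
        (a \<otimes>\<^bsub>\<R>\<^esub> b) \<odot>\<^bsub>U\<^esub> v = a \<odot>\<^bsub>U\<^esub> (b \<odot>\<^bsub>U\<^esub> v)"
      using smult gc by (intro allI impI eqI) (auto simp: V.smult_smult)
    show "\<forall>v\<in>carrier U. \<one>\<^bsub>\<R>\<^esub> \<odot>\<^bsub>U\<^esub> v = v"
      using smult gc by (intro ballI eqI) (auto simp: V.smult_1)
    show "\<forall>a b v. a \<in> carrier \<R> \<and> b \<in> carrier \<R> \<and> v \<in> carrier U \<longrightarrow>
        (a \<oplus>\<^bsub>\<R>\<^esub> b) \<odot>\<^bsub>U\<^esub> v = a \<odot>\<^bsub>U\<^esub> v \<oplus>\<^bsub>U\<^esub> b \<odot>\<^bsub>U\<^esub> v"
      using add smult gc by (intro allI impI eqI) (auto simp: V.smult_add_left)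
    show "\<forall>a v w. a \<in> carrier \<R> \<and> v \<in> carrier U \<and> w \<in> carrier U \<longrightarrow>
        a \<odot>\<^bsub>U\<^esub> (v \<oplus>\<^bsub>U\<^esub> w) = a \<odot>\<^bsub>U\<^esub> v \<oplus>\<^bsub>U\<^esub> a \<odot>\<^bsub>U\<^esub> w"
      using add smult gc by (intro allI impI eqI) (auto simp: V.smult_add_right)
  qed (use zero add smult in auto)
qed

text \<open>
  The sets \<^const>\<open>quot_map\<close> and \<^const>\<open>quot_map2\<close> are unions over all representatives. They
  reduce to one coset as soon as the underlying map sends congruent arguments to congruent values.
\<close>
context real_vs
begin

context
  fixes N
  assumes subspace: "submodule \<R> N V"
begin

lemma subspace_closed: "x \<in> N \<Longrightarrow> x \<in> carrier V" "\<zero> \<in> N" "x \<in> N \<Longrightarrow> y \<in> N \<Longrightarrow> x \<oplus> y \<in> N"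
  "x \<in> N \<Longrightarrow> (c::real) \<odot> x \<in> N" 
  using submodule.subset[OF subspace] submodule.zero_closed[OF subspace] submodule.m_closed[OF subspace]
    submodule.smult_closed[OF subspace] by auto

lemma subspace_uminus: "x \<in> N \<Longrightarrow> \<ominus> x \<in> N"
  using subspace_closed(4)[of x "-1"] subspace_closed(1)[of x] smult_uminus_1[of x] by simp

lemma abelian_subgroup: "abelian_subgroup N V"
proof (rule abelian_subgroupI3)
  show "additive_subgroup N V"
  proof (intro additive_subgroup.intro subgroup.intro)
    show "inv\<^bsub>add_monoid V\<^esub> x \<in> N" if "x \<in> N" for x
      using subspace_uminus[OF that] by (simp only: a_inv_def)
  qed (use subspace_closed in auto)
qed (rule abelian_group_axioms)

lemmas coset_self = abelian_subgroup.a_rcos_self[OF abelian_subgroup]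

lemma mem_coset: "x \<in> carrier V \<Longrightarrow> z \<in> N +> x \<longleftrightarrow> z \<in> carrier V \<and> z \<ominus> x \<in> N"
  unfolding a_minus_def 
  using abelian_subgroup.a_rcos_module_rev[OF abelian_subgroup]
    abelian_subgroup.a_rcos_module_imp[OF abelian_subgroup]
    abelian_subgroup.a_elemrcos_carrier[OF abelian_subgroup] by blast

lemma coset_eq: "x \<in> carrier V \<Longrightarrow> y \<in> carrier V \<Longrightarrow> N +> x = N +> y \<longleftrightarrow> x \<ominus> y \<in> N"
  using mem_coset[of y x] a_repr_independence[of x N y, OF _ _ additive_subgroup.a_subgroup[OF abelian_subgroup.axioms(1)[OF abelian_subgroup]]] coset_self[of x] by auto

lemma quot_map_coset:
  assumes x: "x \<in> carrier V"
    and f: "\<And>a. a \<in> carrier V \<Longrightarrow> a \<ominus> x \<in> N \<Longrightarrow> N +> f a = N +> f x"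
  shows "quot_map V N f (N +> x) = N +> f x"
  using f mem_coset[OF x] coset_self[OF x] unfolding quot_map_def by blast

lemma quot_map2_coset:
  assumes x: "x \<in> carrier V" and y: "y \<in> carrier V"
    and f: "\<And>a b. a \<in> carrier V \<Longrightarrow> a \<ominus> x \<in> N \<Longrightarrow> b \<in> carrier V \<Longrightarrow> b \<ominus> y \<in> N \<Longrightarrow> N +> f a b = N +> f x y"
  shows "quot_map2 V N f (N +> x) (N +> y) = N +> f x y"
  using f mem_coset[OF x] coset_self[OF x] mem_coset[OF y] coset_self[OF y]
  unfolding quot_map2_def by blast

lemma carrier_quot: "carrier (quot_module V N) = (\<lambda>x. N +> x) ` carrier V"
  by (auto simp: quot_module_def A_RCOSETS_def')

lemma add_quot: "x \<in> carrier V \<Longrightarrow> y \<in> carrier V \<Longrightarrow>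
    (N +> x) \<oplus>\<^bsub>quot_module V N\<^esub> (N +> y) = N +> (x \<oplus> y)"
  by (simp add: quot_module_def abelian_subgroup.a_rcos_sum[OF abelian_subgroup])

lemma zero_quot: "\<zero>\<^bsub>quot_module V N\<^esub> = N +> \<zero>"
  using abelian_subgroup.a_rcos_const[OF abelian_subgroup, of "\<zero>"] subspace_closed(2) by (simp add: quot_module_def)

lemma smult_quot:
  assumes x: "x \<in> carrier V"
  shows "c \<odot>\<^bsub>quot_module V N\<^esub> (N +> x) = N +> (c \<odot> x)"
proof -
  have "quot_map V N (\<lambda>x. c \<odot> x) (N +> x) = N +> (c \<odot> x)"
  proof (rule quot_map_coset[OF x])
    fix a assume a: "a \<in> carrier V" "a \<ominus> x \<in> N"
    have "c \<odot> a \<ominus> c \<odot> x = c \<odot> (a \<ominus> x)"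
      using a x smult_r_minus[of c x] by (simp add: a_minus_def smult_add_right)
    then show "N +> c \<odot> a = N +> c \<odot> x"
      using a x subspace_closed(4)[of "a \<ominus> x" c] by (subst coset_eq) auto
  qed
  then show ?thesis by (simp add: quot_module_def quot_map_def)
qed

lemma uminus_quot:
  assumes x: "x \<in> carrier V"
  shows "\<ominus>\<^bsub>quot_module V N\<^esub> (N +> x) = N +> \<ominus> x"
proof -
  have "abelian_group (quot_module V N)"
  proof (rule abelian_groupI)
    show "\<exists>B\<in>carrier (quot_module V N). B \<oplus>\<^bsub>quot_module V N\<^esub> A = \<zero>\<^bsub>quot_module V N\<^esub>"
      if "A \<in> carrier (quot_module V N)" for A
    proof -
      from that obtain y where y: "A = N +> y" "y \<in> carrier V" by (auto simp: carrier_quot)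
      then have "(N +> \<ominus> y) \<oplus>\<^bsub>quot_module V N\<^esub> A = \<zero>\<^bsub>quot_module V N\<^esub>"
        by (simp add: add_quot zero_quot l_neg)
      moreover have "N +> \<ominus> y \<in> carrier (quot_module V N)" using y by (simp add: carrier_quot)
      ultimately show ?thesis by blast
    qed
    show "\<zero>\<^bsub>quot_module V N\<^esub> \<in> carrier (quot_module V N)" by (simp add: carrier_quot zero_quot)
    show "A \<oplus>\<^bsub>quot_module V N\<^esub> B \<in> carrier (quot_module V N)"
      if "A \<in> carrier (quot_module V N)" "B \<in> carrier (quot_module V N)" for A B
      using that by (auto simp: carrier_quot add_quot)
    show "A \<oplus>\<^bsub>quot_module V N\<^esub> B = B \<oplus>\<^bsub>quot_module V N\<^esub> A"
      if "A \<in> carrier (quot_module V N)" "B \<in> carrier (quot_module V N)" for A B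
      using that by (clarsimp simp: carrier_quot add_quot) (simp add: a_comm)
    show "A \<oplus>\<^bsub>quot_module V N\<^esub> B \<oplus>\<^bsub>quot_module V N\<^esub> C = A \<oplus>\<^bsub>quot_module V N\<^esub> (B \<oplus>\<^bsub>quot_module V N\<^esub> C)"
      if "A \<in> carrier (quot_module V N)" "B \<in> carrier (quot_module V N)" "C \<in> carrier (quot_module V N)" for A B C
      using that by (clarsimp simp: carrier_quot add_quot) (simp add: a_assoc)
    show "\<zero>\<^bsub>quot_module V N\<^esub> \<oplus>\<^bsub>quot_module V N\<^esub> A = A" if "A \<in> carrier (quot_module V N)" for A
      using that by (clarsimp simp: carrier_quot add_quot zero_quot)
  qed
  then interpret Q: abelian_group "quot_module V N" .
  show ?thesis using x
    by (intro Q.minus_equality) (simp_all add: carrier_quot add_quot zero_quot l_neg)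
qed

end

end

section \<open>Isomorphisms of triples and the quotient by the metric radical\<close>

lemma bilinear_mapD:
  assumes "bilinear_map U V W f"
  shows "x \<in> carrier U \<Longrightarrow> f x \<in> linear_maps V W"
    and "y \<in> carrier V \<Longrightarrow> (\<lambda>x. f x y) \<in> linear_maps U W"
  using assms by (auto simp: bilinear_map_def)

context pre_triple
begin

sublocale real_vs T
  by (simp add: real_vs_def vectorspace_axioms)

lemma bracket_right: "x \<in> carrier T \<Longrightarrow> lie_bracket T x \<in> linear_maps T T"
  and bracket_left: "y \<in> carrier T \<Longrightarrow> (\<lambda>x. lie_bracket T x y) \<in> linear_maps T T"
  using bilinear_mapD[OF bracket_bilinear] by auto

lemma form_right: "x \<in> carrier T \<Longrightarrow> form T x \<in> dual T"
  and form_left: "y \<in> carrier T \<Longrightarrow> (\<lambda>x. form T x y) \<in> dual T"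
  using bilinear_mapD[OF form_bilinear] by auto

lemma bracket_closed [simp]: "x \<in> carrier T \<Longrightarrow> y \<in> carrier T \<Longrightarrow> lie_bracket T x y \<in> carrier T"
  using linear_map_closed[OF bracket_right] .

lemma theta_closed [simp]: "x \<in> carrier T \<Longrightarrow> theta T x \<in> carrier T"
  using linear_map_closed[OF theta_linear] .

lemma dmap_closed [simp]: "x \<in> carrier T \<Longrightarrow> dmap T x \<in> carrier T"
  using linear_map_closed[OF dmap_linear] .

lemmas form_left_simps =
  dual_add[OF form_left] dual_smult[OF form_left] dual_zero[OF form_left vectorspace_axioms]
  dual_uminus[OF form_left vectorspace_axioms] dual_minus[OF form_left vectorspace_axioms]

lemmas form_right_simps =
  dual_add[OF form_right] dual_smult[OF form_right] dual_zero[OF form_right vectorspace_axioms]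
  dual_uminus[OF form_right vectorspace_axioms] dual_minus[OF form_right vectorspace_axioms]

lemma vector_eqI:
  assumes "x \<in> carrier T" "y \<in> carrier T" "\<And>f. f \<in> dual T \<Longrightarrow> f x = f y"
  shows "x = y"
  using dual_separates[OF vectorspace_axioms finite_dimensional] assms by blast

text \<open>
  By polarisation, expanding \<open>[x + y, x + y] = 0\<close>.
\<close>
lemma bracket_anticommute:
  assumes x: "x \<in> carrier T" and y: "y \<in> carrier T"
  shows "lie_bracket T x y = \<ominus> lie_bracket T y x"
proof (rule vector_eqI)
  fix f assume f: "f \<in> dual T"
  have "lie_bracket T (x \<oplus> y) (x \<oplus> y) = \<zero>" using x y bracket_alternating by simp
  then have "lie_bracket T x x \<oplus> lie_bracket T y x \<oplus> (lie_bracket T x y \<oplus> lie_bracket T y y) = \<zero>"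
    using x y by (simp add: linear_map_add[OF bracket_left] linear_map_add[OF bracket_right])
  then have "lie_bracket T x y \<oplus> lie_bracket T y x = \<zero>"
    using x y by (simp add: bracket_alternating a_comm)
  then have "f (lie_bracket T x y \<oplus> lie_bracket T y x) = 0"
    using dual_zero[OF f vectorspace_axioms] by simp
  then show "f (lie_bracket T x y) = f (\<ominus> lie_bracket T y x)"
    using x y by (simp add: dual_add[OF f] dual_uminus[OF f vectorspace_axioms])
qed (use x y in auto)

lemma radical_submodule: "submodule \<R> (metric_radical T) T"
  by (rule submoduleI) (auto simp: metric_radical_def form_left_simps)

lemma radical_theta: "x \<in> metric_radical T \<Longrightarrow> theta T x \<in> metric_radical T"
  using theta_form[of "theta T x", symmetric] theta_involutive[of x] by (auto simp: metric_radical_def)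

lemma radical_dmap: "x \<in> metric_radical T \<Longrightarrow> dmap T x \<in> metric_radical T"
  using dmap_antisymmetric by (auto simp: metric_radical_def)

text \<open>
  Invariance of the form moves \<open>ad y\<close> to the other argument, so that the radical is an ideal.
\<close>
lemma radical_bracket_right:
  assumes "x \<in> metric_radical T" "y \<in> carrier T"
  shows "lie_bracket T y x \<in> metric_radical T"
  using assms form_ad_invariant[of y x] by (auto simp: metric_radical_def)

lemma radical_bracket_left:
  assumes "x \<in> metric_radical T" "y \<in> carrier T"
  shows "lie_bracket T x y \<in> metric_radical T"
proof -
  have "x \<in> carrier T" using assms(1) by (simp add: metric_radical_def)
  from bracket_anticommute[OF this assms(2)] show ?thesis
    using subspace_uminus[OF radical_submodule, OF radical_bracket_right[OF assms]] by metis
qed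

end

lemma triple_isosD:
  assumes "h \<in> triple_isos S T"
  shows "h \<in> linear_maps S T" "bij_betw h (carrier S) (carrier T)"
    "x \<in> carrier S \<Longrightarrow> y \<in> carrier S \<Longrightarrow> h (lie_bracket S x y) = lie_bracket T (h x) (h y)"
    "x \<in> carrier S \<Longrightarrow> y \<in> carrier S \<Longrightarrow> form S x y = form T (h x) (h y)"
    "x \<in> carrier S \<Longrightarrow> dmap T (h x) = h (dmap S x)"
    "x \<in> carrier S \<Longrightarrow> theta T (h x) = h (theta S x)"
  using assms by (auto simp: triple_isos_def linear_isos_def)

lemma triple_isosI:
  assumes "h \<in> linear_maps S T" "bij_betw h (carrier S) (carrier T)"
    "\<And>x y. x \<in> carrier S \<Longrightarrow> y \<in> carrier S \<Longrightarrow> h (lie_bracket S x y) = lie_bracket T (h x) (h y)"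
    "\<And>x y. x \<in> carrier S \<Longrightarrow> y \<in> carrier S \<Longrightarrow> form S x y = form T (h x) (h y)"
    "\<And>x. x \<in> carrier S \<Longrightarrow> dmap T (h x) = h (dmap S x)"
    "\<And>x. x \<in> carrier S \<Longrightarrow> theta T (h x) = h (theta S x)"
  shows "h \<in> triple_isos S T"
  using assms by (auto simp: triple_isos_def linear_isos_def)

lemma linear_map_compose: "f \<in> linear_maps U V \<Longrightarrow> g \<in> linear_maps V W \<Longrightarrow> g \<circ> f \<in> linear_maps U W"
  by (auto intro!: linear_mapsI simp: linear_map_closed linear_map_add linear_map_smult)

lemma isomorphic_triples_refl: "T \<cong>\<^sub>t T"
proof -
  have "id \<in> triple_isos T T" by (auto intro!: triple_isosI linear_mapsI)
  then show ?thesis by (auto simp: isomorphic_triples_def)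
qed

lemma isomorphic_triples_trans:
  assumes "S \<cong>\<^sub>t T" "T \<cong>\<^sub>t U"
  shows "S \<cong>\<^sub>t U"
proof -
  obtain h k where h: "h \<in> triple_isos S T" and k: "k \<in> triple_isos T U"
    using assms by (auto simp: isomorphic_triples_def)
  have hc: "h x \<in> carrier T" if "x \<in> carrier S" for x
    using linear_map_closed[OF triple_isosD(1)[OF h] that] .
  have "k \<circ> h \<in> triple_isos S U"
  proof (rule triple_isosI)
    show "k \<circ> h \<in> linear_maps S U" by (rule linear_map_compose[OF triple_isosD(1)[OF h] triple_isosD(1)[OF k]])
    show "bij_betw (k \<circ> h) (carrier S) (carrier U)"
      by (rule bij_betw_trans[OF triple_isosD(2)[OF h] triple_isosD(2)[OF k]])
  qed (simp_all add: hc triple_isosD(3-6)[OF h] triple_isosD(3-6)[OF k])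
  then show ?thesis by (auto simp: isomorphic_triples_def)
qed

lemma inv_into_linear:
  assumes S: "vectorspace \<R> S" and h: "h \<in> linear_maps S T" and b: "bij_betw h (carrier S) (carrier T)"
  shows "inv_into (carrier S) h \<in> linear_maps T S"
proof -
  interpret S: real_vs S using S by (simp add: real_vs_def)
  let ?k = "inv_into (carrier S) h"
  have eq: "?k y = x" if "x \<in> carrier S" "h x = y" for x y
    using that b bij_betw_inv_into_left by metis
  have kc: "?k y \<in> carrier S" if "y \<in> carrier T" for y
    using that b by (metis bij_betw_imp_surj_on inv_into_into)
  have hk: "h (?k y) = y" if "y \<in> carrier T" for y
    using that b by (metis bij_betw_inv_into_right)
  show ?thesis
    by (rule linear_mapsI)
      (auto intro!: eq simp: kc hk linear_map_add[OF h] linear_map_smult[OF h])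
qed

lemma (in pre_triple) isomorphic_triples_sym:
  fixes S :: "('b, 'n) lie_triple_scheme"
  assumes "T \<cong>\<^sub>t S"
  shows "S \<cong>\<^sub>t T"
proof -
  obtain h where h: "h \<in> triple_isos T S"
    using assms by (auto simp: isomorphic_triples_def)
  let ?k = "inv_into (carrier T) h"
  note b = triple_isosD(2)[OF h]
  have eq: "?k y = x" if "x \<in> carrier T" "h x = y" for x y
    using that b bij_betw_inv_into_left by metis
  have kc [simp]: "?k y \<in> carrier T" if "y \<in> carrier S" for y
    using that b by (metis bij_betw_imp_surj_on inv_into_into)
  have hk [simp]: "h (?k y) = y" if "y \<in> carrier S" for y
    using that b by (metis bij_betw_inv_into_right)
  have "?k \<in> triple_isos S T"
  proof (rule triple_isosI)
    show "?k \<in> linear_maps S T"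
      by (rule inv_into_linear[OF vectorspace_axioms triple_isosD(1)[OF h] b])
    show "bij_betw ?k (carrier S) (carrier T)" by (rule bij_betw_inv_into[OF b])
    show "?k (lie_bracket S x y) = lie_bracket T (?k x) (?k y)"
      if "x \<in> carrier S" "y \<in> carrier S" for x y
      using that by (intro eq) (auto simp: triple_isosD(3)[OF h])
    show "form S x y = form T (?k x) (?k y)" if "x \<in> carrier S" "y \<in> carrier S" for x y
      using that by (simp add: triple_isosD(4)[OF h])
    show "dmap T (?k x) = ?k (dmap S x)" if "x \<in> carrier S" for x
      using that triple_isosD(5)[OF h, of "?k x"] by (intro eq[symmetric]) auto
    show "theta T (?k x) = ?k (theta S x)" if "x \<in> carrier S" for x
      using that triple_isosD(6)[OF h, of "?k x"] by (intro eq[symmetric]) auto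
  qed
  then show ?thesis by (auto simp: isomorphic_triples_def)
qed

text \<open>
  The surjective morphisms of triples. Onto a non-degenerate triple they are the isomorphisms from
  the quotient by the metric radical, described without cosets.
\<close>
definition triple_projections ::
  "('a, 'm) lie_triple_scheme \<Rightarrow> ('b, 'n) lie_triple_scheme \<Rightarrow> ('a \<Rightarrow> 'b) set" where
  "triple_projections S T = {\<pi> \<in> linear_maps S T. \<pi> ` carrier S = carrier T \<and>
    (\<forall>x\<in>carrier S. \<forall>y\<in>carrier S. \<pi> (lie_bracket S x y) = lie_bracket T (\<pi> x) (\<pi> y)) \<and>
    (\<forall>x\<in>carrier S. \<forall>y\<in>carrier S. form S x y = form T (\<pi> x) (\<pi> y)) \<and>
    (\<forall>x\<in>carrier S. dmap T (\<pi> x) = \<pi> (dmap S x)) \<and>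
    (\<forall>x\<in>carrier S. theta T (\<pi> x) = \<pi> (theta S x))}"

lemma triple_projectionsD:
  assumes "\<pi> \<in> triple_projections S T"
  shows "\<pi> \<in> linear_maps S T" "\<pi> ` carrier S = carrier T"
    "x \<in> carrier S \<Longrightarrow> y \<in> carrier S \<Longrightarrow> \<pi> (lie_bracket S x y) = lie_bracket T (\<pi> x) (\<pi> y)"
    "x \<in> carrier S \<Longrightarrow> y \<in> carrier S \<Longrightarrow> form S x y = form T (\<pi> x) (\<pi> y)"
    "x \<in> carrier S \<Longrightarrow> dmap T (\<pi> x) = \<pi> (dmap S x)"
    "x \<in> carrier S \<Longrightarrow> theta T (\<pi> x) = \<pi> (theta S x)"
  using assms by (auto simp: triple_projections_def)

text \<open>
  As \<open>\<pi>\<close> is surjective and preserves the forms, \<open>x\<close> is orthogonal to everything exactly if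
  \<open>\<pi> x\<close> is, and in \<open>T0\<close> only the zero vector is orthogonal to everything.
\<close>
lemma radical_eq_kernel:
  assumes "extrinsic_symmetric_triple T0" "\<pi> \<in> triple_projections T T0"
  shows "metric_radical T = {x \<in> carrier T. \<pi> x = \<zero>\<^bsub>T0\<^esub>}"
proof -
  interpret T0: extrinsic_symmetric_triple T0 by fact
  note \<pi> = triple_projectionsD[OF assms(2)]
  have "(\<forall>y\<in>carrier T. form T x y = 0) \<longleftrightarrow> \<pi> x = \<zero>\<^bsub>T0\<^esub>" if x: "x \<in> carrier T" for x
  proof -
    have "(\<forall>y\<in>carrier T. form T x y = 0) \<longleftrightarrow> (\<forall>z\<in>\<pi> ` carrier T. form T0 (\<pi> x) z = 0)"
      using x by (auto simp: \<pi>(4))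
    also have "\<dots> \<longleftrightarrow> (\<forall>z\<in>carrier T0. form T0 (\<pi> x) z = 0)" by (simp only: \<pi>(2))
    also have "\<dots> \<longleftrightarrow> \<pi> x = \<zero>\<^bsub>T0\<^esub>"
      using T0.nondegenerate linear_map_closed[OF \<pi>(1) x]
      by (auto simp: nondegenerate_on_def T0.form_left_simps)
    finally show ?thesis .
  qed
  then show ?thesis by (auto simp: metric_radical_def)
qed

context pre_triple
begin

text \<open>
  The metric radical is an ideal that is stable under \<open>D\<close> and \<open>\<theta>\<close> and orthogonal to everything,
  so the structure maps of the quotient can be computed on representatives.
\<close>
lemma radical_quotient_simps:
  "carrier (radical_quotient T) = (\<lambda>x. metric_radical T +> x) ` carrier T"
  "x \<in> carrier T \<Longrightarrow> y \<in> carrier T \<Longrightarrow>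
    (metric_radical T +> x) \<oplus>\<^bsub>radical_quotient T\<^esub> (metric_radical T +> y) = metric_radical T +> (x \<oplus> y)"
  "x \<in> carrier T \<Longrightarrow> c \<odot>\<^bsub>radical_quotient T\<^esub> (metric_radical T +> x) = metric_radical T +> (c \<odot> x)"
  "x \<in> carrier T \<Longrightarrow> y \<in> carrier T \<Longrightarrow>
    lie_bracket (radical_quotient T) (metric_radical T +> x) (metric_radical T +> y)
      = metric_radical T +> lie_bracket T x y"
  "x \<in> carrier T \<Longrightarrow> y \<in> carrier T \<Longrightarrow>
    form (radical_quotient T) (metric_radical T +> x) (metric_radical T +> y) = form T x y"
  "x \<in> carrier T \<Longrightarrow> dmap (radical_quotient T) (metric_radical T +> x) = metric_radical T +> dmap T x"
  "x \<in> carrier T \<Longrightarrow> theta (radical_quotient T) (metric_radical T +> x) = metric_radical T +> theta T x"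
proof -
  let ?N = "metric_radical T"
  note defs = radical_quotient_def Let_def lie.defs module.defs lie_triple.defs
  have q: "carrier (radical_quotient T) = carrier (quot_module T ?N)"
    "add (radical_quotient T) = add (quot_module T ?N)"
    "smult (radical_quotient T) = smult (quot_module T ?N)"
    by (simp_all add: defs)
  show "carrier (radical_quotient T) = (\<lambda>x. ?N +> x) ` carrier T"
    by (simp add: q carrier_quot[OF radical_submodule])
  show "(?N +> x) \<oplus>\<^bsub>radical_quotient T\<^esub> (?N +> y) = ?N +> (x \<oplus> y)"
    if "x \<in> carrier T" "y \<in> carrier T" for x y
    using that by (simp add: q add_quot[OF radical_submodule])
  show "c \<odot>\<^bsub>radical_quotient T\<^esub> (?N +> x) = ?N +> (c \<odot> x)" if "x \<in> carrier T" for x c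
    using that by (simp add: q smult_quot[OF radical_submodule])
  show "dmap (radical_quotient T) (?N +> x) = ?N +> dmap T x" if x: "x \<in> carrier T" for x
  proof -
    have "quot_map T ?N (dmap T) (?N +> x) = ?N +> dmap T x"
    proof (rule quot_map_coset[OF radical_submodule, OF x])
      fix a assume a: "a \<in> carrier T" "a \<ominus> x \<in> ?N"
      have "dmap T a \<ominus> dmap T x = dmap T (a \<ominus> x)"
        using a x by (simp add: a_minus_def linear_map_add[OF dmap_linear]
            linear_map_uminus[OF dmap_linear vectorspace_axioms vectorspace_axioms])
      then show "?N +> dmap T a = ?N +> dmap T x"
        using radical_dmap[OF a(2)] a x by (simp add: coset_eq[OF radical_submodule])
    qed
    then show ?thesis by (simp add: defs)
  qed
  show "theta (radical_quotient T) (?N +> x) = ?N +> theta T x" if x: "x \<in> carrier T" for x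
  proof -
    have "quot_map T ?N (theta T) (?N +> x) = ?N +> theta T x"
    proof (rule quot_map_coset[OF radical_submodule, OF x])
      fix a assume a: "a \<in> carrier T" "a \<ominus> x \<in> ?N"
      have "theta T a \<ominus> theta T x = theta T (a \<ominus> x)"
        using a x by (simp add: a_minus_def linear_map_add[OF theta_linear]
            linear_map_uminus[OF theta_linear vectorspace_axioms vectorspace_axioms])
      then show "?N +> theta T a = ?N +> theta T x"
        using radical_theta[OF a(2)] a x by (simp add: coset_eq[OF radical_submodule])
    qed
    then show ?thesis by (simp add: defs)
  qed
  show "lie_bracket (radical_quotient T) (?N +> x) (?N +> y) = ?N +> lie_bracket T x y"
    if x: "x \<in> carrier T" and y: "y \<in> carrier T" for x y
  proof -
    have "quot_map2 T ?N (lie_bracket T) (?N +> x) (?N +> y) = ?N +> lie_bracket T x y"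
    proof (rule quot_map2_coset[OF radical_submodule, OF x y])
      fix a b assume a: "a \<in> carrier T" "a \<ominus> x \<in> ?N" and b: "b \<in> carrier T" "b \<ominus> y \<in> ?N"
      have "lie_bracket T a b \<ominus> lie_bracket T x y = lie_bracket T (a \<ominus> x) b \<oplus> lie_bracket T x (b \<ominus> y)"
      proof (rule vector_eqI)
        fix f assume f: "f \<in> dual T"
        show "f (lie_bracket T a b \<ominus> lie_bracket T x y) = f (lie_bracket T (a \<ominus> x) b \<oplus> lie_bracket T x (b \<ominus> y))"
          using a b x y by (simp add: a_minus_def dual_add[OF f] dual_uminus[OF f vectorspace_axioms]
              linear_map_add[OF bracket_left] linear_map_add[OF bracket_right]
              linear_map_uminus[OF bracket_left vectorspace_axioms vectorspace_axioms]
              linear_map_uminus[OF bracket_right vectorspace_axioms vectorspace_axioms])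
      qed (use a b x y in auto)
      also have "\<dots> \<in> ?N"
        using radical_bracket_left[OF a(2) b(1)] radical_bracket_right[OF b(2) x] subspace_closed(3)[OF radical_submodule] by blast
      finally show "?N +> lie_bracket T a b = ?N +> lie_bracket T x y"
        using a b x y by (simp add: coset_eq[OF radical_submodule])
    qed
    then show ?thesis by (simp add: defs)
  qed
  show "form (radical_quotient T) (?N +> x) (?N +> y) = form T x y"
    if x: "x \<in> carrier T" and y: "y \<in> carrier T" for x y
  proof -
    have "form T a b = form T x y" if "a \<in> ?N +> x" "b \<in> ?N +> y" for a b
    proof -
      have a: "a \<in> carrier T" "a \<ominus> x \<in> ?N" and b: "b \<in> carrier T" "b \<ominus> y \<in> ?N"
        using that x y by (auto simp: mem_coset[OF radical_submodule])
      have "form T (a \<ominus> x) b = 0" "form T (b \<ominus> y) x = 0" using a b x by (auto simp: metric_radical_def)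
      then show ?thesis using a b x y form_symmetric[of b x] form_symmetric[of y x] by (simp add: form_left_simps)
    qed
    moreover have "x \<in> ?N +> x" "y \<in> ?N +> y" using x y coset_self[OF radical_submodule] by auto
    ultimately have "(THE c. \<exists>a\<in>?N +> x. \<exists>b\<in>?N +> y. c = form T a b) = form T x y" by blast
    then show ?thesis by (simp add: defs)
  qed
qed

text \<open>
  Composition with the coset map turns an isomorphism into a projection. Conversely the kernel of
  a projection is the metric radical, so it induces a bijection on cosets.
\<close>
lemma radical_quotient_isomorphic_iff:
  fixes T0 :: "('b, 'n) lie_triple_scheme"
  assumes T0: "extrinsic_symmetric_triple T0"
  shows "radical_quotient T \<cong>\<^sub>t T0 \<longleftrightarrow> triple_projections T T0 \<noteq> {}"
proof
  let ?N = "metric_radical T"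
  assume "radical_quotient T \<cong>\<^sub>t T0"
  then obtain h where h: "h \<in> triple_isos (radical_quotient T) T0" by (auto simp: isomorphic_triples_def)
  note hD = triple_isosD[OF h]
  have qc: "?N +> x \<in> carrier (radical_quotient T)" if "x \<in> carrier T" for x
    using that by (simp add: radical_quotient_simps)
  have "(\<lambda>x. h (?N +> x)) \<in> triple_projections T T0"
    unfolding triple_projections_def
  proof (intro CollectI conjI ballI)
    show "(\<lambda>x. h (?N +> x)) \<in> linear_maps T T0"
      using linear_map_closed[OF hD(1) qc] linear_map_add[OF hD(1) qc qc, symmetric]
        linear_map_smult[OF hD(1) qc, symmetric]
      by (intro linear_mapsI) (auto simp: radical_quotient_simps)
    show "(\<lambda>x. h (?N +> x)) ` carrier T = carrier T0"
      using hD(2) by (auto simp: bij_betw_def radical_quotient_simps image_image)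
  qed (simp_all add: hD(3,4)[OF qc qc, symmetric] hD(5,6)[OF qc] radical_quotient_simps)
  then show "triple_projections T T0 \<noteq> {}" by blast
next
  let ?N = "metric_radical T"
  interpret T0: extrinsic_symmetric_triple T0 by fact
  assume "triple_projections T T0 \<noteq> {}"
  then obtain \<pi> where pr: "\<pi> \<in> triple_projections T T0" by blast
  note \<pi> = triple_projectionsD[OF pr]
  have \<pi>_minus: "\<pi> (x \<ominus> y) = \<pi> x \<ominus>\<^bsub>T0\<^esub> \<pi> y" if "x \<in> carrier T" "y \<in> carrier T" for x y
    using that by (simp add: a_minus_def linear_map_add[OF \<pi>(1)]
      linear_map_uminus[OF \<pi>(1) vectorspace_axioms T0.vectorspace_axioms])
  have \<pi>_eq: "\<pi> x = \<pi> y \<longleftrightarrow> ?N +> x = ?N +> y" if "x \<in> carrier T" "y \<in> carrier T" for x y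
  proof -
    have "\<pi> x \<in> carrier T0" "\<pi> y \<in> carrier T0" using that linear_map_closed[OF \<pi>(1)] by auto
    then have "x \<ominus> y \<in> ?N \<longleftrightarrow> \<pi> x = \<pi> y"
      unfolding radical_eq_kernel[OF T0 pr] using that \<pi>_minus by auto
    then show ?thesis using that by (simp add: coset_eq[OF radical_submodule])
  qed
  define h where "h A = \<pi> (SOME x. x \<in> carrier T \<and> A = ?N +> x)" for A
  have h: "h (?N +> x) = \<pi> x" if "x \<in> carrier T" for x
  proof -
    define y where "y = (SOME y. y \<in> carrier T \<and> ?N +> x = ?N +> y)"
    have y: "y \<in> carrier T \<and> ?N +> x = ?N +> y"
      unfolding y_def by (rule someI[of _ x]) (use that in simp)
    then have "\<pi> x = \<pi> y" using \<pi>_eq[OF that, of y] by simp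
    then show ?thesis by (simp add: h_def y_def)
  qed
  have "h \<in> triple_isos (radical_quotient T) T0"
  proof (rule triple_isosI)
    show "h \<in> linear_maps (radical_quotient T) T0"
      by (rule linear_mapsI) (auto simp: radical_quotient_simps h linear_map_closed[OF \<pi>(1)]
        linear_map_add[OF \<pi>(1)] linear_map_smult[OF \<pi>(1)])
    have "inj_on h (carrier (radical_quotient T))"
      by (rule inj_onI) (auto simp: radical_quotient_simps(1) h \<pi>_eq)
    moreover have "h ` carrier (radical_quotient T) = carrier T0"
      using \<pi>(2) by (auto simp: radical_quotient_simps(1) h image_image)
    ultimately show "bij_betw h (carrier (radical_quotient T)) (carrier T0)" by (simp add: bij_betw_def)
  qed (auto simp: radical_quotient_simps h \<pi>(3-6))
  then show "radical_quotient T \<cong>\<^sub>t T0" by (auto simp: isomorphic_triples_def)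
qed

end

section \<open>Second cohomology with trivial coefficients\<close>

lemma mem_cocycles_iff:
  "\<omega> \<in> cocycles L R \<longleftrightarrow> \<omega> \<in> extensional (carrier L \<times> carrier L) \<and>
    (\<forall>x\<in>carrier L. (\<lambda>y. \<omega> (x, y)) \<in> linear_maps L R) \<and>
    (\<forall>y\<in>carrier L. (\<lambda>x. \<omega> (x, y)) \<in> linear_maps L R) \<and>
    (\<forall>x\<in>carrier L. \<omega> (x, x) = \<zero>\<^bsub>R\<^esub>) \<and>
    (\<forall>x\<in>carrier L. \<forall>y\<in>carrier L. \<forall>z\<in>carrier L.
      \<omega> (lie_bracket L x y, z) \<oplus>\<^bsub>R\<^esub> \<omega> (lie_bracket L y z, x) \<oplus>\<^bsub>R\<^esub> \<omega> (lie_bracket L z x, y) = \<zero>\<^bsub>R\<^esub>)"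
  by (auto simp: cocycles_def bilinear_map_def curry_def)

lemma
  assumes "\<omega> \<in> cocycles L R"
  shows cocycle_extensional: "\<omega> \<in> extensional (carrier L \<times> carrier L)"
    and cocycle_right: "x \<in> carrier L \<Longrightarrow> (\<lambda>y. \<omega> (x, y)) \<in> linear_maps L R"
    and cocycle_left: "y \<in> carrier L \<Longrightarrow> (\<lambda>x. \<omega> (x, y)) \<in> linear_maps L R"
    and cocycle_alternating: "x \<in> carrier L \<Longrightarrow> \<omega> (x, x) = \<zero>\<^bsub>R\<^esub>"
    and cocycle_cyclic: "x \<in> carrier L \<Longrightarrow> y \<in> carrier L \<Longrightarrow> z \<in> carrier L \<Longrightarrow>
      \<omega> (lie_bracket L x y, z) \<oplus>\<^bsub>R\<^esub> \<omega> (lie_bracket L y z, x) \<oplus>\<^bsub>R\<^esub> \<omega> (lie_bracket L z x, y) = \<zero>\<^bsub>R\<^esub>"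
  using assms by (auto simp: mem_cocycles_iff)

locale triple_with_coefficients = pre_triple T for T :: "('a, 'm) lie_triple_scheme" (structure) +
  fixes R :: "(real, 'r) module"
  assumes R_vectorspace: "vectorspace \<R> R" and R_fin_dim: "vectorspace.fin_dim \<R> R"
begin

lemma R_real_vs: "real_vs R"
  using R_vectorspace by (simp add: real_vs_def)

lemma coeff_eqI:
  assumes "x \<in> carrier R" "y \<in> carrier R" "\<And>f. f \<in> dual R \<Longrightarrow> f x = f y"
  shows "x = y"
  using dual_separates[OF R_vectorspace R_fin_dim] assms by blast

lemma R_add_closed [simp]: "r \<in> carrier R \<Longrightarrow> s \<in> carrier R \<Longrightarrow> r \<oplus>\<^bsub>R\<^esub> s \<in> carrier R"
  and R_smult_closed [simp]: "r \<in> carrier R \<Longrightarrow> c \<odot>\<^bsub>R\<^esub> r \<in> carrier R"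
  and R_zero_closed [simp]: "\<zero>\<^bsub>R\<^esub> \<in> carrier R"
  and R_uminus_closed [simp]: "r \<in> carrier R \<Longrightarrow> \<ominus>\<^bsub>R\<^esub> r \<in> carrier R"
proof -
  interpret R: real_vs R by (rule R_real_vs)
  show "r \<in> carrier R \<Longrightarrow> s \<in> carrier R \<Longrightarrow> r \<oplus>\<^bsub>R\<^esub> s \<in> carrier R" by simp
  show "r \<in> carrier R \<Longrightarrow> c \<odot>\<^bsub>R\<^esub> r \<in> carrier R" by simp
  show "\<zero>\<^bsub>R\<^esub> \<in> carrier R" by simp
  show "r \<in> carrier R \<Longrightarrow> \<ominus>\<^bsub>R\<^esub> r \<in> carrier R" by simp
qed

lemmas scalar_simps =
  dual_zero[OF _ R_vectorspace] dual_add[where V=R] dual_smult[where V=R] dual_uminus[OF _ R_vectorspace]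

lemma linear_map_simps:
  assumes "\<eta> \<in> linear_maps T R"
  shows "x \<in> carrier T \<Longrightarrow> \<eta> x \<in> carrier R"
    "x \<in> carrier T \<Longrightarrow> y \<in> carrier T \<Longrightarrow> \<eta> (x \<oplus> y) = \<eta> x \<oplus>\<^bsub>R\<^esub> \<eta> y"
    "x \<in> carrier T \<Longrightarrow> \<eta> (c \<odot> x) = c \<odot>\<^bsub>R\<^esub> \<eta> x"
    "\<eta> \<zero> = \<zero>\<^bsub>R\<^esub>"
    "x \<in> carrier T \<Longrightarrow> \<eta> (\<ominus> x) = \<ominus>\<^bsub>R\<^esub> \<eta> x"
  using linear_map_closed[OF assms] linear_map_add[OF assms] linear_map_smult[OF assms]
    linear_map_zero[OF assms vectorspace_axioms R_vectorspace]
    linear_map_uminus[OF assms vectorspace_axioms R_vectorspace] by auto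

lemma linear_map_to_coeffI:
  assumes "\<And>x. x \<in> carrier T \<Longrightarrow> \<eta> x \<in> carrier R"
    "\<And>f x y. f \<in> dual R \<Longrightarrow> x \<in> carrier T \<Longrightarrow> y \<in> carrier T \<Longrightarrow> f (\<eta> (x \<oplus> y)) = f (\<eta> x) + f (\<eta> y)"
    "\<And>f c x. f \<in> dual R \<Longrightarrow> x \<in> carrier T \<Longrightarrow> f (\<eta> (c \<odot> x)) = c * f (\<eta> x)"
  shows "\<eta> \<in> linear_maps T R"
  using assms by (intro linear_mapsI coeff_eqI) (auto simp: scalar_simps)

text \<open>
  The cocycle conditions are stated after applying a functional, which turns them into equations
  between real numbers.
\<close>
lemma cocyclesI:
  assumes "\<omega> \<in> extensional (carrier T \<times> carrier T)"
    and closed: "\<And>x y. x \<in> carrier T \<Longrightarrow> y \<in> carrier T \<Longrightarrow> \<omega> (x, y) \<in> carrier R"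
    and "\<And>f x y z. f \<in> dual R \<Longrightarrow> x \<in> carrier T \<Longrightarrow> y \<in> carrier T \<Longrightarrow> z \<in> carrier T \<Longrightarrow>
      f (\<omega> (x, y \<oplus> z)) = f (\<omega> (x, y)) + f (\<omega> (x, z))"
    and "\<And>f x y z. f \<in> dual R \<Longrightarrow> x \<in> carrier T \<Longrightarrow> y \<in> carrier T \<Longrightarrow> z \<in> carrier T \<Longrightarrow>
      f (\<omega> (x \<oplus> y, z)) = f (\<omega> (x, z)) + f (\<omega> (y, z))"
    and "\<And>f x y c. f \<in> dual R \<Longrightarrow> x \<in> carrier T \<Longrightarrow> y \<in> carrier T \<Longrightarrow>
      f (\<omega> (x, c \<odot> y)) = c * f (\<omega> (x, y))"
    and "\<And>f x y c. f \<in> dual R \<Longrightarrow> x \<in> carrier T \<Longrightarrow> y \<in> carrier T \<Longrightarrow>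
      f (\<omega> (c \<odot> x, y)) = c * f (\<omega> (x, y))"
    and "\<And>f x. f \<in> dual R \<Longrightarrow> x \<in> carrier T \<Longrightarrow> f (\<omega> (x, x)) = 0"
    and "\<And>f x y z. f \<in> dual R \<Longrightarrow> x \<in> carrier T \<Longrightarrow> y \<in> carrier T \<Longrightarrow> z \<in> carrier T \<Longrightarrow>
      f (\<omega> (lie_bracket T x y, z)) + f (\<omega> (lie_bracket T y z, x)) + f (\<omega> (lie_bracket T z x, y)) = 0"
  shows "\<omega> \<in> cocycles T R"
  unfolding mem_cocycles_iff
proof (intro conjI ballI)
  show "(\<lambda>y. \<omega> (x, y)) \<in> linear_maps T R" if "x \<in> carrier T" for x
    using assms that by (intro linear_map_to_coeffI) auto
  show "(\<lambda>x. \<omega> (x, y)) \<in> linear_maps T R" if "y \<in> carrier T" for y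
    using assms that by (intro linear_map_to_coeffI) auto
  show "\<omega> (x, x) = \<zero>\<^bsub>R\<^esub>" if "x \<in> carrier T" for x
    using assms that by (intro coeff_eqI) (auto simp: scalar_simps)
  show "\<omega> (lie_bracket T x y, z) \<oplus>\<^bsub>R\<^esub> \<omega> (lie_bracket T y z, x) \<oplus>\<^bsub>R\<^esub> \<omega> (lie_bracket T z x, y) = \<zero>\<^bsub>R\<^esub>"
    if "x \<in> carrier T" "y \<in> carrier T" "z \<in> carrier T" for x y z
    using assms(8)[OF _ that] that closed by (intro coeff_eqI) (auto simp: scalar_simps)
qed (fact assms(1))

lemma cocycle_simps:
  assumes "\<omega> \<in> cocycles T R"
  shows "x \<in> carrier T \<Longrightarrow> y \<in> carrier T \<Longrightarrow> \<omega> (x, y) \<in> carrier R"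
    "x \<in> carrier T \<Longrightarrow> y \<in> carrier T \<Longrightarrow> z \<in> carrier T \<Longrightarrow> \<omega> (x, y \<oplus> z) = \<omega> (x, y) \<oplus>\<^bsub>R\<^esub> \<omega> (x, z)"
    "x \<in> carrier T \<Longrightarrow> y \<in> carrier T \<Longrightarrow> z \<in> carrier T \<Longrightarrow> \<omega> (x \<oplus> y, z) = \<omega> (x, z) \<oplus>\<^bsub>R\<^esub> \<omega> (y, z)"
    "x \<in> carrier T \<Longrightarrow> y \<in> carrier T \<Longrightarrow> \<omega> (x, c \<odot> y) = c \<odot>\<^bsub>R\<^esub> \<omega> (x, y)"
    "x \<in> carrier T \<Longrightarrow> y \<in> carrier T \<Longrightarrow> \<omega> (c \<odot> x, y) = c \<odot>\<^bsub>R\<^esub> \<omega> (x, y)"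
    "x \<in> carrier T \<Longrightarrow> y \<in> carrier T \<Longrightarrow> \<omega> (x, \<ominus> y) = \<ominus>\<^bsub>R\<^esub> \<omega> (x, y)"
    "x \<in> carrier T \<Longrightarrow> y \<in> carrier T \<Longrightarrow> \<omega> (\<ominus> x, y) = \<ominus>\<^bsub>R\<^esub> \<omega> (x, y)"
    "x \<in> carrier T \<Longrightarrow> \<omega> (x, x) = \<zero>\<^bsub>R\<^esub>"
  using linear_map_simps[OF cocycle_right[OF assms]] linear_map_simps[OF cocycle_left[OF assms]]
    cocycle_alternating[OF assms] by auto

lemma scalar_cyclic:
  assumes "\<omega> \<in> cocycles T R" "f \<in> dual R" "x \<in> carrier T" "y \<in> carrier T" "z \<in> carrier T"
  shows "f (\<omega> (lie_bracket T x y, z)) + f (\<omega> (lie_bracket T y z, x)) + f (\<omega> (lie_bracket T z x, y)) = 0"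
  using arg_cong[OF cocycle_cyclic[OF assms(1,3-5)], of f] assms
  by (simp add: scalar_simps cocycle_simps[OF assms(1)])

lemma jacobi_under_linear_map:
  assumes "\<eta> \<in> linear_maps T R" "f \<in> dual R" "x \<in> carrier T" "y \<in> carrier T" "z \<in> carrier T"
  shows "f (\<eta> (lie_bracket T (lie_bracket T x y) z)) + f (\<eta> (lie_bracket T (lie_bracket T y z) x))
    + f (\<eta> (lie_bracket T (lie_bracket T z x) y)) = 0"
  using arg_cong[OF jacobi[OF assms(3-5)], of "\<lambda>v. f (\<eta> v)"] assms
  by (simp add: scalar_simps linear_map_simps[OF assms(1)])

lemmas bracket_simps =
  linear_map_add[OF bracket_left] linear_map_add[OF bracket_right]
  linear_map_smult[OF bracket_left] linear_map_smult[OF bracket_right]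
  linear_map_uminus[OF bracket_left vectorspace_axioms vectorspace_axioms]
  linear_map_uminus[OF bracket_right vectorspace_axioms vectorspace_axioms]

lemma cocycle_eqI:
  assumes "\<omega> \<in> cocycles T R" "\<omega>' \<in> cocycles T R"
    "\<And>x y. x \<in> carrier T \<Longrightarrow> y \<in> carrier T \<Longrightarrow> \<omega> (x, y) = \<omega>' (x, y)"
  shows "\<omega> = \<omega>'"
  using cocycle_extensional[OF assms(1)] cocycle_extensional[OF assms(2)]
  by (rule extensionalityI) (use assms(3) in auto)

lemma cocycle_add:
  assumes "\<omega> \<in> cocycles T R" "\<omega>' \<in> cocycles T R"
  shows "(\<lambda>p\<in>carrier T \<times> carrier T. \<omega> p \<oplus>\<^bsub>R\<^esub> \<omega>' p) \<in> cocycles T R"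
proof (rule cocyclesI)
  fix f x y z assume f: "f \<in> dual R" and xyz: "x \<in> carrier T" "y \<in> carrier T" "z \<in> carrier T"
  show "f ((\<lambda>p\<in>carrier T \<times> carrier T. \<omega> p \<oplus>\<^bsub>R\<^esub> \<omega>' p) (lie_bracket T x y, z)) +
    f ((\<lambda>p\<in>carrier T \<times> carrier T. \<omega> p \<oplus>\<^bsub>R\<^esub> \<omega>' p) (lie_bracket T y z, x)) +
    f ((\<lambda>p\<in>carrier T \<times> carrier T. \<omega> p \<oplus>\<^bsub>R\<^esub> \<omega>' p) (lie_bracket T z x, y)) = 0"
    using scalar_cyclic[OF assms(1) f xyz] scalar_cyclic[OF assms(2) f xyz] f xyz
    by (simp add: scalar_simps cocycle_simps[OF assms(1)] cocycle_simps[OF assms(2)])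
qed (auto simp: scalar_simps cocycle_simps[OF assms(1)] cocycle_simps[OF assms(2)] algebra_simps)

lemma cocycle_smult:
  assumes "\<omega> \<in> cocycles T R"
  shows "(\<lambda>p\<in>carrier T \<times> carrier T. c \<odot>\<^bsub>R\<^esub> \<omega> p) \<in> cocycles T R"
proof (rule cocyclesI)
  fix f x y z assume f: "f \<in> dual R" and xyz: "x \<in> carrier T" "y \<in> carrier T" "z \<in> carrier T"
  show "f ((\<lambda>p\<in>carrier T \<times> carrier T. c \<odot>\<^bsub>R\<^esub> \<omega> p) (lie_bracket T x y, z)) +
    f ((\<lambda>p\<in>carrier T \<times> carrier T. c \<odot>\<^bsub>R\<^esub> \<omega> p) (lie_bracket T y z, x)) +
    f ((\<lambda>p\<in>carrier T \<times> carrier T. c \<odot>\<^bsub>R\<^esub> \<omega> p) (lie_bracket T z x, y)) = 0"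
    using arg_cong[OF scalar_cyclic[OF assms(1) f xyz], of "\<lambda>t. c * t"] f xyz
    by (simp add: scalar_simps cocycle_simps[OF assms(1)] algebra_simps)
qed (auto simp: scalar_simps cocycle_simps[OF assms(1)] algebra_simps)

lemma coboundary_cocycle:
  assumes "\<eta> \<in> linear_maps T R"
  shows "(\<lambda>(x, y)\<in>carrier T \<times> carrier T. \<eta> (lie_bracket T x y)) \<in> cocycles T R"
proof (rule cocyclesI)
  fix f x y z assume f: "f \<in> dual R" and xyz: "x \<in> carrier T" "y \<in> carrier T" "z \<in> carrier T"
  show "f ((\<lambda>(x, y)\<in>carrier T \<times> carrier T. \<eta> (lie_bracket T x y)) (lie_bracket T x y, z)) +
    f ((\<lambda>(x, y)\<in>carrier T \<times> carrier T. \<eta> (lie_bracket T x y)) (lie_bracket T y z, x)) +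
    f ((\<lambda>(x, y)\<in>carrier T \<times> carrier T. \<eta> (lie_bracket T x y)) (lie_bracket T z x, y)) = 0"
    using jacobi_under_linear_map[OF assms f xyz] xyz by simp
qed (auto simp: scalar_simps linear_map_simps[OF assms] bracket_simps bracket_alternating algebra_simps)

lemma zero_cocycle: "(\<lambda>p\<in>carrier T \<times> carrier T. \<zero>\<^bsub>R\<^esub>) \<in> cocycles T R"
  by (rule cocyclesI) (auto simp: scalar_simps)

lemma Z2_simps:
  "carrier (Z2 T R) = cocycles T R"
  "\<omega> \<oplus>\<^bsub>Z2 T R\<^esub> \<omega>' = (\<lambda>p\<in>carrier T \<times> carrier T. \<omega> p \<oplus>\<^bsub>R\<^esub> \<omega>' p)"
  "c \<odot>\<^bsub>Z2 T R\<^esub> \<omega> = (\<lambda>p\<in>carrier T \<times> carrier T. c \<odot>\<^bsub>R\<^esub> \<omega> p)"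
  "\<zero>\<^bsub>Z2 T R\<^esub> = (\<lambda>p\<in>carrier T \<times> carrier T. \<zero>\<^bsub>R\<^esub>)"
  by (simp_all add: Z2_def Let_def)

lemma Z2_vectorspace: "vectorspace \<R> (Z2 T R)"
proof -
  interpret R: real_vs R by (rule R_real_vs)
  let ?P = "carrier T \<times> carrier T"
  note closed = cocycle_simps(1)
  have eqI: "\<omega> = \<omega>'" if "\<omega> \<in> cocycles T R" "\<omega>' \<in> cocycles T R" "\<And>p. p \<in> ?P \<Longrightarrow> \<omega> p = \<omega>' p" for \<omega> \<omega>'
    using that by (intro cocycle_eqI) auto
  have c: "\<omega> p \<in> carrier R" if "\<omega> \<in> cocycles T R" "p \<in> ?P" for \<omega> p
    using that closed by auto
  show ?thesis
  proof (rule vs_criteria; (unfold Z2_simps)?)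
    show "field \<R>" by (rule class_field.field_axioms)
    show "(\<lambda>p\<in>?P. \<zero>\<^bsub>R\<^esub>) \<in> cocycles T R" by (rule zero_cocycle)
    show "\<forall>v w. v \<in> cocycles T R \<and> w \<in> cocycles T R \<longrightarrow> (\<lambda>p\<in>?P. v p \<oplus>\<^bsub>R\<^esub> w p) \<in> cocycles T R"
      using cocycle_add by blast
    show "\<forall>c v. c \<in> carrier \<R> \<and> v \<in> cocycles T R \<longrightarrow> (\<lambda>p\<in>?P. c \<odot>\<^bsub>R\<^esub> v p) \<in> cocycles T R"
      using cocycle_smult by blast
    show "\<forall>v\<in>cocycles T R. \<exists>w\<in>cocycles T R. (\<lambda>p\<in>?P. v p \<oplus>\<^bsub>R\<^esub> w p) = (\<lambda>p\<in>?P. \<zero>\<^bsub>R\<^esub>)"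
    proof
      fix v assume v: "v \<in> cocycles T R"
      have "(\<lambda>p\<in>?P. v p \<oplus>\<^bsub>R\<^esub> (\<lambda>p\<in>?P. (-1) \<odot>\<^bsub>R\<^esub> v p) p) = (\<lambda>p\<in>?P. \<zero>\<^bsub>R\<^esub>)"
        by (rule restrict_ext) (use c[OF v] in \<open>simp add: R.smult_uminus_1 R.r_neg\<close>)
      then show "\<exists>w\<in>cocycles T R. (\<lambda>p\<in>?P. v p \<oplus>\<^bsub>R\<^esub> w p) = (\<lambda>p\<in>?P. \<zero>\<^bsub>R\<^esub>)"
        using cocycle_smult[OF v] by blast
    qed
    show "\<forall>v w. v \<in> cocycles T R \<and> w \<in> cocycles T R \<longrightarrow> (\<lambda>p\<in>?P. v p \<oplus>\<^bsub>R\<^esub> w p) = (\<lambda>p\<in>?P. w p \<oplus>\<^bsub>R\<^esub> v p)"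
      using c by (auto intro!: restrict_ext R.add.m_comm)
    show "\<forall>v w x. v \<in> cocycles T R \<and> w \<in> cocycles T R \<and> x \<in> cocycles T R \<longrightarrow>
        (\<lambda>p\<in>?P. (\<lambda>p\<in>?P. v p \<oplus>\<^bsub>R\<^esub> w p) p \<oplus>\<^bsub>R\<^esub> x p) = (\<lambda>p\<in>?P. v p \<oplus>\<^bsub>R\<^esub> (\<lambda>p\<in>?P. w p \<oplus>\<^bsub>R\<^esub> x p) p)"
      using c by (auto intro!: restrict_ext R.add.m_assoc)
    show "\<forall>v\<in>cocycles T R. (\<lambda>p\<in>?P. v p \<oplus>\<^bsub>R\<^esub> (\<lambda>p\<in>?P. \<zero>\<^bsub>R\<^esub>) p) = v"
      using cocycle_add[OF _ zero_cocycle] c by (intro ballI eqI) auto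
    show "\<forall>a b v. a \<in> carrier \<R> \<and> b \<in> carrier \<R> \<and> v \<in> cocycles T R \<longrightarrow>
        (\<lambda>p\<in>?P. (a \<otimes>\<^bsub>\<R>\<^esub> b) \<odot>\<^bsub>R\<^esub> v p) = (\<lambda>p\<in>?P. a \<odot>\<^bsub>R\<^esub> (\<lambda>p\<in>?P. b \<odot>\<^bsub>R\<^esub> v p) p)"
      using c by (auto intro!: restrict_ext simp: R.smult_smult)
    show "\<forall>v\<in>cocycles T R. (\<lambda>p\<in>?P. \<one>\<^bsub>\<R>\<^esub> \<odot>\<^bsub>R\<^esub> v p) = v"
      using cocycle_smult[of _ 1] c by (intro ballI eqI) (auto simp: R.smult_1)
    show "\<forall>a b v. a \<in> carrier \<R> \<and> b \<in> carrier \<R> \<and> v \<in> cocycles T R \<longrightarrow>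
        (\<lambda>p\<in>?P. (a \<oplus>\<^bsub>\<R>\<^esub> b) \<odot>\<^bsub>R\<^esub> v p) =
        (\<lambda>p\<in>?P. (\<lambda>p\<in>?P. a \<odot>\<^bsub>R\<^esub> v p) p \<oplus>\<^bsub>R\<^esub> (\<lambda>p\<in>?P. b \<odot>\<^bsub>R\<^esub> v p) p)"
      using c by (auto intro!: restrict_ext simp: R.smult_add_left)
    show "\<forall>a v w. a \<in> carrier \<R> \<and> v \<in> cocycles T R \<and> w \<in> cocycles T R \<longrightarrow>
        (\<lambda>p\<in>?P. a \<odot>\<^bsub>R\<^esub> (\<lambda>p\<in>?P. v p \<oplus>\<^bsub>R\<^esub> w p) p) =
        (\<lambda>p\<in>?P. (\<lambda>p\<in>?P. a \<odot>\<^bsub>R\<^esub> v p) p \<oplus>\<^bsub>R\<^esub> (\<lambda>p\<in>?P. a \<odot>\<^bsub>R\<^esub> w p) p)"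
      using c by (auto intro!: restrict_ext simp: R.smult_add_right)
  qed
qed


lemma Z2_real_vs: "real_vs (Z2 T R)"
  using Z2_vectorspace by (simp add: real_vs_def)

text \<open>
  The sign in the definition of a coboundary is absorbed by \<open>\<eta>\<close>.
\<close>
lemma mem_B2_iff:
  "b \<in> B2 T R \<longleftrightarrow> (\<exists>\<eta>\<in>linear_maps T R. b = (\<lambda>(x, y)\<in>carrier T \<times> carrier T. \<eta> (lie_bracket T x y)))"
proof -
  interpret R: real_vs R by (rule R_real_vs)
  have neg: "(\<lambda>x. \<ominus>\<^bsub>R\<^esub> \<eta> x) \<in> linear_maps T R" if "\<eta> \<in> linear_maps T R" for \<eta>
    using that by (intro linear_map_to_coeffI) (auto simp: scalar_simps linear_map_simps[OF that])
  have neg2: "(\<lambda>(x, y)\<in>carrier T \<times> carrier T. \<eta> (lie_bracket T x y)) =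
      (\<lambda>(x, y)\<in>carrier T \<times> carrier T. \<ominus>\<^bsub>R\<^esub> (\<ominus>\<^bsub>R\<^esub> \<eta> (lie_bracket T x y)))" if "\<eta> \<in> linear_maps T R" for \<eta>
    by (rule restrict_ext) (use linear_map_simps(1)[OF that] in auto)
  show ?thesis
  proof
    assume "b \<in> B2 T R"
    then obtain \<eta> where "\<eta> \<in> linear_maps T R"
      "b = (\<lambda>(x, y)\<in>carrier T \<times> carrier T. \<ominus>\<^bsub>R\<^esub> \<eta> (lie_bracket T x y))"
      unfolding B2_def by blast
    then show "\<exists>\<eta>\<in>linear_maps T R. b = (\<lambda>(x, y)\<in>carrier T \<times> carrier T. \<eta> (lie_bracket T x y))"
      using neg by (intro bexI[of _ "\<lambda>x. \<ominus>\<^bsub>R\<^esub> \<eta> x"]) auto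
  next
    assume "\<exists>\<eta>\<in>linear_maps T R. b = (\<lambda>(x, y)\<in>carrier T \<times> carrier T. \<eta> (lie_bracket T x y))"
    then obtain \<eta> where \<eta>: "\<eta> \<in> linear_maps T R"
      "b = (\<lambda>(x, y)\<in>carrier T \<times> carrier T. \<eta> (lie_bracket T x y))" by blast
    then show "b \<in> B2 T R"
      unfolding B2_def using neg[OF \<eta>(1)] neg2[OF \<eta>(1)] \<eta>(2)
      by (intro CollectI exI[of _ "\<lambda>x. \<ominus>\<^bsub>R\<^esub> \<eta> x"] conjI) (rule trans, assumption+)
  qed
qed

lemma coboundaryI:
  assumes "\<eta> \<in> linear_maps T R" "b = (\<lambda>(x, y)\<in>carrier T \<times> carrier T. \<eta> (lie_bracket T x y))"
  shows "b \<in> B2 T R"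
  unfolding mem_B2_iff using assms by (intro bexI[of _ \<eta>])

lemma B2_submodule: "submodule \<R> (B2 T R) (Z2 T R)"
proof -
  interpret R: real_vs R by (rule R_real_vs)
  interpret Z: real_vs "Z2 T R" by (rule Z2_real_vs)
  let ?b = "\<lambda>\<eta>. \<lambda>(x, y)\<in>carrier T \<times> carrier T. \<eta> (lie_bracket T x y)"
  show ?thesis
  proof (rule Z.submoduleI)
    show "B2 T R \<subseteq> carrier (Z2 T R)"
      using coboundary_cocycle by (auto simp: mem_B2_iff Z2_simps)
    have "(\<lambda>x. \<zero>\<^bsub>R\<^esub>) \<in> linear_maps T R"
      by (rule linear_map_to_coeffI) (auto simp: scalar_simps)
    then show "\<zero>\<^bsub>Z2 T R\<^esub> \<in> B2 T R"
      unfolding Z2_simps by (rule coboundaryI) (rule restrict_ext, auto)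
    show "x \<oplus>\<^bsub>Z2 T R\<^esub> y \<in> B2 T R" if xy: "x \<in> B2 T R" "y \<in> B2 T R" for x y
    proof -
      obtain \<eta> \<zeta> where e: "\<eta> \<in> linear_maps T R" "\<zeta> \<in> linear_maps T R" "x = ?b \<eta>" "y = ?b \<zeta>"
        using xy unfolding mem_B2_iff by blast
      have "(\<lambda>v. \<eta> v \<oplus>\<^bsub>R\<^esub> \<zeta> v) \<in> linear_maps T R"
        by (rule linear_map_to_coeffI)
          (auto simp: scalar_simps linear_map_simps[OF e(1)] linear_map_simps[OF e(2)] algebra_simps)
      moreover have "x \<oplus>\<^bsub>Z2 T R\<^esub> y = ?b (\<lambda>v. \<eta> v \<oplus>\<^bsub>R\<^esub> \<zeta> v)"
        unfolding e(3,4) Z2_simps by (rule restrict_ext) auto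
      ultimately show ?thesis by (rule coboundaryI)
    qed
    show "c \<odot>\<^bsub>Z2 T R\<^esub> x \<in> B2 T R" if x: "x \<in> B2 T R" for c x
    proof -
      obtain \<eta> where e: "\<eta> \<in> linear_maps T R" "x = ?b \<eta>"
        using x unfolding mem_B2_iff by blast
      have "(\<lambda>v. c \<odot>\<^bsub>R\<^esub> \<eta> v) \<in> linear_maps T R"
        by (rule linear_map_to_coeffI)
          (auto simp: scalar_simps linear_map_simps[OF e(1)] algebra_simps)
      moreover have "c \<odot>\<^bsub>Z2 T R\<^esub> x = ?b (\<lambda>v. c \<odot>\<^bsub>R\<^esub> \<eta> v)"
        unfolding e(2) Z2_simps by (rule restrict_ext) auto
      ultimately show ?thesis by (rule coboundaryI)
    qed
  qed
qed

text \<open>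
  Equality of cohomology classes in terms of representatives, see \<open>cohomology_class_eq_iff\<close>
  below; the cochain \<open>\<eta>\<close> is kept because the isomorphisms of extensions are built from it.
\<close>
definition cohomologous :: "('a \<times> 'a \<Rightarrow> 'r) \<Rightarrow> ('a \<times> 'a \<Rightarrow> 'r) \<Rightarrow> bool" where
  "cohomologous \<omega> \<omega>' \<longleftrightarrow> (\<exists>\<eta>\<in>linear_maps T R. \<forall>x\<in>carrier T. \<forall>y\<in>carrier T.
    \<omega>' (x, y) = \<omega> (x, y) \<oplus>\<^bsub>R\<^esub> \<eta> (lie_bracket T x y))"

lemma cohomology_class_eq_iff:
  assumes \<omega>: "\<omega> \<in> cocycles T R" and \<omega>': "\<omega>' \<in> cocycles T R"
  shows "cohomology_class T R \<omega> = cohomology_class T R \<omega>' \<longleftrightarrow> cohomologous \<omega> \<omega>'"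
proof -
  interpret R: real_vs R by (rule R_real_vs)
  interpret Z: real_vs "Z2 T R" by (rule Z2_real_vs)
  have Z: "\<omega> \<in> carrier (Z2 T R)" "\<omega>' \<in> carrier (Z2 T R)" using \<omega> \<omega>' by (simp_all add: Z2_simps)
  have "cohomology_class T R \<omega> = cohomology_class T R \<omega>' \<longleftrightarrow> \<omega>' \<ominus>\<^bsub>Z2 T R\<^esub> \<omega> \<in> B2 T R"
    unfolding cohomology_class_def using Z.coset_eq[OF B2_submodule Z(2,1)] by auto
  also have "\<dots> \<longleftrightarrow> (\<exists>b\<in>B2 T R. \<omega>' = \<omega> \<oplus>\<^bsub>Z2 T R\<^esub> b)"
  proof
    assume a: "\<omega>' \<ominus>\<^bsub>Z2 T R\<^esub> \<omega> \<in> B2 T R"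
    have "\<omega> \<oplus>\<^bsub>Z2 T R\<^esub> (\<omega>' \<ominus>\<^bsub>Z2 T R\<^esub> \<omega>) = \<omega>'"
      unfolding a_minus_def
      using Z Z.add.m_lcomm[of \<omega> \<omega>' "\<ominus>\<^bsub>Z2 T R\<^esub> \<omega>"] by (simp add: Z.r_neg)
    then show "\<exists>b\<in>B2 T R. \<omega>' = \<omega> \<oplus>\<^bsub>Z2 T R\<^esub> b" using a by metis
  next
    assume "\<exists>b\<in>B2 T R. \<omega>' = \<omega> \<oplus>\<^bsub>Z2 T R\<^esub> b"
    then obtain b where b: "b \<in> B2 T R" "\<omega>' = \<omega> \<oplus>\<^bsub>Z2 T R\<^esub> b" by blast
    have bZ: "b \<in> carrier (Z2 T R)" using b submodule.subset[OF B2_submodule] by blast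
    have "\<omega>' \<ominus>\<^bsub>Z2 T R\<^esub> \<omega> = \<omega> \<oplus>\<^bsub>Z2 T R\<^esub> (b \<oplus>\<^bsub>Z2 T R\<^esub> \<ominus>\<^bsub>Z2 T R\<^esub> \<omega>)"
      using Z(1) bZ b(2) by (simp add: a_minus_def Z.add.m_assoc)
    also have "\<dots> = b \<oplus>\<^bsub>Z2 T R\<^esub> (\<omega> \<oplus>\<^bsub>Z2 T R\<^esub> \<ominus>\<^bsub>Z2 T R\<^esub> \<omega>)"
      using Z(1) bZ by (intro Z.add.m_lcomm) auto
    also have "\<dots> = b" using Z(1) bZ by (simp add: Z.r_neg)
    finally show "\<omega>' \<ominus>\<^bsub>Z2 T R\<^esub> \<omega> \<in> B2 T R" using b(1) by simp
  qed
  also have "\<dots> \<longleftrightarrow> cohomologous \<omega> \<omega>'"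
  proof
    assume "\<exists>b\<in>B2 T R. \<omega>' = \<omega> \<oplus>\<^bsub>Z2 T R\<^esub> b"
    then obtain b where b: "b \<in> B2 T R" "\<omega>' = \<omega> \<oplus>\<^bsub>Z2 T R\<^esub> b" by blast
    obtain \<eta> where \<eta>: "\<eta> \<in> linear_maps T R"
      "b = (\<lambda>(x, y)\<in>carrier T \<times> carrier T. \<eta> (lie_bracket T x y))"
      using b(1) unfolding mem_B2_iff by blast
    have "\<omega>' (x, y) = \<omega> (x, y) \<oplus>\<^bsub>R\<^esub> \<eta> (lie_bracket T x y)" if "x \<in> carrier T" "y \<in> carrier T" for x y
      using that b(2) \<eta>(2) by (simp add: Z2_simps)
    then show "cohomologous \<omega> \<omega>'" unfolding cohomologous_def using \<eta> by blast
  next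
    assume "cohomologous \<omega> \<omega>'"
    then obtain \<eta> where \<eta>: "\<eta> \<in> linear_maps T R"
      "\<forall>x\<in>carrier T. \<forall>y\<in>carrier T. \<omega>' (x, y) = \<omega> (x, y) \<oplus>\<^bsub>R\<^esub> \<eta> (lie_bracket T x y)"
      unfolding cohomologous_def by blast
    have "\<omega>' = \<omega> \<oplus>\<^bsub>Z2 T R\<^esub> (\<lambda>(x, y)\<in>carrier T \<times> carrier T. \<eta> (lie_bracket T x y))"
      using cocycle_add[OF \<omega> coboundary_cocycle[OF \<eta>(1)]] \<omega>' \<eta>(2)
      unfolding Z2_simps by (intro cocycle_eqI) auto
    then show "\<exists>b\<in>B2 T R. \<omega>' = \<omega> \<oplus>\<^bsub>Z2 T R\<^esub> b" using coboundaryI[OF \<eta>(1) refl] by blast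
  qed
  finally show ?thesis .
qed

lemma uminus_Z2:
  assumes "\<omega> \<in> cocycles T R"
  shows "\<ominus>\<^bsub>Z2 T R\<^esub> \<omega> = (\<lambda>p\<in>carrier T \<times> carrier T. \<ominus>\<^bsub>R\<^esub> \<omega> p)"
    and "\<ominus>\<^bsub>Z2 T R\<^esub> \<omega> \<in> cocycles T R"
proof -
  interpret R: real_vs R by (rule R_real_vs)
  interpret Z: real_vs "Z2 T R" by (rule Z2_real_vs)
  have "(\<lambda>p\<in>carrier T \<times> carrier T. \<ominus>\<^bsub>R\<^esub> \<omega> p) = (\<lambda>p\<in>carrier T \<times> carrier T. (-1) \<odot>\<^bsub>R\<^esub> \<omega> p)"
    by (rule restrict_ext) (auto simp: R.smult_uminus_1 cocycle_simps(1)[OF assms])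
  also have "\<dots> = \<ominus>\<^bsub>Z2 T R\<^esub> \<omega>"
    using Z.smult_uminus_1[of \<omega>] assms by (simp add: Z2_simps)
  finally show "\<ominus>\<^bsub>Z2 T R\<^esub> \<omega> = (\<lambda>p\<in>carrier T \<times> carrier T. \<ominus>\<^bsub>R\<^esub> \<omega> p)" by simp
  then show "\<ominus>\<^bsub>Z2 T R\<^esub> \<omega> \<in> cocycles T R"
    using Z.a_inv_closed[of \<omega>] assms by (simp add: Z2_simps)
qed

lemma quot_map_cohomology_class:
  assumes "\<omega> \<in> cocycles T R" "F \<in> cocycles T R \<rightarrow> cocycles T R"
    and "\<And>\<omega>'. \<omega>' \<in> cocycles T R \<Longrightarrow> cohomologous \<omega>' \<omega> \<Longrightarrow> cohomologous (F \<omega>') (F \<omega>)"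
  shows "quot_map (Z2 T R) (B2 T R) F (cohomology_class T R \<omega>) = cohomology_class T R (F \<omega>)"
proof -
  interpret Z: real_vs "Z2 T R" by (rule Z2_real_vs)
  show ?thesis
    unfolding cohomology_class_def
  proof (rule Z.quot_map_coset[OF B2_submodule])
    show "\<omega> \<in> carrier (Z2 T R)" using assms(1) by (simp add: Z2_simps)
    fix a assume a: "a \<in> carrier (Z2 T R)" "a \<ominus>\<^bsub>Z2 T R\<^esub> \<omega> \<in> B2 T R"
    then have aZ: "a \<in> cocycles T R" by (simp add: Z2_simps)
    have "cohomology_class T R a = cohomology_class T R \<omega>"
      unfolding cohomology_class_def using Z.coset_eq[OF B2_submodule a(1)] a(2) assms(1)
      by (simp add: Z2_simps)
    then have "cohomologous a \<omega>" using cohomology_class_eq_iff[OF aZ assms(1)] by simp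
    then have "cohomologous (F a) (F \<omega>)" by (rule assms(3)[OF aZ])
    then show "B2 T R +>\<^bsub>Z2 T R\<^esub> F a = B2 T R +>\<^bsub>Z2 T R\<^esub> F \<omega>"
      using cohomology_class_eq_iff[of "F a" "F \<omega>"] assms(1,2) aZ
      by (auto simp: cohomology_class_def)
  qed
qed

lemma carrier_H2: "carrier (H2 T R) = cohomology_class T R ` cocycles T R"
proof -
  interpret Z: real_vs "Z2 T R" by (rule Z2_real_vs)
  show ?thesis
    by (simp add: H2_def Z.carrier_quot[OF B2_submodule] cohomology_class_def Z2_simps)
qed

lemma uminus_H2:
  assumes "\<omega> \<in> cocycles T R"
  shows "\<ominus>\<^bsub>H2 T R\<^esub> cohomology_class T R \<omega> = cohomology_class T R (\<ominus>\<^bsub>Z2 T R\<^esub> \<omega>)"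
proof -
  interpret Z: real_vs "Z2 T R" by (rule Z2_real_vs)
  show ?thesis using Z.uminus_quot[OF B2_submodule, of \<omega>] assms
    by (simp add: H2_def cohomology_class_def Z2_simps)
qed

lemma zero_H2: "\<zero>\<^bsub>H2 T R\<^esub> = cohomology_class T R (\<zero>\<^bsub>Z2 T R\<^esub>)"
proof -
  interpret Z: real_vs "Z2 T R" by (rule Z2_real_vs)
  show ?thesis using Z.zero_quot[OF B2_submodule] by (simp add: H2_def cohomology_class_def)
qed

lemma transformed_cocycle:
  assumes \<omega>: "\<omega> \<in> cocycles T R" and g: "g \<in> linear_maps T T" and A: "A \<in> linear_maps R R"
    and gb: "\<And>x y. x \<in> carrier T \<Longrightarrow> y \<in> carrier T \<Longrightarrow> g (lie_bracket T x y) = lie_bracket T (g x) (g y)"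
  shows "(\<lambda>(x, y)\<in>carrier T \<times> carrier T. A (\<omega> (g x, g y))) \<in> cocycles T R"
proof -
  have fA: "(\<lambda>r. f (A r)) \<in> dual R" if "f \<in> dual R" for f
    using linear_map_compose[OF A that] by (simp add: comp_def)
  note [simp] = linear_map_closed[OF g] linear_map_closed[OF A] cocycle_simps(1)[OF \<omega>]
  show ?thesis
    by (rule cocyclesI) (auto simp: linear_map_add[OF g] linear_map_smult[OF g] gb cocycle_simps[OF \<omega>]
      dual_add[OF fA] dual_smult[OF fA] dual_zero[OF fA R_vectorspace] scalar_cyclic[OF \<omega> fA])
qed

lemma pullback_theta_cocycle:
  assumes "\<omega> \<in> cocycles T R"
  shows "pullback T (theta T) \<omega> \<in> cocycles T R"
proof -
  have "(\<lambda>r. r) \<in> linear_maps R R" by (rule linear_mapsI) auto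
  from transformed_cocycle[OF assms theta_linear this theta_bracket] show ?thesis by (simp add: pullback_def)
qed

text \<open>
  The cyclic identity of \<open>D\<omega>\<close> at \<open>(x, y, z)\<close> is the sum of those of \<open>\<omega>\<close> at \<open>(Dx, y, z)\<close>,
  \<open>(x, Dy, z)\<close> and \<open>(x, y, Dz)\<close>. That \<open>D\<omega>\<close> is alternating follows by polarising at
  \<open>Dx + x\<close>.
\<close>
lemma D_cochain_cocycle:
  assumes \<omega>: "\<omega> \<in> cocycles T R"
  shows "D_cochain T R \<omega> \<in> cocycles T R"
  unfolding D_cochain_def
proof (rule cocyclesI)
  fix f x y z assume f: "f \<in> dual R" and xyz: "x \<in> carrier T" "y \<in> carrier T" "z \<in> carrier T"
  let ?D = "\<lambda>(x, y)\<in>carrier T \<times> carrier T. \<omega> (dmap T x, y) \<oplus>\<^bsub>R\<^esub> \<omega> (x, dmap T y)"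
  show "f (?D (lie_bracket T x y, z)) + f (?D (lie_bracket T y z, x)) + f (?D (lie_bracket T z x, y)) = 0"
    using scalar_cyclic[OF \<omega> f, of "dmap T x" y z] scalar_cyclic[OF \<omega> f, of x "dmap T y" z]
      scalar_cyclic[OF \<omega> f, of x y "dmap T z"] f xyz
    by (simp add: scalar_simps cocycle_simps[OF \<omega>] dmap_derivation)
next
  fix f x assume f: "f \<in> dual R" and x: "x \<in> carrier T"
  have "f (\<omega> (dmap T x \<oplus> x, dmap T x \<oplus> x)) =
      f (\<omega> (dmap T x, dmap T x)) + f (\<omega> (dmap T x, x)) + (f (\<omega> (x, dmap T x)) + f (\<omega> (x, x)))"
    using f x by (simp add: scalar_simps cocycle_simps(1-3)[OF \<omega>])
  then show "f ((\<lambda>(x, y)\<in>carrier T \<times> carrier T. \<omega> (dmap T x, y) \<oplus>\<^bsub>R\<^esub> \<omega> (x, dmap T y)) (x, x)) = 0"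
    using f x by (simp add: scalar_simps cocycle_simps(1,8)[OF \<omega>])
qed (auto simp: scalar_simps cocycle_simps[OF \<omega>] linear_map_add[OF dmap_linear]
    linear_map_smult[OF dmap_linear] algebra_simps)

lemma mem_invariant_cocycles_iff:
  "\<omega> \<in> invariant_cocycles T R \<longleftrightarrow> \<omega> \<in> cocycles T R \<and>
    (\<forall>x\<in>carrier T. \<forall>y\<in>carrier T. \<omega> (theta T x, theta T y) = \<ominus>\<^bsub>R\<^esub> \<omega> (x, y)) \<and>
    (\<forall>x\<in>carrier T. \<forall>y\<in>carrier T. \<omega> (dmap T x, y) \<oplus>\<^bsub>R\<^esub> \<omega> (x, dmap T y) = \<zero>\<^bsub>R\<^esub>)"
proof -
  have "pullback T (theta T) \<omega> = \<ominus>\<^bsub>Z2 T R\<^esub> \<omega> \<longleftrightarrow>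
      (\<forall>x\<in>carrier T. \<forall>y\<in>carrier T. \<omega> (theta T x, theta T y) = \<ominus>\<^bsub>R\<^esub> \<omega> (x, y))"
    "D_cochain T R \<omega> = \<zero>\<^bsub>Z2 T R\<^esub> \<longleftrightarrow>
      (\<forall>x\<in>carrier T. \<forall>y\<in>carrier T. \<omega> (dmap T x, y) \<oplus>\<^bsub>R\<^esub> \<omega> (x, dmap T y) = \<zero>\<^bsub>R\<^esub>)"
    if "\<omega> \<in> cocycles T R"
    by (auto simp: uminus_Z2[OF that] pullback_def D_cochain_def Z2_simps restrict_def fun_eq_iff)
  then show ?thesis by (auto simp: invariant_cocycles_def Z2_simps)
qed


section \<open>Invariant representatives of cohomology classes\<close>

lemma theta_dmap: "x \<in> carrier T \<Longrightarrow> theta T (dmap T x) = \<ominus> dmap T (theta T x)"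
  using dmap_theta[of x] by simp

lemmas dmap_simps =
  linear_map_add[OF dmap_linear] linear_map_smult[OF dmap_linear]
  linear_map_uminus[OF dmap_linear vectorspace_axioms vectorspace_axioms]
  linear_map_zero[OF dmap_linear vectorspace_axioms vectorspace_axioms]

lemmas theta_simps =
  linear_map_add[OF theta_linear] linear_map_smult[OF theta_linear]
  linear_map_uminus[OF theta_linear vectorspace_axioms vectorspace_axioms]
  linear_map_zero[OF theta_linear vectorspace_axioms vectorspace_axioms]

lemmas functional_simps =
  dual_zero[OF _ vectorspace_axioms] dual_add[where V=T] dual_smult[where V=T]
  dual_uminus[OF _ vectorspace_axioms]

lemma linear_map_functional:
  "\<eta> \<in> linear_maps T R \<Longrightarrow> f \<in> dual R \<Longrightarrow> (\<lambda>x. f (\<eta> x)) \<in> dual T"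
  using linear_map_compose[of \<eta> T R f real_space] by (simp add: comp_def)

lemma cohomologous_add_coboundary:
  assumes "\<omega> \<in> cocycles T R" "\<eta> \<in> linear_maps T R"
  defines "\<omega>' \<equiv> \<lambda>(x, y)\<in>carrier T \<times> carrier T. \<omega> (x, y) \<oplus>\<^bsub>R\<^esub> \<eta> (lie_bracket T x y)"
  shows "\<omega>' \<in> cocycles T R" "cohomology_class T R \<omega>' = cohomology_class T R \<omega>"
proof -
  have "\<omega>' = (\<lambda>p\<in>carrier T \<times> carrier T. \<omega> p \<oplus>\<^bsub>R\<^esub>
      (\<lambda>(x, y)\<in>carrier T \<times> carrier T. \<eta> (lie_bracket T x y)) p)"
    unfolding \<omega>'_def by (rule restrict_ext) auto
  then show \<omega>': "\<omega>' \<in> cocycles T R" using cocycle_add[OF assms(1) coboundary_cocycle[OF assms(2)]] by simp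
  have "cohomologous \<omega> \<omega>'"
    unfolding cohomologous_def \<omega>'_def using assms(2) by (intro bexI[of _ \<eta>]) auto
  then show "cohomology_class T R \<omega>' = cohomology_class T R \<omega>"
    using cohomology_class_eq_iff[OF assms(1) \<omega>'] by simp
qed

lemma quot_map_theta:
  assumes "\<omega> \<in> cocycles T R"
  shows "quot_map (Z2 T R) (B2 T R) (pullback T (theta T)) (cohomology_class T R \<omega>) =
    cohomology_class T R (pullback T (theta T) \<omega>)"
proof (rule quot_map_cohomology_class[OF assms])
  show "pullback T (theta T) \<in> cocycles T R \<rightarrow> cocycles T R" using pullback_theta_cocycle by blast
  fix \<omega>' assume "cohomologous \<omega>' \<omega>"
  then obtain \<eta> where \<eta>: "\<eta> \<in> linear_maps T R"
    "\<forall>x\<in>carrier T. \<forall>y\<in>carrier T. \<omega> (x, y) = \<omega>' (x, y) \<oplus>\<^bsub>R\<^esub> \<eta> (lie_bracket T x y)"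
    unfolding cohomologous_def by blast
  have "(\<lambda>x. \<eta> (theta T x)) \<in> linear_maps T R"
    using linear_map_compose[OF theta_linear \<eta>(1)] by (simp add: comp_def)
  then show "cohomologous (pullback T (theta T) \<omega>') (pullback T (theta T) \<omega>)"
    unfolding cohomologous_def using \<eta>(2)
    by (intro bexI[of _ "\<lambda>x. \<eta> (theta T x)"]) (auto simp: pullback_def theta_bracket)
qed

lemma quot_map_D_cochain:
  assumes "\<omega> \<in> cocycles T R"
  shows "quot_map (Z2 T R) (B2 T R) (D_cochain T R) (cohomology_class T R \<omega>) =
    cohomology_class T R (D_cochain T R \<omega>)"
proof (rule quot_map_cohomology_class[OF assms])
  show "D_cochain T R \<in> cocycles T R \<rightarrow> cocycles T R" using D_cochain_cocycle by blast
  fix \<omega>' assume \<omega>': "\<omega>' \<in> cocycles T R" and "cohomologous \<omega>' \<omega>"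
  then obtain \<eta> where \<eta>: "\<eta> \<in> linear_maps T R"
    "\<forall>x\<in>carrier T. \<forall>y\<in>carrier T. \<omega> (x, y) = \<omega>' (x, y) \<oplus>\<^bsub>R\<^esub> \<eta> (lie_bracket T x y)"
    unfolding cohomologous_def by blast
  have lin: "(\<lambda>x. \<eta> (dmap T x)) \<in> linear_maps T R"
    using linear_map_compose[OF dmap_linear \<eta>(1)] by (simp add: comp_def)
  have "D_cochain T R \<omega> (x, y) = D_cochain T R \<omega>' (x, y) \<oplus>\<^bsub>R\<^esub> \<eta> (dmap T (lie_bracket T x y))"
    if "x \<in> carrier T" "y \<in> carrier T" for x y
  proof (rule coeff_eqI)
    fix f assume f: "f \<in> dual R"
    have e: "\<omega> (a, b) = \<omega>' (a, b) \<oplus>\<^bsub>R\<^esub> \<eta> (lie_bracket T a b)"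
      if "a \<in> carrier T" "b \<in> carrier T" for a b
      using \<eta>(2) that by blast
    show "f (D_cochain T R \<omega> (x, y)) = f (D_cochain T R \<omega>' (x, y) \<oplus>\<^bsub>R\<^esub> \<eta> (dmap T (lie_bracket T x y)))"
      using f that
      by (simp add: D_cochain_def e scalar_simps dmap_derivation cocycle_simps(1)[OF \<omega>'] linear_map_simps(1,2)[OF \<eta>(1)])
  next
    show "D_cochain T R \<omega> (x, y) \<in> carrier R"
      using that by (simp add: D_cochain_def cocycle_simps(1)[OF assms])
    show "D_cochain T R \<omega>' (x, y) \<oplus>\<^bsub>R\<^esub> \<eta> (dmap T (lie_bracket T x y)) \<in> carrier R"
      using that by (simp add: D_cochain_def cocycle_simps(1)[OF \<omega>'] linear_map_simps(1)[OF \<eta>(1)])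
  qed
  then show "cohomologous (D_cochain T R \<omega>') (D_cochain T R \<omega>)"
    unfolding cohomologous_def using lin by (intro bexI[of _ "\<lambda>x. \<eta> (dmap T x)"]) auto
qed

lemma mem_H2_D_minus_iff:
  assumes "\<omega> \<in> cocycles T R"
  shows "cohomology_class T R \<omega> \<in> H2_D_minus T R \<longleftrightarrow>
    cohomology_class T R (pullback T (theta T) \<omega>) = cohomology_class T R (\<ominus>\<^bsub>Z2 T R\<^esub> \<omega>) \<and>
    cohomology_class T R (D_cochain T R \<omega>) = cohomology_class T R \<zero>\<^bsub>Z2 T R\<^esub>"
  using assms
  by (auto simp: H2_D_minus_def carrier_H2 quot_map_theta quot_map_D_cochain uminus_H2 zero_H2)

lemma invariant_cocycle_class:
  assumes "\<omega> \<in> invariant_cocycles T R"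
  shows "cohomology_class T R \<omega> \<in> H2_D_minus T R"
  using assms mem_H2_D_minus_iff[of \<omega>] by (auto simp: invariant_cocycles_def Z2_simps)

text \<open>
  The sum is \<open>g (D [Da, Db])\<close>. It vanishes because over the complex numbers \<open>Da\<close> and \<open>Db\<close> are
  combinations of eigenvectors of \<open>D\<close> for \<open>\<plusminus>i\<close>, and the bracket of two of these has an
  eigenvalue in \<open>{0, \<plusminus>2i}\<close>, of which \<open>D\<close> admits only \<open>0\<close>. Over the reals it is obtained by
  expanding \<open>D\<^sup>3 [a, b] = - D [a, b]\<close> with the Leibniz rule.
\<close>
lemma dmap_kills_bracket_of_images:
  assumes g: "g \<in> dual T" and a: "a \<in> carrier T" and b: "b \<in> carrier T"
  shows "g (lie_bracket T (dmap T (dmap T a)) (dmap T b)) + g (lie_bracket T (dmap T a) (dmap T (dmap T b))) = 0"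
proof -
  have "dmap T (dmap T (dmap T (lie_bracket T a b))) = \<ominus> dmap T (lie_bracket T a b)"
    using a b by (simp add: dmap_cubed)
  then have "g (dmap T (dmap T (dmap T (lie_bracket T a b)))) = - g (dmap T (lie_bracket T a b))"
    using a b g by (simp only: functional_simps dmap_closed bracket_closed)
  moreover have "g (dmap T (dmap T (dmap T (lie_bracket T a b)))) =
      g (lie_bracket T (dmap T (dmap T (dmap T a))) b) + 3 * g (lie_bracket T (dmap T (dmap T a)) (dmap T b))
      + 3 * g (lie_bracket T (dmap T a) (dmap T (dmap T b))) + g (lie_bracket T a (dmap T (dmap T (dmap T b))))"
    using a b g by (simp add: dmap_derivation dmap_simps functional_simps)
  moreover have "g (lie_bracket T (dmap T (dmap T (dmap T a))) b) = - g (lie_bracket T (dmap T a) b)"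
    "g (lie_bracket T a (dmap T (dmap T (dmap T b)))) = - g (lie_bracket T a (dmap T b))"
    "g (dmap T (lie_bracket T a b)) = g (lie_bracket T (dmap T a) b) + g (lie_bracket T a (dmap T b))"
    using a b g by (simp_all add: dmap_cubed dmap_derivation functional_simps bracket_simps)
  ultimately show ?thesis by simp
qed

text \<open>
  If \<open>D\<omega> = \<eta> [\<cdot>, \<cdot>]\<close>, then \<open>D\<^sup>2\<omega> = \<eta> (D [\<cdot>, \<cdot>])\<close> is a coboundary, and \<open>u = \<omega> + D\<^sup>2\<omega>\<close>
  is cohomologous to \<open>\<omega>\<close>. It is killed by \<open>D\<close>: on \<open>2\<close>-forms \<open>D\<close> is semisimple with
  eigenvalues in \<open>{0, \<plusminus>i, \<plusminus>2i}\<close>, and the exact form \<open>D\<omega>\<close> has only components for \<open>\<plusminus>i\<close>, on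
  which \<open>1 + D\<^sup>2\<close> vanishes.
\<close>
lemma D_invariant_representative:
  assumes \<omega>: "\<omega> \<in> cocycles T R"
    and "cohomology_class T R (D_cochain T R \<omega>) = cohomology_class T R \<zero>\<^bsub>Z2 T R\<^esub>"
  obtains u where "u \<in> cocycles T R" "cohomology_class T R u = cohomology_class T R \<omega>"
    "\<And>x y. x \<in> carrier T \<Longrightarrow> y \<in> carrier T \<Longrightarrow> u (dmap T x, y) \<oplus>\<^bsub>R\<^esub> u (x, dmap T y) = \<zero>\<^bsub>R\<^esub>"
proof -
  interpret R: real_vs R by (rule R_real_vs)
  have "cohomologous \<zero>\<^bsub>Z2 T R\<^esub> (D_cochain T R \<omega>)"
    using assms(2) cohomology_class_eq_iff[OF zero_cocycle D_cochain_cocycle[OF \<omega>]] by (simp add: Z2_simps)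
  then obtain \<eta> where \<eta>: "\<eta> \<in> linear_maps T R"
    "\<forall>x\<in>carrier T. \<forall>y\<in>carrier T. D_cochain T R \<omega> (x, y) = \<zero>\<^bsub>Z2 T R\<^esub> (x, y) \<oplus>\<^bsub>R\<^esub> \<eta> (lie_bracket T x y)"
    unfolding cohomologous_def by blast
  have eta: "\<omega> (dmap T x, y) \<oplus>\<^bsub>R\<^esub> \<omega> (x, dmap T y) = \<eta> (lie_bracket T x y)"
    if "x \<in> carrier T" "y \<in> carrier T" for x y
    using \<eta>(2) that linear_map_simps(1)[OF \<eta>(1)] by (simp add: D_cochain_def Z2_simps)
  define \<zeta> where "\<zeta> = (\<lambda>x. \<eta> (dmap T x))"
  have \<zeta>: "\<zeta> \<in> linear_maps T R"
    using linear_map_compose[OF dmap_linear \<eta>(1)] by (simp add: \<zeta>_def comp_def)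
  define u where "u = (\<lambda>(x, y)\<in>carrier T \<times> carrier T. \<omega> (x, y) \<oplus>\<^bsub>R\<^esub> \<zeta> (lie_bracket T x y))"
  show ?thesis
  proof (rule that[of u])
    show "u \<in> cocycles T R" "cohomology_class T R u = cohomology_class T R \<omega>"
      unfolding u_def by (rule cohomologous_add_coboundary[OF \<omega> \<zeta>])+
    fix x y assume xy: "x \<in> carrier T" "y \<in> carrier T"
    show "u (dmap T x, y) \<oplus>\<^bsub>R\<^esub> u (x, dmap T y) = \<zero>\<^bsub>R\<^esub>"
    proof (rule coeff_eqI)
      fix f assume f: "f \<in> dual R"
      define n where "n = (\<lambda>v. f (\<eta> v))"
      define w where "w a b = f (\<omega> (a, b))" for a b
      have n: "n \<in> dual T" unfolding n_def by (rule linear_map_functional[OF \<eta>(1) f])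
      have E: "w (dmap T a) b + w a (dmap T b) = n (lie_bracket T a b)"
        if "a \<in> carrier T" "b \<in> carrier T" for a b
        using arg_cong[OF eta[OF that], of f] that f
        by (simp add: w_def n_def scalar_simps cocycle_simps[OF \<omega>])
      have w3: "w (dmap T (dmap T (dmap T a))) b = - w (dmap T a) b"
        "w b (dmap T (dmap T (dmap T a))) = - w b (dmap T a)"
        if "a \<in> carrier T" "b \<in> carrier T" for a b
        using that f by (simp_all add: w_def dmap_cubed cocycle_simps[OF \<omega>] scalar_simps)
      \<comment> \<open>The equations W and V express that \<open>\<omega>\<close> has no component for the eigenvalues \<open>\<plusminus>2i\<close>.\<close>
      have W: "w (dmap T (dmap T a)) (dmap T (dmap T b)) = w (dmap T a) (dmap T b)"
        if "a \<in> carrier T" "b \<in> carrier T" for a b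
        using that E[of "dmap T (dmap T a)" "dmap T b"] E[of "dmap T a" "dmap T (dmap T b)"]
          dmap_kills_bracket_of_images[OF n that] w3[of a "dmap T b"] w3[of b "dmap T a"] by simp
      have V: "w (dmap T x) (dmap T (dmap T y)) + w (dmap T (dmap T x)) (dmap T y) = 0"
        using W[of "dmap T x" y] w3[of x "dmap T (dmap T y)"] xy by simp
      have "f (u (dmap T x, y) \<oplus>\<^bsub>R\<^esub> u (x, dmap T y)) =
          w (dmap T x) y + w x (dmap T y) + n (lie_bracket T (dmap T (dmap T x)) y)
          + 2 * n (lie_bracket T (dmap T x) (dmap T y)) + n (lie_bracket T x (dmap T (dmap T y)))"
        using f xy
        by (simp add: u_def w_def n_def \<zeta>_def scalar_simps cocycle_simps[OF \<omega>] linear_map_simps[OF \<eta>(1)]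
          dmap_derivation)
      also have "\<dots> = 0"
        using E[of "dmap T (dmap T x)" y] E[of "dmap T x" "dmap T y"] E[of x "dmap T (dmap T y)"]
          w3[of x y] w3[of y x] V xy by simp
      finally show "f (u (dmap T x, y) \<oplus>\<^bsub>R\<^esub> u (x, dmap T y)) = f \<zero>\<^bsub>R\<^esub>" using f by (simp add: scalar_simps)
    qed (use xy in \<open>auto simp: u_def cocycle_simps[OF \<omega>] linear_map_simps[OF \<zeta>]\<close>)
  qed
qed

text \<open>
  After the choice of a representative \<open>u\<close> with \<open>Du = 0\<close>, the cocycle \<open>(u - \<theta>\<^sup>*u) / 2\<close> has the
  required symmetry. It represents the same class since \<open>\<theta>\<^sup>*u\<close> is cohomologous to \<open>-u\<close>, and
  \<open>D\<close> still kills it since \<open>D\<close> anticommutes with \<open>\<theta>\<close>.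
\<close>
lemma invariant_representative:
  assumes "a \<in> H2_D_minus T R"
  obtains \<omega> where "\<omega> \<in> invariant_cocycles T R" "cohomology_class T R \<omega> = a"
proof -
  interpret R: real_vs R by (rule R_real_vs)
  obtain \<omega> where \<omega>: "\<omega> \<in> cocycles T R" "a = cohomology_class T R \<omega>"
    using assms unfolding H2_D_minus_def carrier_H2 by blast
  obtain u where u: "u \<in> cocycles T R" "cohomology_class T R u = a"
    and uD: "\<And>x y. x \<in> carrier T \<Longrightarrow> y \<in> carrier T \<Longrightarrow> u (dmap T x, y) \<oplus>\<^bsub>R\<^esub> u (x, dmap T y) = \<zero>\<^bsub>R\<^esub>"
    using D_invariant_representative[OF \<omega>(1)] assms mem_H2_D_minus_iff[OF \<omega>(1)] \<omega>(2) by metis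
  have "cohomology_class T R (pullback T (theta T) u) = cohomology_class T R (\<ominus>\<^bsub>Z2 T R\<^esub> u)"
    using assms mem_H2_D_minus_iff[OF u(1)] u(2) by simp
  then have "cohomologous (\<ominus>\<^bsub>Z2 T R\<^esub> u) (pullback T (theta T) u)"
    using cohomology_class_eq_iff[OF uminus_Z2(2)[OF u(1)] pullback_theta_cocycle[OF u(1)]] by simp
  then obtain \<zeta> where \<zeta>: "\<zeta> \<in> linear_maps T R"
    "\<forall>x\<in>carrier T. \<forall>y\<in>carrier T. pullback T (theta T) u (x, y) =
      (\<ominus>\<^bsub>Z2 T R\<^esub> u) (x, y) \<oplus>\<^bsub>R\<^esub> \<zeta> (lie_bracket T x y)"
    unfolding cohomologous_def by blast
  have zeta: "u (theta T x, theta T y) = \<ominus>\<^bsub>R\<^esub> u (x, y) \<oplus>\<^bsub>R\<^esub> \<zeta> (lie_bracket T x y)"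
    if "x \<in> carrier T" "y \<in> carrier T" for x y
    using \<zeta>(2) that by (simp add: pullback_def uminus_Z2[OF u(1)])
  \<comment> \<open>Since \<open>\<theta>\<^sup>*u = -u + \<zeta> [\<cdot>, \<cdot>]\<close>, the cocycle \<open>(u - \<theta>\<^sup>*u) / 2\<close> is \<open>u - \<zeta> [\<cdot>, \<cdot>] / 2\<close>.\<close>
  define \<xi> where "\<xi> = (\<lambda>x. (-1/2) \<odot>\<^bsub>R\<^esub> \<zeta> x)"
  have \<xi>: "\<xi> \<in> linear_maps T R"
    unfolding \<xi>_def by (rule linear_map_to_coeffI)
      (auto simp: scalar_simps linear_map_simps[OF \<zeta>(1)] algebra_simps)
  define v where "v = (\<lambda>(x, y)\<in>carrier T \<times> carrier T. u (x, y) \<oplus>\<^bsub>R\<^esub> \<xi> (lie_bracket T x y))"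
  have v: "v \<in> cocycles T R" "cohomology_class T R v = a"
    using cohomologous_add_coboundary[OF u(1) \<xi>] u(2) by (simp_all add: v_def)
  have f_v: "f (v (x, y)) = (f (u (x, y)) - f (u (theta T x, theta T y))) / 2"
    if "f \<in> dual R" "x \<in> carrier T" "y \<in> carrier T" for f x y
    using that zeta[OF that(2,3)]
    by (simp add: v_def \<xi>_def scalar_simps cocycle_simps[OF u(1)] linear_map_simps[OF \<zeta>(1)] field_simps)
  have vc: "v (x, y) \<in> carrier R" if "x \<in> carrier T" "y \<in> carrier T" for x y
    using cocycle_simps(1)[OF v(1) that] .
  have f_uD: "f (u (dmap T x, y)) + f (u (x, dmap T y)) = 0"
    if "f \<in> dual R" "x \<in> carrier T" "y \<in> carrier T" for f x y
    using arg_cong[OF uD[OF that(2,3)], of f] that by (simp add: scalar_simps cocycle_simps[OF u(1)])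
  have "v \<in> invariant_cocycles T R"
    unfolding mem_invariant_cocycles_iff
  proof (intro conjI ballI)
    fix x y assume xy: "x \<in> carrier T" "y \<in> carrier T"
    show "v (theta T x, theta T y) = \<ominus>\<^bsub>R\<^esub> v (x, y)"
      by (rule coeff_eqI) (use xy vc in \<open>auto simp: scalar_simps f_v theta_involutive field_simps\<close>)
    show "v (dmap T x, y) \<oplus>\<^bsub>R\<^esub> v (x, dmap T y) = \<zero>\<^bsub>R\<^esub>"
    proof (rule coeff_eqI)
      fix f assume f: "f \<in> dual R"
      show "f (v (dmap T x, y) \<oplus>\<^bsub>R\<^esub> v (x, dmap T y)) = f \<zero>\<^bsub>R\<^esub>"
        using f xy vc f_uD[OF f xy] f_uD[OF f, of "theta T x" "theta T y"]
        by (simp add: scalar_simps f_v theta_dmap cocycle_simps[OF u(1)] add_divide_distrib[symmetric])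
    qed (use xy vc in auto)
  qed (rule v(1))
  then show ?thesis using that v(2) by blast
qed

text \<open>
  Precomposition with \<open>1 + D\<^sup>2\<close>, the projection onto the kernel of \<open>D\<close>, and with
  \<open>(1 - \<theta>) / 2\<close> makes a linear map vanish on the image of \<open>D\<close> and skew under \<open>\<theta>\<close>. The
  premises of the last clause hold at those \<open>x\<close> where \<open>q\<close> behaves like such a map already.
\<close>
lemma skew_part:
  assumes q: "q \<in> linear_maps T R"
  obtains p where "p \<in> linear_maps T R"
    and "\<And>x. x \<in> carrier T \<Longrightarrow> p (dmap T x) = \<zero>\<^bsub>R\<^esub>"
    and "\<And>x. x \<in> carrier T \<Longrightarrow> p (theta T x) = \<ominus>\<^bsub>R\<^esub> p x"
    and "\<And>x. x \<in> carrier T \<Longrightarrow> q (dmap T (dmap T x)) = \<zero>\<^bsub>R\<^esub> \<Longrightarrow>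
      q (theta T (dmap T (dmap T x))) = \<zero>\<^bsub>R\<^esub> \<Longrightarrow> q (theta T x) = \<ominus>\<^bsub>R\<^esub> q x \<Longrightarrow> p x = q x"
proof -
  note [simp] = linear_map_simps(1)[OF q]
  define P where "P x = x \<oplus> dmap T (dmap T x)" for x
  define p where "p x = (1/2) \<odot>\<^bsub>R\<^esub> (q (P x) \<oplus>\<^bsub>R\<^esub> \<ominus>\<^bsub>R\<^esub> q (theta T (P x)))" for x
  have Pc [simp]: "P x \<in> carrier T" if "x \<in> carrier T" for x using that by (simp add: P_def)
  have pc [simp]: "p x \<in> carrier R" if "x \<in> carrier T" for x using that by (simp add: p_def)
  have p_eq: "f (p x) = (f (q x) + f (q (dmap T (dmap T x)))
      - f (q (theta T x)) - f (q (theta T (dmap T (dmap T x))))) / 2"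
    if "f \<in> dual R" "x \<in> carrier T" for f x
    using that by (simp add: p_def P_def scalar_simps linear_map_simps[OF q] theta_simps)
  show ?thesis
  proof (rule that[of p])
    show "p \<in> linear_maps T R"
      by (rule linear_map_to_coeffI)
        (auto simp: p_eq dmap_simps theta_simps linear_map_simps[OF q] scalar_simps algebra_simps add_divide_distrib diff_divide_distrib)
    show "p (dmap T x) = \<zero>\<^bsub>R\<^esub>" if "x \<in> carrier T" for x
      by (rule coeff_eqI) (use that in \<open>auto simp: p_eq dmap_cubed theta_simps linear_map_simps[OF q] scalar_simps\<close>)
    show "p (theta T x) = \<ominus>\<^bsub>R\<^esub> p x" if "x \<in> carrier T" for x
      by (rule coeff_eqI) (use that in \<open>auto simp: p_eq theta_involutive dmap_theta dmap_simps linear_map_simps[OF q] scalar_simps field_simps\<close>)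
    show "p x = q x" if "x \<in> carrier T" "q (dmap T (dmap T x)) = \<zero>\<^bsub>R\<^esub>"
      "q (theta T (dmap T (dmap T x))) = \<zero>\<^bsub>R\<^esub>" "q (theta T x) = \<ominus>\<^bsub>R\<^esub> q x" for x
      by (rule coeff_eqI) (use that in \<open>auto simp: p_eq scalar_simps\<close>)
  qed
qed

text \<open>
  The difference of the two cocycles has the symmetries of both, so the \<open>\<eta>\<close> that relates them has
  them on brackets. Hence passing to its skew part does not change it there.
\<close>
lemma cohomologous_invariant_cocycles:
  assumes \<omega>: "\<omega> \<in> invariant_cocycles T R" and \<omega>': "\<omega>' \<in> invariant_cocycles T R"
    and "cohomology_class T R \<omega> = cohomology_class T R \<omega>'"
  obtains \<eta> where "\<eta> \<in> linear_maps T R"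
    and "\<And>x. x \<in> carrier T \<Longrightarrow> \<eta> (dmap T x) = \<zero>\<^bsub>R\<^esub>"
    and "\<And>x. x \<in> carrier T \<Longrightarrow> \<eta> (theta T x) = \<ominus>\<^bsub>R\<^esub> \<eta> x"
    and "\<And>x y. x \<in> carrier T \<Longrightarrow> y \<in> carrier T \<Longrightarrow>
      \<omega>' (x, y) = \<omega> (x, y) \<oplus>\<^bsub>R\<^esub> \<eta> (lie_bracket T x y)"
proof -
  interpret R: real_vs R by (rule R_real_vs)
  have c: "\<omega> \<in> cocycles T R" "\<omega>' \<in> cocycles T R"
    using \<omega> \<omega>' by (auto simp: mem_invariant_cocycles_iff)
  obtain q where q: "q \<in> linear_maps T R"
    "\<forall>x\<in>carrier T. \<forall>y\<in>carrier T. \<omega>' (x, y) = \<omega> (x, y) \<oplus>\<^bsub>R\<^esub> q (lie_bracket T x y)"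
    using assms(3) cohomology_class_eq_iff[OF c] unfolding cohomologous_def by blast
  note [simp] = linear_map_simps(1)[OF q(1)]
  have fq: "f (q (lie_bracket T x y)) = f (\<omega>' (x, y)) - f (\<omega> (x, y))"
    if "f \<in> dual R" "x \<in> carrier T" "y \<in> carrier T" for f x y
    using that q(2) by (simp add: scalar_simps cocycle_simps[OF c(1)])
  have inv: "f (w (theta T x, theta T y)) = - f (w (x, y))"
    "f (w (dmap T x, y)) + f (w (x, dmap T y)) = 0"
    if "w \<in> invariant_cocycles T R" "f \<in> dual R" "x \<in> carrier T" "y \<in> carrier T" for w f x y
  proof -
    have w: "w \<in> cocycles T R" using that by (simp add: mem_invariant_cocycles_iff)
    have 1: "w (theta T x, theta T y) = \<ominus>\<^bsub>R\<^esub> w (x, y)"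
      and 2: "w (dmap T x, y) \<oplus>\<^bsub>R\<^esub> w (x, dmap T y) = \<zero>\<^bsub>R\<^esub>"
      using that by (auto simp: mem_invariant_cocycles_iff)
    show "f (w (theta T x, theta T y)) = - f (w (x, y))"
      using that 1 by (simp add: scalar_simps cocycle_simps[OF w])
    show "f (w (dmap T x, y)) + f (w (x, dmap T y)) = 0"
      using that arg_cong[OF 2, of f] by (simp add: scalar_simps cocycle_simps[OF w])
  qed
  have qD: "q (dmap T (lie_bracket T x y)) = \<zero>\<^bsub>R\<^esub>" if "x \<in> carrier T" "y \<in> carrier T" for x y
  proof (rule coeff_eqI)
    fix f assume f: "f \<in> dual R"
    show "f (q (dmap T (lie_bracket T x y))) = f \<zero>\<^bsub>R\<^esub>"
      using f that inv(2)[OF \<omega> f that] inv(2)[OF \<omega>' f that]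
      by (simp add: scalar_simps dmap_derivation linear_map_simps(2)[OF q(1)] fq)
  qed (use that in auto)
  have qD2: "q (dmap T (dmap T (lie_bracket T x y))) = \<zero>\<^bsub>R\<^esub>" if "x \<in> carrier T" "y \<in> carrier T" for x y
    using that qD[of "dmap T x" y] qD[of x "dmap T y"]
    by (simp add: dmap_derivation[of x y] dmap_simps linear_map_simps(2)[OF q(1)])
  have qt: "q (theta T (lie_bracket T x y)) = \<ominus>\<^bsub>R\<^esub> q (lie_bracket T x y)"
    if "x \<in> carrier T" "y \<in> carrier T" for x y
  proof (rule coeff_eqI)
    fix f assume f: "f \<in> dual R"
    show "f (q (theta T (lie_bracket T x y))) = f (\<ominus>\<^bsub>R\<^esub> q (lie_bracket T x y))"
      using f that inv(1)[OF \<omega> f that] inv(1)[OF \<omega>' f that]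
      by (simp add: scalar_simps theta_bracket fq)
  qed (use that in auto)
  have qtD2: "q (theta T (dmap T (dmap T (lie_bracket T x y)))) = \<zero>\<^bsub>R\<^esub>"
    if "x \<in> carrier T" "y \<in> carrier T" for x y
    using that qD2[of "theta T x" "theta T y"] by (simp add: theta_dmap theta_bracket dmap_simps)
  obtain p where p: "p \<in> linear_maps T R"
    "\<And>x. x \<in> carrier T \<Longrightarrow> p (dmap T x) = \<zero>\<^bsub>R\<^esub>"
    "\<And>x. x \<in> carrier T \<Longrightarrow> p (theta T x) = \<ominus>\<^bsub>R\<^esub> p x"
    "\<And>x. x \<in> carrier T \<Longrightarrow> q (dmap T (dmap T x)) = \<zero>\<^bsub>R\<^esub> \<Longrightarrow>
      q (theta T (dmap T (dmap T x))) = \<zero>\<^bsub>R\<^esub> \<Longrightarrow> q (theta T x) = \<ominus>\<^bsub>R\<^esub> q x \<Longrightarrow> p x = q x"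
    using skew_part[OF q(1)] by blast
  show ?thesis
    by (rule that[OF p(1-3)]) (use q(2) qD2 qt qtD2 p(4) in auto)
qed

end

section \<open>Extensions in coordinates\<close>

text \<open>
  Coordinates \<open>(\<pi>, p)\<close> that identify a structure \<open>T\<close> with the extension of \<open>T0\<close> by \<open>R\<close> defined
  by \<open>\<omega>\<close>. In this form one verification of the axioms covers the extension itself, its copies on
  other types and the weak triples in which coordinates have been found.
\<close>
locale extension_model = base: triple_with_coefficients T0 R
  for T0 :: "('a, 'm) lie_triple_scheme" and R :: "(real, 'r) module" +
  fixes \<omega> :: "'a \<times> 'a \<Rightarrow> 'r" and T :: "('u, 'n) lie_triple_scheme" (structure)
    and \<pi> :: "'u \<Rightarrow> 'a" and p :: "'u \<Rightarrow> 'r"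
  assumes nondegenerate_base: "nondegenerate_on T0 (carrier T0)"
    and invariant: "\<omega> \<in> invariant_cocycles T0 R"
    and model_vectorspace: "vectorspace \<R> T"
    and model_closed:
      "\<lbrakk>x \<in> carrier T; y \<in> carrier T\<rbrakk> \<Longrightarrow> lie_bracket T x y \<in> carrier T"
      "x \<in> carrier T \<Longrightarrow> dmap T x \<in> carrier T"
      "x \<in> carrier T \<Longrightarrow> theta T x \<in> carrier T"
    and \<pi>_linear: "\<pi> \<in> linear_maps T T0"
    and p_linear: "p \<in> linear_maps T R"
    and components_bij: "bij_betw (\<lambda>x. (\<pi> x, p x)) (carrier T) (carrier T0 \<times> carrier R)"
    and \<pi>_bracket: "\<lbrakk>x \<in> carrier T; y \<in> carrier T\<rbrakk> \<Longrightarrow> \<pi> (lie_bracket T x y) = lie_bracket T0 (\<pi> x) (\<pi> y)"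
    and p_bracket: "\<lbrakk>x \<in> carrier T; y \<in> carrier T\<rbrakk> \<Longrightarrow> p (lie_bracket T x y) = \<omega> (\<pi> x, \<pi> y)"
    and model_form: "\<lbrakk>x \<in> carrier T; y \<in> carrier T\<rbrakk> \<Longrightarrow> form T x y = form T0 (\<pi> x) (\<pi> y)"
    and \<pi>_dmap: "x \<in> carrier T \<Longrightarrow> \<pi> (dmap T x) = dmap T0 (\<pi> x)"
    and p_dmap: "x \<in> carrier T \<Longrightarrow> p (dmap T x) = \<zero>\<^bsub>R\<^esub>"
    and \<pi>_theta: "x \<in> carrier T \<Longrightarrow> \<pi> (theta T x) = theta T0 (\<pi> x)"
    and p_theta: "x \<in> carrier T \<Longrightarrow> p (theta T x) = \<ominus>\<^bsub>R\<^esub> p x"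
begin

sublocale real_vs T
  using model_vectorspace by (simp add: real_vs_def)

lemma model_eqI:
  "\<lbrakk>x \<in> carrier T; y \<in> carrier T; \<pi> x = \<pi> y; p x = p y\<rbrakk> \<Longrightarrow> x = y"
  using components_bij by (auto simp: bij_betw_def inj_on_def)

lemma model_lift:
  assumes "a \<in> carrier T0" "r \<in> carrier R"
  obtains x where "x \<in> carrier T" "\<pi> x = a" "p x = r"
proof -
  have "(a, r) \<in> (\<lambda>x. (\<pi> x, p x)) ` carrier T" using assms components_bij by (auto simp: bij_betw_def)
  then show ?thesis using that by auto
qed

lemma \<pi>_simps:
  "x \<in> carrier T \<Longrightarrow> \<pi> x \<in> carrier T0"
  "x \<in> carrier T \<Longrightarrow> y \<in> carrier T \<Longrightarrow> \<pi> (x \<oplus> y) = \<pi> x \<oplus>\<^bsub>T0\<^esub> \<pi> y"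
  "x \<in> carrier T \<Longrightarrow> \<pi> (c \<odot> x) = c \<odot>\<^bsub>T0\<^esub> \<pi> x"
  "\<pi> \<zero> = \<zero>\<^bsub>T0\<^esub>"
  "x \<in> carrier T \<Longrightarrow> \<pi> (\<ominus> x) = \<ominus>\<^bsub>T0\<^esub> \<pi> x"
  using linear_map_closed[OF \<pi>_linear] linear_map_add[OF \<pi>_linear] linear_map_smult[OF \<pi>_linear]
    linear_map_zero[OF \<pi>_linear model_vectorspace base.vectorspace_axioms]
    linear_map_uminus[OF \<pi>_linear model_vectorspace base.vectorspace_axioms] by auto

lemma p_simps:
  "x \<in> carrier T \<Longrightarrow> p x \<in> carrier R"
  "x \<in> carrier T \<Longrightarrow> y \<in> carrier T \<Longrightarrow> p (x \<oplus> y) = p x \<oplus>\<^bsub>R\<^esub> p y"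
  "x \<in> carrier T \<Longrightarrow> p (c \<odot> x) = c \<odot>\<^bsub>R\<^esub> p x"
  "p \<zero> = \<zero>\<^bsub>R\<^esub>"
  "x \<in> carrier T \<Longrightarrow> p (\<ominus> x) = \<ominus>\<^bsub>R\<^esub> p x"
  using linear_map_closed[OF p_linear] linear_map_add[OF p_linear] linear_map_smult[OF p_linear]
    linear_map_zero[OF p_linear model_vectorspace base.R_vectorspace]
    linear_map_uminus[OF p_linear model_vectorspace base.R_vectorspace] by auto

lemmas structure_simps =
  model_closed \<pi>_bracket p_bracket \<pi>_dmap p_dmap \<pi>_theta p_theta

lemma \<omega>_cocycle: "\<omega> \<in> cocycles T0 R"
  using invariant by (simp add: base.mem_invariant_cocycles_iff)

lemma \<omega>_theta: "x \<in> carrier T0 \<Longrightarrow> y \<in> carrier T0 \<Longrightarrow> \<omega> (theta T0 x, theta T0 y) = \<ominus>\<^bsub>R\<^esub> \<omega> (x, y)"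
  and \<omega>_dmap: "x \<in> carrier T0 \<Longrightarrow> y \<in> carrier T0 \<Longrightarrow>
    \<omega> (dmap T0 x, y) \<oplus>\<^bsub>R\<^esub> \<omega> (x, dmap T0 y) = \<zero>\<^bsub>R\<^esub>"
  using invariant by (auto simp: base.mem_invariant_cocycles_iff)

lemma eq_uminus_self: "r \<in> carrier R \<Longrightarrow> r = \<ominus>\<^bsub>R\<^esub> r \<Longrightarrow> r = \<zero>\<^bsub>R\<^esub>"
proof (rule base.coeff_eqI)
  fix f assume r: "r \<in> carrier R" "r = \<ominus>\<^bsub>R\<^esub> r" and f: "f \<in> dual R"
  have "f r = - f r" using arg_cong[OF r(2), of f] f r(1) by (simp add: base.scalar_simps)
  then show "f r = f \<zero>\<^bsub>R\<^esub>" using f by (simp add: base.scalar_simps)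
qed auto

lemma uminus_zero_coeff: "\<ominus>\<^bsub>R\<^esub> \<zero>\<^bsub>R\<^esub> = \<zero>\<^bsub>R\<^esub>"
  by (rule base.coeff_eqI) (simp_all add: base.scalar_simps)

lemma model_lie_algebra: "lie_algebra T"
proof (rule lie_algebra.intro[OF model_vectorspace], rule lie_algebra_axioms.intro)
  interpret R: real_vs R by (rule base.R_real_vs)
  let ?V = "direct_sum T0 R" and ?h = "\<lambda>x. (\<pi> x, p x)"
  have V: "vectorspace \<R> ?V" using direct_sum_is_vs[OF base.vectorspace_axioms base.R_vectorspace] .
  have h: "?h \<in> linear_maps T ?V"
    by (rule linear_mapsI) (auto simp: direct_sum_def \<pi>_simps p_simps)
  have b: "bij_betw ?h (carrier T) (carrier ?V)" using components_bij by (simp add: direct_sum_def)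
  show fin_dim
    using fin_dim_image[OF inv_into_linear[OF model_vectorspace h b] V model_vectorspace]
      fin_dim_direct_sum[OF base.vectorspace_axioms base.finite_dimensional base.R_vectorspace base.R_fin_dim]
      bij_betw_imp_surj_on[OF bij_betw_inv_into[OF b]] by blast
  show "bilinear_map T T T (lie_bracket T)"
    unfolding bilinear_map_def
  proof (intro conjI ballI linear_mapsI)
    fix x y z assume [simp]: "x \<in> carrier T" "y \<in> carrier T" "z \<in> carrier T"
    note [simp] = structure_simps \<pi>_simps p_simps base.bracket_simps base.cocycle_simps[OF \<omega>_cocycle]
    show "lie_bracket T x (y \<oplus> z) = lie_bracket T x y \<oplus> lie_bracket T x z"
      by (rule model_eqI) simp_all
    show "lie_bracket T (y \<oplus> z) x = lie_bracket T y x \<oplus> lie_bracket T z x"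
      by (rule model_eqI) simp_all
  next
    fix c x y assume [simp]: "x \<in> carrier T" "y \<in> carrier T"
    note [simp] = structure_simps \<pi>_simps p_simps base.bracket_simps base.cocycle_simps[OF \<omega>_cocycle]
    show "lie_bracket T x (c \<odot> y) = c \<odot> lie_bracket T x y"
      by (rule model_eqI) simp_all
    show "lie_bracket T (c \<odot> y) x = c \<odot> lie_bracket T y x"
      by (rule model_eqI) simp_all
  qed (simp_all add: model_closed)
  show "lie_bracket T x x = \<zero>" if "x \<in> carrier T" for x
    using that by (intro model_eqI)
      (simp_all add: structure_simps \<pi>_simps p_simps base.bracket_alternating base.cocycle_simps[OF \<omega>_cocycle])
  show "lie_bracket T (lie_bracket T x y) z \<oplus> lie_bracket T (lie_bracket T y z) x
      \<oplus> lie_bracket T (lie_bracket T z x) y = \<zero>"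
    if "x \<in> carrier T" "y \<in> carrier T" "z \<in> carrier T" for x y z
    using that by (intro model_eqI)
      (simp_all add: structure_simps \<pi>_simps p_simps base.jacobi cocycle_cyclic[OF \<omega>_cocycle])
qed

text \<open>
  The kernel of \<open>\<pi>\<close> is a copy of \<open>R\<close> on which \<open>\<theta>\<close> is \<open>-1\<close> and \<open>D\<close> is \<open>0\<close>. It therefore
  contributes to \<^const>\<open>lower_minus\<close> and \<^const>\<open>upper_plus\<close>, and not to \<^const>\<open>lower_plus\<close> and
  \<^const>\<open>upper_minus\<close>, where the coordinate \<open>p\<close> has to vanish.
\<close>
lemma mem_lower_plus: "x \<in> lower_plus T \<longleftrightarrow> x \<in> carrier T \<and> \<pi> x \<in> lower_plus T0 \<and> p x = \<zero>\<^bsub>R\<^esub>"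
proof -
  interpret R: real_vs R by (rule base.R_real_vs)
  have "theta T x = x \<longleftrightarrow> theta T0 (\<pi> x) = \<pi> x \<and> p x = \<zero>\<^bsub>R\<^esub>" if x: "x \<in> carrier T" for x
  proof
    assume a: "theta T x = x"
    then have "p x = \<ominus>\<^bsub>R\<^esub> p x" using p_theta[OF x] by simp
    then show "theta T0 (\<pi> x) = \<pi> x \<and> p x = \<zero>\<^bsub>R\<^esub>"
      using a \<pi>_theta[OF x] eq_uminus_self p_simps(1)[OF x] by simp
  next
    assume "theta T0 (\<pi> x) = \<pi> x \<and> p x = \<zero>\<^bsub>R\<^esub>"
    then show "theta T x = x" using x by (intro model_eqI) (simp_all add: structure_simps)
  qed
  then show ?thesis by (auto simp: lower_plus_def \<pi>_simps)
qed

lemma mem_upper_plus: "x \<in> upper_plus T \<longleftrightarrow> x \<in> carrier T \<and> \<pi> x \<in> upper_plus T0"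
proof -
  have "dmap T x = \<zero> \<longleftrightarrow> dmap T0 (\<pi> x) = \<zero>\<^bsub>T0\<^esub>" if x: "x \<in> carrier T" for x
  proof
    assume "dmap T x = \<zero>"
    then show "dmap T0 (\<pi> x) = \<zero>\<^bsub>T0\<^esub>" using \<pi>_dmap[OF x] \<pi>_simps(4) by simp
  next
    assume "dmap T0 (\<pi> x) = \<zero>\<^bsub>T0\<^esub>"
    then show "dmap T x = \<zero>" using x by (intro model_eqI) (simp_all add: structure_simps \<pi>_simps p_simps)
  qed
  then show ?thesis by (auto simp: upper_plus_def \<pi>_simps)
qed

lemma mem_upper_minus: "x \<in> upper_minus T \<longleftrightarrow> x \<in> carrier T \<and> \<pi> x \<in> upper_minus T0 \<and> p x = \<zero>\<^bsub>R\<^esub>"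
proof -
  interpret R: real_vs R by (rule base.R_real_vs)
  have "dmap T (dmap T x) = \<ominus> x \<longleftrightarrow> dmap T0 (dmap T0 (\<pi> x)) = \<ominus>\<^bsub>T0\<^esub> \<pi> x \<and> p x = \<zero>\<^bsub>R\<^esub>"
    if x: "x \<in> carrier T" for x
  proof
    assume a: "dmap T (dmap T x) = \<ominus> x"
    have "\<ominus>\<^bsub>R\<^esub> p x = \<zero>\<^bsub>R\<^esub>"
      using arg_cong[OF a, of p] x by (simp add: structure_simps p_simps)
    then have "p x = \<zero>\<^bsub>R\<^esub>" using R.r_neg[OF p_simps(1)[OF x]] R.r_zero[OF p_simps(1)[OF x]] by simp
    then show "dmap T0 (dmap T0 (\<pi> x)) = \<ominus>\<^bsub>T0\<^esub> \<pi> x \<and> p x = \<zero>\<^bsub>R\<^esub>"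
      using arg_cong[OF a, of \<pi>] x by (simp add: structure_simps \<pi>_simps)
  next
    assume "dmap T0 (dmap T0 (\<pi> x)) = \<ominus>\<^bsub>T0\<^esub> \<pi> x \<and> p x = \<zero>\<^bsub>R\<^esub>"
    then show "dmap T (dmap T x) = \<ominus> x"
      using x by (intro model_eqI) (simp_all add: structure_simps \<pi>_simps p_simps uminus_zero_coeff)
  qed
  then show ?thesis by (auto simp: upper_minus_def \<pi>_simps)
qed

lemma mem_lower_minus: "x \<in> lower_minus T \<longleftrightarrow> x \<in> carrier T \<and> \<pi> x \<in> lower_minus T0"
proof -
  have "theta T x = \<ominus> x \<longleftrightarrow> theta T0 (\<pi> x) = \<ominus>\<^bsub>T0\<^esub> \<pi> x" if x: "x \<in> carrier T" for x
  proof
    assume a: "theta T x = \<ominus> x"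
    show "theta T0 (\<pi> x) = \<ominus>\<^bsub>T0\<^esub> \<pi> x"
      using arg_cong[OF a, of \<pi>] x by (simp add: structure_simps \<pi>_simps)
  next
    assume "theta T0 (\<pi> x) = \<ominus>\<^bsub>T0\<^esub> \<pi> x"
    then show "theta T x = \<ominus> x" using x by (intro model_eqI) (simp_all add: structure_simps \<pi>_simps p_simps)
  qed
  then show ?thesis by (auto simp: lower_minus_def \<pi>_simps)
qed

text \<open>
  Evaluating \<open>\<theta>\<^sup>*\<omega> = -\<omega>\<close> at fixed points of \<open>\<theta>\<close>.
\<close>
lemma \<omega>_lower_plus:
  assumes "x \<in> lower_plus T0" "y \<in> lower_plus T0"
  shows "\<omega> (x, y) = \<zero>\<^bsub>R\<^esub>"
proof (rule eq_uminus_self)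
  show "\<omega> (x, y) = \<ominus>\<^bsub>R\<^esub> \<omega> (x, y)"
    using assms \<omega>_theta[of x y] by (simp add: lower_plus_def)
qed (use assms in \<open>simp add: lower_plus_def base.cocycle_simps(1)[OF \<omega>_cocycle]\<close>)

text \<open>
  Brackets of elements fixed by \<open>\<theta>\<close> have vanishing coordinate \<open>p\<close>, and both sides of the
  equation lie in the kernel of \<open>p\<close>. There \<open>\<pi>\<close> is injective, so the equation follows from the one
  in \<open>T0\<close>.
\<close>
lemma model_bracket_generates:
  "span {lie_bracket T x y | x y. x \<in> lower_plus T \<inter> upper_minus T \<and> y \<in> lower_plus T \<inter> upper_minus T}
    = lower_plus T \<inter> upper_plus T"
proof -
  interpret R: real_vs R by (rule base.R_real_vs)
  let ?S = "{lie_bracket T x y | x y. x \<in> lower_plus T \<inter> upper_minus T \<and> y \<in> lower_plus T \<inter> upper_minus T}"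
  let ?B = "{lie_bracket T0 x y | x y. x \<in> lower_plus T0 \<inter> upper_minus T0 \<and> y \<in> lower_plus T0 \<inter> upper_minus T0}"
  have S: "?S \<subseteq> carrier T" by (auto simp: mem_lower_plus model_closed)
  have lift: "\<exists>x\<in>lower_plus T \<inter> upper_minus T. \<pi> x = a" if a: "a \<in> lower_plus T0 \<inter> upper_minus T0" for a
  proof -
    have "a \<in> carrier T0" using a by (simp add: lower_plus_def)
    then obtain x where "x \<in> carrier T" "\<pi> x = a" "p x = \<zero>\<^bsub>R\<^esub>" using model_lift[of a "\<zero>\<^bsub>R\<^esub>"] by auto
    then show ?thesis using a by (auto simp: mem_lower_plus mem_upper_minus)
  qed
  have "\<pi> ` ?S \<subseteq> ?B"
  proof
    fix z assume "z \<in> \<pi> ` ?S"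
    then obtain x y where xy: "x \<in> lower_plus T \<inter> upper_minus T" "y \<in> lower_plus T \<inter> upper_minus T"
      "z = \<pi> (lie_bracket T x y)" by auto
    then have "z = lie_bracket T0 (\<pi> x) (\<pi> y)" by (simp add: mem_lower_plus \<pi>_bracket)
    moreover have "\<pi> x \<in> lower_plus T0 \<inter> upper_minus T0" "\<pi> y \<in> lower_plus T0 \<inter> upper_minus T0"
      using xy by (auto simp: mem_lower_plus mem_upper_minus)
    ultimately show "z \<in> ?B" by blast
  qed
  moreover have "?B \<subseteq> \<pi> ` ?S"
  proof
    fix z assume "z \<in> ?B"
    then obtain a b where ab: "a \<in> lower_plus T0 \<inter> upper_minus T0" "b \<in> lower_plus T0 \<inter> upper_minus T0"
      "z = lie_bracket T0 a b" by auto
    obtain x y where x: "x \<in> lower_plus T \<inter> upper_minus T" "\<pi> x = a"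
      and y: "y \<in> lower_plus T \<inter> upper_minus T" "\<pi> y = b" using lift ab by metis
    have "z = \<pi> (lie_bracket T x y)" using x y ab(3) by (simp add: mem_lower_plus \<pi>_bracket)
    moreover have "lie_bracket T x y \<in> ?S" using x y by blast
    ultimately show "z \<in> \<pi> ` ?S" by blast
  qed
  ultimately have "\<pi> ` ?S = ?B" by blast
  then have \<pi>_span: "\<pi> ` span ?S = lower_plus T0 \<inter> upper_plus T0"
    using image_span[OF \<pi>_linear base.vectorspace_axioms S] base.bracket_generates by simp
  have "submodule \<R> {\<zero>\<^bsub>R\<^esub>} R"
    by (rule R.submoduleI) (auto simp: R.smult_r_null)
  note kernel = submodule_vimage[OF p_linear base.R_vectorspace this]
  have "?S \<subseteq> {x \<in> carrier T. p x \<in> {\<zero>\<^bsub>R\<^esub>}}"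
  proof
    fix z assume "z \<in> ?S"
    then obtain x y where xy: "x \<in> lower_plus T" "y \<in> lower_plus T" "z = lie_bracket T x y" by blast
    then show "z \<in> {x \<in> carrier T. p x \<in> {\<zero>\<^bsub>R\<^esub>}}"
      by (simp add: mem_lower_plus model_closed p_bracket \<omega>_lower_plus)
  qed
  then have "span ?S \<subseteq> {x \<in> carrier T. p x \<in> {\<zero>\<^bsub>R\<^esub>}}" by (rule span_is_subset[OF _ kernel])
  then have p_span: "x \<in> carrier T" "p x = \<zero>\<^bsub>R\<^esub>" if "x \<in> span ?S" for x using that by auto
  show ?thesis
  proof (intro equalityI subsetI)
    fix z assume z: "z \<in> span ?S"
    then have "\<pi> z \<in> lower_plus T0 \<inter> upper_plus T0" using \<pi>_span by blast
    then show "z \<in> lower_plus T \<inter> upper_plus T"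
      using p_span[OF z] by (simp add: mem_lower_plus mem_upper_plus)
  next
    fix z assume z: "z \<in> lower_plus T \<inter> upper_plus T"
    then have "\<pi> z \<in> \<pi> ` span ?S" unfolding \<pi>_span by (simp add: mem_lower_plus mem_upper_plus)
    then obtain w where w: "w \<in> span ?S" "\<pi> z = \<pi> w" by blast
    have "z = w" using z w p_span[OF w(1)] by (intro model_eqI) (auto simp: mem_lower_plus)
    then show "z \<in> span ?S" using w by simp
  qed
qed

lemma model_pre_triple: "pre_triple T"
proof (rule pre_triple.intro[OF model_lie_algebra], rule pre_triple_axioms.intro)
  interpret R: real_vs R by (rule base.R_real_vs)
  show "bilinear_map T T real_space (form T)"
    unfolding bilinear_map_def
    by (intro conjI ballI linear_mapsI)
      (simp_all add: model_form \<pi>_simps base.form_left_simps base.form_right_simps real_space_def)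
  show "form T x y = form T y x" if "x \<in> carrier T" "y \<in> carrier T" for x y
    using that by (simp add: model_form \<pi>_simps base.form_symmetric)
  show "form T (lie_bracket T x y) z = - form T y (lie_bracket T x z)"
    if "x \<in> carrier T" "y \<in> carrier T" "z \<in> carrier T" for x y z
    using that by (simp add: model_form structure_simps \<pi>_simps base.form_ad_invariant)
  show "theta T \<in> linear_maps T T"
  proof (rule linear_mapsI)
    show "theta T (x \<oplus> y) = theta T x \<oplus> theta T y" if "x \<in> carrier T" "y \<in> carrier T" for x y
      using that by (intro model_eqI base.coeff_eqI)
        (simp_all add: structure_simps \<pi>_simps p_simps base.theta_simps base.scalar_simps)
    show "theta T (c \<odot> x) = c \<odot> theta T x" if "x \<in> carrier T" for c x
      using that by (intro model_eqI base.coeff_eqI)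
        (simp_all add: structure_simps \<pi>_simps p_simps base.theta_simps base.scalar_simps)
  qed (rule model_closed)
  show "theta T (lie_bracket T x y) = lie_bracket T (theta T x) (theta T y)"
    if "x \<in> carrier T" "y \<in> carrier T" for x y
    using that by (intro model_eqI) (simp_all add: structure_simps \<pi>_simps base.theta_bracket \<omega>_theta)
  show "theta T (theta T x) = x" if "x \<in> carrier T" for x
    using that by (intro model_eqI) (simp_all add: structure_simps \<pi>_simps p_simps base.theta_involutive)
  show "form T (theta T x) (theta T y) = form T x y" if "x \<in> carrier T" "y \<in> carrier T" for x y
    using that by (simp add: model_form structure_simps \<pi>_simps base.theta_form)
  show "dmap T \<in> linear_maps T T"
  proof (rule linear_mapsI)
    show "dmap T (x \<oplus> y) = dmap T x \<oplus> dmap T y" if "x \<in> carrier T" "y \<in> carrier T" for x y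
      using that by (intro model_eqI) (simp_all add: structure_simps \<pi>_simps p_simps base.dmap_simps)
    show "dmap T (c \<odot> x) = c \<odot> dmap T x" if "x \<in> carrier T" for c x
      using that R.smult_r_null[of c]
      by (intro model_eqI) (simp_all add: structure_simps \<pi>_simps p_simps base.dmap_simps)
  qed (rule model_closed)
  show "dmap T (lie_bracket T x y) = lie_bracket T (dmap T x) y \<oplus> lie_bracket T x (dmap T y)"
    if "x \<in> carrier T" "y \<in> carrier T" for x y
    using that by (intro model_eqI)
      (simp_all add: structure_simps \<pi>_simps p_simps base.dmap_derivation \<omega>_dmap)
  show "form T (dmap T x) y = - form T x (dmap T y)" if "x \<in> carrier T" "y \<in> carrier T" for x y
    using that by (simp add: model_form structure_simps \<pi>_simps base.dmap_antisymmetric)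
  show "dmap T (dmap T (dmap T x)) = \<ominus> dmap T x" if "x \<in> carrier T" for x
    using that by (intro model_eqI) (simp_all add: structure_simps \<pi>_simps p_simps base.dmap_cubed uminus_zero_coeff)
  show "dmap T (theta T x) = \<ominus> theta T (dmap T x)" if "x \<in> carrier T" for x
    using that by (intro model_eqI) (simp_all add: structure_simps \<pi>_simps p_simps base.dmap_theta uminus_zero_coeff)
qed (rule model_bracket_generates)


lemma base_extrinsic: "extrinsic_symmetric_triple T0"
  by (rule extrinsic_symmetric_triple.intro[OF base.pre_triple_axioms])
    (rule extrinsic_symmetric_triple_axioms.intro[OF nondegenerate_base])

lemma \<pi>_projection: "\<pi> \<in> triple_projections T T0"
proof -
  have "\<pi> ` carrier T = carrier T0"
  proof (intro equalityI subsetI)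
    fix a assume "a \<in> carrier T0"
    then obtain x where "x \<in> carrier T" "\<pi> x = a" using model_lift[of a "\<zero>\<^bsub>R\<^esub>"] by auto
    then show "a \<in> \<pi> ` carrier T" by blast
  qed (auto simp: \<pi>_simps)
  then show ?thesis
    using \<pi>_linear by (simp add: triple_projections_def \<pi>_bracket model_form \<pi>_dmap \<pi>_theta)
qed

lemma mem_radical: "x \<in> metric_radical T \<longleftrightarrow> x \<in> carrier T \<and> \<pi> x = \<zero>\<^bsub>T0\<^esub>"
  by (simp add: radical_eq_kernel[OF base_extrinsic \<pi>_projection])

lemma p_radical: "p \<in> linear_isos (T\<lparr>carrier := metric_radical T\<rparr>) R"
proof -
  have "p \<in> linear_maps (T\<lparr>carrier := metric_radical T\<rparr>) R"
    by (rule linear_mapsI) (auto simp: mem_radical p_simps)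
  moreover have "bij_betw p (metric_radical T) (carrier R)"
    unfolding bij_betw_def
  proof
    show "inj_on p (metric_radical T)"
      by (rule inj_onI) (auto simp: mem_radical intro: model_eqI)
    show "p ` metric_radical T = carrier R"
    proof (intro equalityI subsetI)
      fix r assume "r \<in> carrier R"
      then obtain x where "x \<in> carrier T" "\<pi> x = \<zero>\<^bsub>T0\<^esub>" "p x = r"
        using model_lift[of "\<zero>\<^bsub>T0\<^esub>" r] by auto
      then show "r \<in> p ` metric_radical T" by (auto simp: mem_radical)
    qed (auto simp: mem_radical p_simps)
  qed
  ultimately show ?thesis by (simp add: linear_isos_def)
qed

lemma lift_zero:
  assumes "a \<in> carrier T0"
  obtains x where "x \<in> carrier T" "\<pi> x = a" "p x = \<zero>\<^bsub>R\<^esub>"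
  using model_lift[OF assms base.R_zero_closed] by blast

text \<open>
  In \<open>T0\<close> the space \<open>g_+ + g_-^-\<close> is orthogonal to its complement \<open>g_-^+\<close>, so a vector of it that is
  orthogonal to the whole of it is orthogonal to everything.
\<close>
lemma model_weakly_nondegenerate:
  "nondegenerate_on T (submodule_sum (lower_plus T) (lower_minus T \<inter> upper_minus T))"
  unfolding nondegenerate_on_def
proof (intro ballI impI)
  let ?W = "submodule_sum (lower_plus T) (lower_minus T \<inter> upper_minus T)"
  fix x assume x: "x \<in> ?W" and orth: "\<forall>y\<in>?W. form T x y = 0"
  have z1: "\<zero> \<in> lower_plus T"
    unfolding mem_lower_plus by (simp add: \<pi>_simps p_simps lower_plus_def base.theta_simps(4))
  have minus_zero: "\<ominus>\<^bsub>T0\<^esub> \<zero>\<^bsub>T0\<^esub> = \<zero>\<^bsub>T0\<^esub>"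
    by (rule base.vector_eqI) (simp_all add: base.functional_simps)
  have z2: "\<zero> \<in> lower_minus T \<inter> upper_minus T"
    unfolding Int_iff mem_lower_minus mem_upper_minus
    by (simp add: \<pi>_simps p_simps lower_minus_def upper_minus_def base.theta_simps(4) base.dmap_simps(4) minus_zero)
  have W: "a \<oplus> b \<in> ?W" if "a \<in> lower_plus T" "b \<in> lower_minus T \<inter> upper_minus T" for a b
    using that unfolding submodule_sum_def by force
  have W1: "y \<in> ?W" if "y \<in> lower_plus T" for y
    using W[OF that z2] that by (simp add: mem_lower_plus)
  have W2: "y \<in> ?W" if "y \<in> lower_minus T \<inter> upper_minus T" for y
    using W[OF z1 that] that by (simp add: mem_lower_minus)
  obtain a b where ab: "a \<in> lower_plus T" "b \<in> lower_minus T \<inter> upper_minus T" "x = a \<oplus> b"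
    using x unfolding submodule_sum_def by (auto simp del: Int_iff)
  have abT: "a \<in> carrier T" "b \<in> carrier T" "p a = \<zero>\<^bsub>R\<^esub>" "p b = \<zero>\<^bsub>R\<^esub>"
    and \<pi>a: "theta T0 (\<pi> a) = \<pi> a"
    and \<pi>b: "dmap T0 (dmap T0 (\<pi> b)) = \<ominus>\<^bsub>T0\<^esub> \<pi> b"
    using ab(1,2) unfolding Int_iff mem_lower_plus mem_lower_minus mem_upper_minus
    by (simp_all add: lower_plus_def upper_minus_def)
  have xT: "x \<in> carrier T" using ab abT by simp
  have px: "p x = \<zero>\<^bsub>R\<^esub>"
    using ab(3) abT by (intro base.coeff_eqI) (simp_all add: p_simps base.scalar_simps)
  have orth_plus: "form T0 (\<pi> x) z = 0" if "z \<in> lower_plus T0" for z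
  proof -
    have "z \<in> carrier T0" using that by (simp add: lower_plus_def)
    then obtain y where y: "y \<in> carrier T" "\<pi> y = z" "p y = \<zero>\<^bsub>R\<^esub>" by (rule lift_zero)
    then have "y \<in> ?W" using that by (intro W1) (simp add: mem_lower_plus)
    then show ?thesis using orth y xT by (auto simp: model_form)
  qed
  have orth_minus: "form T0 (\<pi> x) z = 0" if "z \<in> lower_minus T0 \<inter> upper_minus T0" for z
  proof -
    have "z \<in> carrier T0" using that by (simp add: lower_minus_def)
    then obtain y where y: "y \<in> carrier T" "\<pi> y = z" "p y = \<zero>\<^bsub>R\<^esub>" by (rule lift_zero)
    then have "y \<in> ?W" using that by (intro W2) (simp add: mem_lower_minus mem_upper_minus)
    then show ?thesis using orth y xT by (auto simp: model_form)
  qed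
  have \<pi>c: "\<pi> a \<in> carrier T0" "\<pi> b \<in> carrier T0" "\<pi> x \<in> carrier T0" using abT xT by (simp_all add: \<pi>_simps)
  have "form T0 (\<pi> x) z = 0" if z: "z \<in> carrier T0" for z
  proof -
    \<comment> \<open>Twice \<open>z\<close> is the sum of \<open>z + \<theta>z\<close>, which lies in \<open>g_+\<close>, of \<open>-D\<^sup>2 zm\<close>, which lies in
        \<open>g_-^-\<close>, and of \<open>u\<close>, which lies in \<open>g_-^+\<close>.\<close>
    define zm where "zm = z \<oplus>\<^bsub>T0\<^esub> \<ominus>\<^bsub>T0\<^esub> theta T0 z"
    define u where "u = zm \<oplus>\<^bsub>T0\<^esub> dmap T0 (dmap T0 zm)"
    have c: "zm \<in> carrier T0" "u \<in> carrier T0" using z by (simp_all add: zm_def u_def)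
    have tzm: "theta T0 zm = \<ominus>\<^bsub>T0\<^esub> zm"
      by (rule base.vector_eqI)
        (use z c in \<open>simp_all add: zm_def base.theta_simps base.theta_involutive base.functional_simps\<close>)
    have tu: "theta T0 u = \<ominus>\<^bsub>T0\<^esub> u"
      by (rule base.vector_eqI)
        (use z c in \<open>simp_all add: u_def tzm base.theta_simps base.theta_dmap base.dmap_simps base.functional_simps\<close>)
    have du: "dmap T0 u = \<zero>\<^bsub>T0\<^esub>"
      by (rule base.vector_eqI)
        (use z c in \<open>simp_all add: u_def base.dmap_simps base.dmap_cubed base.functional_simps\<close>)
    have "z \<oplus>\<^bsub>T0\<^esub> theta T0 z \<in> lower_plus T0"
      using z by (simp add: lower_plus_def base.theta_simps base.theta_involutive base.a_comm)
    from orth_plus[OF this]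
    have 1: "form T0 (\<pi> x) z + form T0 (\<pi> x) (theta T0 z) = 0"
      using z \<pi>c by (simp add: base.form_right_simps)
    have "dmap T0 (dmap T0 zm) \<in> lower_minus T0 \<inter> upper_minus T0"
      using c by (simp add: lower_minus_def upper_minus_def base.theta_dmap base.dmap_simps tzm base.dmap_cubed)
    from orth_minus[OF this]
    have 2: "form T0 (\<pi> x) (dmap T0 (dmap T0 zm)) = 0" .
    have "form T0 (\<pi> a) u = form T0 (theta T0 (\<pi> a)) (theta T0 u)"
      using \<pi>c c by (simp add: base.theta_form)
    then have a0: "form T0 (\<pi> a) u = 0" using \<pi>c c by (simp add: \<pi>a tu base.form_right_simps)
    have "form T0 (dmap T0 (dmap T0 (\<pi> b))) u = - form T0 (dmap T0 (\<pi> b)) (dmap T0 u)"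
      using \<pi>c c by (intro base.dmap_antisymmetric) auto
    then have b0: "form T0 (\<pi> b) u = 0"
      using \<pi>c c by (simp add: \<pi>b du base.form_right_simps base.form_left_simps)
    have "form T0 (\<pi> x) u = 0"
      using ab(3) abT \<pi>c c a0 b0 by (simp add: \<pi>_simps base.form_left_simps)
    then have "form T0 (\<pi> x) z - form T0 (\<pi> x) (theta T0 z) = 0"
      using 2 z c \<pi>c by (simp add: u_def base.form_right_simps) (simp add: zm_def base.form_right_simps)
    with 1 show ?thesis by simp
  qed
  then have "\<pi> x = \<zero>\<^bsub>T0\<^esub>" using nondegenerate_base \<pi>c(3) by (auto simp: nondegenerate_on_def)
  then show "x = \<zero>" using xT px by (intro model_eqI) (simp_all add: \<pi>_simps p_simps)
qed

lemma model_weak_triple: "weak_extrinsic_symmetric_triple T"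
  by (rule weak_extrinsic_symmetric_triple.intro[OF model_pre_triple])
    (rule weak_extrinsic_symmetric_triple_axioms.intro[OF model_weakly_nondegenerate])

lemma model_radical_quotient: "radical_quotient T \<cong>\<^sub>t T0"
  using pre_triple.radical_quotient_isomorphic_iff[OF model_pre_triple base_extrinsic] \<pi>_projection by blast

end

lemma extension_simps:
  "carrier (extension T0 R \<omega>) = carrier T0 \<times> carrier R"
  "u \<oplus>\<^bsub>extension T0 R \<omega>\<^esub> v = (fst u \<oplus>\<^bsub>T0\<^esub> fst v, snd u \<oplus>\<^bsub>R\<^esub> snd v)"
  "c \<odot>\<^bsub>extension T0 R \<omega>\<^esub> u = (c \<odot>\<^bsub>T0\<^esub> fst u, c \<odot>\<^bsub>R\<^esub> snd u)"
  "\<zero>\<^bsub>extension T0 R \<omega>\<^esub> = (\<zero>\<^bsub>T0\<^esub>, \<zero>\<^bsub>R\<^esub>)"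
  "lie_bracket (extension T0 R \<omega>) u v = (lie_bracket T0 (fst u) (fst v), \<omega> (fst u, fst v))"
  "form (extension T0 R \<omega>) u v = form T0 (fst u) (fst v)"
  "dmap (extension T0 R \<omega>) u = (dmap T0 (fst u), \<zero>\<^bsub>R\<^esub>)"
  "theta (extension T0 R \<omega>) u = (theta T0 (fst u), \<ominus>\<^bsub>R\<^esub> snd u)"
  by (simp_all add: extension_def direct_sum_def lie.defs module.defs lie_triple.defs split_beta)

locale extension_setting = triple_with_coefficients T R
  for T :: "('a, 'm) lie_triple_scheme" (structure) and R :: "(real, 'r) module" +
  assumes nondegenerate: "nondegenerate_on T (carrier T)"
begin

lemma modelI:
  fixes S :: "('u, 'n) lie_triple_scheme"
  assumes "\<omega> \<in> invariant_cocycles T R" "vectorspace \<R> S"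
    and "\<And>x y. x \<in> carrier S \<Longrightarrow> y \<in> carrier S \<Longrightarrow> lie_bracket S x y \<in> carrier S"
      "\<And>x. x \<in> carrier S \<Longrightarrow> dmap S x \<in> carrier S"
      "\<And>x. x \<in> carrier S \<Longrightarrow> theta S x \<in> carrier S"
    and h: "h \<in> triple_isos S (extension T R \<omega>)"
  shows "extension_model T R \<omega> S (\<lambda>x. fst (h x)) (\<lambda>x. snd (h x))"
proof (rule extension_model.intro[OF triple_with_coefficients_axioms],
    rule extension_model_axioms.intro[OF nondegenerate assms(1-5)])
  note hD = triple_isosD[OF h]
  have hc: "fst (h x) \<in> carrier T" "snd (h x) \<in> carrier R" if "x \<in> carrier S" for x
    using linear_map_closed[OF hD(1) that] by (auto simp: extension_simps)
  show "(\<lambda>x. fst (h x)) \<in> linear_maps S T" "(\<lambda>x. snd (h x)) \<in> linear_maps S R"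
    by (rule linear_mapsI; simp add: hc linear_map_add[OF hD(1)] linear_map_smult[OF hD(1)] extension_simps)+
  show "bij_betw (\<lambda>x. (fst (h x), snd (h x))) (carrier S) (carrier T \<times> carrier R)"
    using hD(2) by (simp add: extension_simps)
  fix x assume x: "x \<in> carrier S"
  show "fst (h (dmap S x)) = dmap T (fst (h x))" "snd (h (dmap S x)) = \<zero>\<^bsub>R\<^esub>"
    using hD(5)[OF x, symmetric] by (simp_all add: extension_simps)
  show "fst (h (theta S x)) = theta T (fst (h x))" "snd (h (theta S x)) = \<ominus>\<^bsub>R\<^esub> snd (h x)"
    using hD(6)[OF x, symmetric] by (simp_all add: extension_simps)
  fix y assume y: "y \<in> carrier S"
  show "fst (h (lie_bracket S x y)) = lie_bracket T (fst (h x)) (fst (h y))"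
    "snd (h (lie_bracket S x y)) = \<omega> (fst (h x), fst (h y))"
    using hD(3)[OF x y] by (simp_all add: extension_simps)
  show "form S x y = form T (fst (h x)) (fst (h y))"
    using hD(4)[OF x y] by (simp add: extension_simps)
qed

lemma model_isomorphic_extension:
  fixes S :: "('u, 'n) lie_triple_scheme"
  assumes "extension_model T R \<omega> S \<pi> p"
  shows "S \<cong>\<^sub>t extension T R \<omega>"
proof -
  interpret M: extension_model T R \<omega> S \<pi> p by fact
  have "(\<lambda>x. (\<pi> x, p x)) \<in> triple_isos S (extension T R \<omega>)"
  proof (rule triple_isosI)
    show "(\<lambda>x. (\<pi> x, p x)) \<in> linear_maps S (extension T R \<omega>)"
      by (rule linear_mapsI) (simp_all add: extension_simps M.\<pi>_simps M.p_simps)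
    show "bij_betw (\<lambda>x. (\<pi> x, p x)) (carrier S) (carrier (extension T R \<omega>))"
      using M.components_bij by (simp add: extension_simps)
  qed (simp_all add: extension_simps M.structure_simps M.model_form)
  then show ?thesis by (auto simp: isomorphic_triples_def)
qed

lemma extension_vectorspace: "vectorspace \<R> (extension T R \<omega>)"
proof (rule vectorspace_transport[of "direct_sum T R" id])
  show "vectorspace \<R> (direct_sum T R)" by (rule direct_sum_is_vs[OF vectorspace_axioms R_vectorspace])
qed (auto simp: extension_simps direct_sum_def)

lemma extension_is_model:
  assumes "\<omega> \<in> invariant_cocycles T R"
  shows "extension_model T R \<omega> (extension T R \<omega>) fst snd"
proof -
  have "\<omega> \<in> cocycles T R" using assms by (simp add: mem_invariant_cocycles_iff)
  note c = cocycle_simps(1)[OF this]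
  have "id \<in> triple_isos (extension T R \<omega>) (extension T R \<omega>)"
    by (auto intro!: triple_isosI linear_mapsI)
  from modelI[OF assms extension_vectorspace _ _ _ this] show ?thesis
    by (auto simp: extension_simps c)
qed

text \<open>
  The structure of the extension is moved along \<open>e\<close>, with \<open>h\<close> as the inverse of \<open>e\<close>.
\<close>
lemma copy_is_model:
  fixes e :: "'a \<times> 'r \<Rightarrow> 'u"
  assumes \<omega>: "\<omega> \<in> invariant_cocycles T R" and e: "inj_on e (carrier T \<times> carrier R)"
  obtains S :: "'u lie_triple" and \<pi> p where "extension_model T R \<omega> S \<pi> p"
proof -
  let ?E = "extension T R \<omega>"
  interpret E: extension_model T R \<omega> ?E fst snd by (rule extension_is_model[OF \<omega>])
  interpret E: pre_triple ?E by (rule E.model_pre_triple)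
  define h where "h = inv_into (carrier ?E) e"
  have he [simp]: "h (e v) = v" if "v \<in> carrier ?E" for v
    using e that by (simp add: h_def extension_simps)
  define S :: "'u lie_triple" where "S =
    \<lparr>carrier = e ` carrier ?E, mult = undefined, one = undefined, zero = e \<zero>\<^bsub>?E\<^esub>,
     add = (\<lambda>x y. e (h x \<oplus>\<^bsub>?E\<^esub> h y)), smult = (\<lambda>c x. e (c \<odot>\<^bsub>?E\<^esub> h x)),
     lie_bracket = (\<lambda>x y. e (lie_bracket ?E (h x) (h y))), form = (\<lambda>x y. form ?E (h x) (h y)),
     dmap = (\<lambda>x. e (dmap ?E (h x))), theta = (\<lambda>x. e (theta ?E (h x)))\<rparr>"
  have hc [simp]: "h x \<in> carrier ?E" if "x \<in> carrier S" for x using that by (auto simp: S_def)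
  have bij: "bij_betw h (carrier S) (carrier ?E)"
    by (rule bij_betw_byWitness[where f' = e]) (auto simp: S_def)
  have S: "vectorspace \<R> S"
    by (rule vectorspace_transport[OF extension_vectorspace bij]) (auto simp: S_def)
  have "h \<in> triple_isos S ?E"
    by (rule triple_isosI[OF linear_mapsI bij]) (auto simp: S_def)
  from modelI[OF \<omega> S _ _ _ this] have "extension_model T R \<omega> S (\<lambda>x. fst (h x)) (\<lambda>x. snd (h x))"
    by (auto simp: S_def)
  then show ?thesis by (rule that)
qed


section \<open>Weak triples are extensions\<close>

lemma extrinsic: "extrinsic_symmetric_triple T"
  by (rule extrinsic_symmetric_triple.intro[OF pre_triple_axioms])
    (rule extrinsic_symmetric_triple_axioms.intro[OF nondegenerate])

text \<open>
  The metric radical \<open>N\<close> meets \<open>g_+ + g_-^-\<close> only in \<open>0\<close>, since the form is non-degenerate there.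
  As \<open>N\<close> is stable under \<open>\<theta>\<close> and \<open>D\<close>, it follows that \<open>\<theta>\<close> is \<open>-1\<close> and \<open>D\<close> is \<open>0\<close> on \<open>N\<close>, and
  then that \<open>N\<close> is central. The coordinate \<open>p\<close> is an extension of \<open>\<rho>\<close> from \<open>N\<close> to \<open>S\<close>, made
  compatible with \<open>\<theta>\<close> and \<open>D\<close> by \<open>skew_part\<close>; this does not change it on \<open>N\<close>. The cocycle is
  \<open>\<omega> (\<pi> x, \<pi> y) = p [x, y]\<close>.
\<close>
lemma weak_triple_is_model:
  fixes S :: "('u, 'n) lie_triple_scheme"
  assumes weak: "weak_extrinsic_symmetric_triple S"
    and \<rho>: "\<rho> \<in> linear_isos (S\<lparr>carrier := metric_radical S\<rparr>) R"
    and quotient: "radical_quotient S \<cong>\<^sub>t T"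
  obtains \<omega> \<pi> p where "extension_model T R \<omega> S \<pi> p"
proof -
  interpret S: weak_extrinsic_symmetric_triple S by (rule weak)
  interpret S: triple_with_coefficients S R
    by (rule triple_with_coefficients.intro[OF S.pre_triple_axioms])
      (rule triple_with_coefficients_axioms.intro[OF R_vectorspace R_fin_dim])
  let ?N = "metric_radical S"
  obtain \<pi> where pr: "\<pi> \<in> triple_projections S T"
    using S.radical_quotient_isomorphic_iff[OF extrinsic] quotient by blast
  note \<pi> = triple_projectionsD[OF pr]
  note [simp] = linear_map_closed[OF \<pi>(1)]
  have N_iff: "x \<in> ?N \<longleftrightarrow> x \<in> carrier S \<and> \<pi> x = \<zero>" for x
    by (simp add: radical_eq_kernel[OF extrinsic pr])
  have S_zero: "\<ominus>\<^bsub>S\<^esub> \<zero>\<^bsub>S\<^esub> = \<zero>\<^bsub>S\<^esub>"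
    by (rule S.vector_eqI) (simp_all add: S.functional_simps)
  have fixed_zero: "x = \<zero>\<^bsub>S\<^esub>" if x: "x \<in> ?N" "theta S x = x" for x
  proof -
    let ?W = "S.submodule_sum (lower_plus S) (lower_minus S \<inter> upper_minus S)"
    have xS: "x \<in> carrier S" using x by (simp add: N_iff)
    have "\<zero>\<^bsub>S\<^esub> \<in> lower_minus S \<inter> upper_minus S"
      by (simp add: lower_minus_def upper_minus_def S_zero S.theta_simps S.dmap_simps)
    moreover have "x \<in> lower_plus S" using x xS by (simp add: lower_plus_def)
    ultimately have "x \<oplus>\<^bsub>S\<^esub> \<zero>\<^bsub>S\<^esub> \<in> ?W" unfolding S.submodule_sum_def by force
    then have xW: "x \<in> ?W" using xS by simp
    have "y \<in> carrier S" if "y \<in> ?W" for y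
      using that unfolding S.submodule_sum_def by (auto simp: lower_plus_def lower_minus_def)
    then have "\<forall>y\<in>?W. form S x y = 0" using x by (auto simp: metric_radical_def)
    then show ?thesis using S.weakly_nondegenerate xW by (auto simp: nondegenerate_on_def)
  qed
  \<comment> \<open>\<open>x + \<theta>x\<close> is a fixed point of \<open>\<theta>\<close> in the radical.\<close>
  have N_theta: "theta S x = \<ominus>\<^bsub>S\<^esub> x" if x: "x \<in> ?N" for x
  proof -
    have xS: "x \<in> carrier S" using x by (simp add: N_iff)
    have "x \<oplus>\<^bsub>S\<^esub> theta S x \<in> ?N"
      using submodule.m_closed[OF S.radical_submodule x S.radical_theta[OF x]] .
    moreover have "theta S (x \<oplus>\<^bsub>S\<^esub> theta S x) = x \<oplus>\<^bsub>S\<^esub> theta S x"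
      using xS by (simp add: S.theta_simps S.theta_involutive S.a_comm)
    ultimately have 0: "x \<oplus>\<^bsub>S\<^esub> theta S x = \<zero>\<^bsub>S\<^esub>" by (rule fixed_zero)
    show ?thesis
    proof (rule S.vector_eqI)
      fix f assume f: "f \<in> dual S"
      show "f (theta S x) = f (\<ominus>\<^bsub>S\<^esub> x)"
        using arg_cong[OF 0, of f] f xS by (simp add: S.functional_simps)
    qed (use xS in auto)
  qed
  \<comment> \<open>\<open>D\<close> anticommutes with \<open>\<theta>\<close>, so \<open>Dx\<close> is a fixed point of \<open>\<theta>\<close> in the radical.\<close>
  have N_dmap: "dmap S x = \<zero>\<^bsub>S\<^esub>" if x: "x \<in> ?N" for x
  proof (rule fixed_zero[OF S.radical_dmap[OF x]])
    have xS: "x \<in> carrier S" using x by (simp add: N_iff)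
    show "theta S (dmap S x) = dmap S x"
      using xS N_theta[OF x] by (simp add: S.theta_dmap S.dmap_simps)
  qed
  \<comment> \<open>Comparing both sides of \<open>\<theta>[x, y] = [\<theta>x, \<theta>y]\<close> and of the Leibniz rule shows that \<open>ad x\<close> does not
      distinguish \<open>y\<close> from \<open>\<theta>y\<close> and kills the image of \<open>D\<close>, hence \<open>g^-\<close>. By the Jacobi identity it
      kills \<open>g_+^+ = [g_+^-, g_+^-]\<close>, and so \<open>g_+\<close>, which contains \<open>y + \<theta>y\<close>.\<close>
  have central: "lie_bracket S x y = \<zero>\<^bsub>S\<^esub>" if x: "x \<in> ?N" and y: "y \<in> carrier S" for x y
  proof -
    have xS: "x \<in> carrier S" using x by (simp add: N_iff)
    have zero_left: "lie_bracket S \<zero>\<^bsub>S\<^esub> z = \<zero>\<^bsub>S\<^esub>" if "z \<in> carrier S" for z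
      using linear_map_zero[OF S.bracket_left[OF that] S.vectorspace_axioms S.vectorspace_axioms] .
    have theta_y: "lie_bracket S x (theta S z) = lie_bracket S x z" if z: "z \<in> carrier S" for z
    proof -
      have "\<ominus>\<^bsub>S\<^esub> lie_bracket S x z = theta S (lie_bracket S x z)"
        by (rule N_theta[OF S.radical_bracket_left[OF x z], symmetric])
      also have "\<dots> = \<ominus>\<^bsub>S\<^esub> lie_bracket S x (theta S z)"
        using z xS N_theta[OF x] by (simp add: S.theta_bracket S.bracket_simps)
      finally have "\<ominus>\<^bsub>S\<^esub> lie_bracket S x z = \<ominus>\<^bsub>S\<^esub> lie_bracket S x (theta S z)" .
      then show ?thesis
        using S.minus_minus[OF S.bracket_closed[OF xS z]]
          S.minus_minus[OF S.bracket_closed[OF xS S.theta_closed[OF z]]] by metis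
    qed
    have dmap_y: "lie_bracket S x (dmap S z) = \<zero>\<^bsub>S\<^esub>" if z: "z \<in> carrier S" for z
      using N_dmap[OF S.radical_bracket_left[OF x z]] N_dmap[OF x] z xS zero_left[OF z]
      by (simp add: S.dmap_derivation)
    have upper_minus_y: "lie_bracket S x z = \<zero>\<^bsub>S\<^esub>" if z: "z \<in> upper_minus S" for z
    proof -
      have zS: "z \<in> carrier S" and "dmap S (dmap S z) = \<ominus>\<^bsub>S\<^esub> z" using z by (auto simp: upper_minus_def)
      then have "z = \<ominus>\<^bsub>S\<^esub> dmap S (dmap S z)" by simp
      then have "lie_bracket S x z = \<ominus>\<^bsub>S\<^esub> lie_bracket S x (dmap S (dmap S z))"
        using xS zS S.bracket_simps(6)[OF xS, of "dmap S (dmap S z)"] by simp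
      then show ?thesis using dmap_y[of "dmap S z"] zS S_zero by simp
    qed
    let ?B = "{lie_bracket S a b | a b. a \<in> lower_plus S \<inter> upper_minus S \<and> b \<in> lower_plus S \<inter> upper_minus S}"
    let ?C = "{z \<in> carrier S. lie_bracket S x z \<in> {\<zero>\<^bsub>S\<^esub>}}"
    have "?B \<subseteq> ?C"
    proof
      fix z assume "z \<in> ?B"
      then obtain a b where ab: "a \<in> upper_minus S" "b \<in> upper_minus S" "z = lie_bracket S a b" by blast
      then have abS: "a \<in> carrier S" "b \<in> carrier S" by (auto simp: upper_minus_def)
      have xa: "lie_bracket S x a = \<zero>\<^bsub>S\<^esub>" and xb: "lie_bracket S x b = \<zero>\<^bsub>S\<^esub>"
        using ab upper_minus_y by auto
      have bx: "lie_bracket S b x = \<zero>\<^bsub>S\<^esub>"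
        using S.bracket_anticommute[OF abS(2) xS] xb S_zero by simp
      have "lie_bracket S (lie_bracket S a b) x = \<zero>\<^bsub>S\<^esub>"
        using S.jacobi[OF xS abS] xS abS by (simp add: xa bx zero_left)
      then have "lie_bracket S x (lie_bracket S a b) = \<zero>\<^bsub>S\<^esub>"
        using S.bracket_anticommute[OF xS S.bracket_closed[OF abS]] S_zero by simp
      then show "z \<in> ?C" using ab abS by simp
    qed
    moreover have "submodule \<R> {\<zero>\<^bsub>S\<^esub>} S"
      by (rule S.submoduleI) (auto simp: S.smult_r_null)
    note C = S.submodule_vimage[OF S.bracket_right[OF xS] S.vectorspace_axioms this]
    ultimately have "S.span ?B \<subseteq> ?C" by (intro S.span_is_subset[OF _ C])
    then have pp: "lie_bracket S x z = \<zero>\<^bsub>S\<^esub>" if "z \<in> lower_plus S \<inter> upper_plus S" for z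
      using that S.bracket_generates by auto
    define v where "v = y \<oplus>\<^bsub>S\<^esub> theta S y"
    have v: "v \<in> carrier S" "theta S v = v"
      using y by (simp_all add: v_def S.theta_simps S.theta_involutive S.a_comm)
    have "dmap S (v \<oplus>\<^bsub>S\<^esub> dmap S (dmap S v)) = \<zero>\<^bsub>S\<^esub>"
      by (rule S.vector_eqI) (use v in \<open>simp_all add: S.dmap_simps S.dmap_cubed S.functional_simps\<close>)
    moreover have "theta S (dmap S (dmap S v)) = dmap S (dmap S v)"
      using v by (simp add: S.theta_dmap S.dmap_simps)
    ultimately have "v \<oplus>\<^bsub>S\<^esub> dmap S (dmap S v) \<in> lower_plus S \<inter> upper_plus S"
      using v by (simp add: lower_plus_def upper_plus_def S.theta_simps)
    from pp[OF this] have v0: "lie_bracket S x v = \<zero>\<^bsub>S\<^esub>"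
      using v xS dmap_y[of "dmap S v"] by (simp add: S.bracket_simps)
    show ?thesis
    proof (rule S.vector_eqI)
      fix f assume f: "f \<in> dual S"
      show "f (lie_bracket S x y) = f \<zero>\<^bsub>S\<^esub>"
        using arg_cong[OF v0, of f] f xS y by (simp add: v_def S.bracket_simps theta_y S.functional_simps)
    qed (use xS y in auto)
  qed
  have \<rho>lin: "\<rho> \<in> linear_maps (S\<lparr>carrier := ?N\<rparr>) R" and \<rho>bij: "bij_betw \<rho> ?N (carrier R)"
    using \<rho> by (auto simp: linear_isos_def)
  obtain q where q: "q \<in> linear_maps S R" "\<And>x. x \<in> ?N \<Longrightarrow> q x = \<rho> x"
    using extend_linear_map[OF S.vectorspace_axioms S.finite_dimensional R_vectorspace S.radical_submodule \<rho>lin]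
    by blast
  obtain p where p: "p \<in> linear_maps S R"
    "\<And>x. x \<in> carrier S \<Longrightarrow> p (dmap S x) = \<zero>\<^bsub>R\<^esub>"
    "\<And>x. x \<in> carrier S \<Longrightarrow> p (theta S x) = \<ominus>\<^bsub>R\<^esub> p x"
    "\<And>x. x \<in> carrier S \<Longrightarrow> q (dmap S (dmap S x)) = \<zero>\<^bsub>R\<^esub> \<Longrightarrow>
      q (theta S (dmap S (dmap S x))) = \<zero>\<^bsub>R\<^esub> \<Longrightarrow> q (theta S x) = \<ominus>\<^bsub>R\<^esub> q x \<Longrightarrow> p x = q x"
    using S.skew_part[OF q(1)] by blast
  have p\<rho>: "p x = \<rho> x" if x: "x \<in> ?N" for x
  proof -
    have xS: "x \<in> carrier S" using x by (simp add: N_iff)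
    have "p x = q x"
      using xS by (intro p(4)) (simp_all add: N_dmap[OF x] N_theta[OF x] S.dmap_simps S.theta_simps
        S.linear_map_simps[OF q(1)])
    then show ?thesis using q(2)[OF x] by simp
  qed
  have \<pi>_minus: "\<pi> (x \<ominus>\<^bsub>S\<^esub> y) = \<pi> x \<ominus> \<pi> y" if "x \<in> carrier S" "y \<in> carrier S" for x y
    using that by (simp add: a_minus_def linear_map_add[OF \<pi>(1)]
        linear_map_uminus[OF \<pi>(1) S.vectorspace_axioms vectorspace_axioms])
  have diff: "x \<ominus>\<^bsub>S\<^esub> y \<in> ?N" if "x \<in> carrier S" "y \<in> carrier S" "\<pi> x = \<pi> y" for x y
    using that by (simp add: N_iff \<pi>_minus)
  have bracket_left_cong: "lie_bracket S x z = lie_bracket S y z"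
    if "x \<in> carrier S" "y \<in> carrier S" "z \<in> carrier S" "\<pi> x = \<pi> y" for x y z
  proof (rule S.vector_eqI)
    fix f assume f: "f \<in> dual S"
    show "f (lie_bracket S x z) = f (lie_bracket S y z)"
      using arg_cong[OF central[OF diff[OF that(1,2,4)] that(3)], of f] f that
      by (simp add: a_minus_def S.bracket_simps S.functional_simps)
  qed (use that in auto)
  have bracket_cong: "lie_bracket S x z = lie_bracket S y w"
    if "x \<in> carrier S" "y \<in> carrier S" "z \<in> carrier S" "w \<in> carrier S" "\<pi> x = \<pi> y" "\<pi> z = \<pi> w" for x y z w
  proof -
    have "lie_bracket S x z = lie_bracket S y z" using that by (intro bracket_left_cong)
    also have "\<dots> = \<ominus>\<^bsub>S\<^esub> lie_bracket S z y" using that by (intro S.bracket_anticommute)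
    also have "\<dots> = \<ominus>\<^bsub>S\<^esub> lie_bracket S w y" using that bracket_left_cong[of z w y] by simp
    also have "\<dots> = lie_bracket S y w" using that S.bracket_anticommute[of y w] by simp
    finally show ?thesis .
  qed
  \<comment> \<open>Any choice of preimages defines the same cocycle, because the kernel of \<open>\<pi>\<close> is central.\<close>
  define s where "s = inv_into (carrier S) \<pi>"
  have s: "s a \<in> carrier S" "\<pi> (s a) = a" if "a \<in> carrier T" for a
    using that \<pi>(2) unfolding s_def by (auto intro: inv_into_into f_inv_into_f)
  define \<omega> where "\<omega> = (\<lambda>(a, b)\<in>carrier T \<times> carrier T. p (lie_bracket S (s a) (s b)))"
  have \<omega>: "\<omega> (\<pi> x, \<pi> y) = p (lie_bracket S x y)" if "x \<in> carrier S" "y \<in> carrier S" for x y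
    using that s bracket_cong[of "s (\<pi> x)" x "s (\<pi> y)" y] by (simp add: \<omega>_def)
  have surj: "\<exists>x. x \<in> carrier S \<and> a = \<pi> x" if "a \<in> carrier T" for a
    using that s by metis
  note [simp] = S.linear_map_simps(1)[OF p(1)]
  have "\<omega> \<in> cocycles T R"
  proof (rule cocyclesI)
    show "\<omega> \<in> extensional (carrier T \<times> carrier T)" by (simp add: \<omega>_def)
    fix a b assume a: "a \<in> carrier T" and b: "b \<in> carrier T"
    obtain x y where xy: "x \<in> carrier S" "a = \<pi> x" "y \<in> carrier S" "b = \<pi> y"
      using surj[OF a] surj[OF b] by auto
    show "\<omega> (a, b) \<in> carrier R" using xy by (simp add: \<omega>)
    fix f assume f: "f \<in> dual R"
    have "\<omega> (\<pi> x, \<pi> x) = \<zero>\<^bsub>R\<^esub>"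
      using \<omega>[OF xy(1) xy(1)] S.linear_map_simps(4)[OF p(1)] S.bracket_alternating[OF xy(1)] by simp
    then show "f (\<omega> (a, a)) = 0" using xy f by (simp add: scalar_simps)
    show "f (\<omega> (a, c \<odot> b)) = c * f (\<omega> (a, b))" for c
      using xy f \<omega>[of x "c \<odot>\<^bsub>S\<^esub> y"] \<omega>[of x y]
      by (simp add: linear_map_smult[OF \<pi>(1)] S.bracket_simps S.linear_map_simps[OF p(1)] scalar_simps)
    show "f (\<omega> (c \<odot> a, b)) = c * f (\<omega> (a, b))" for c
      using xy f \<omega>[of "c \<odot>\<^bsub>S\<^esub> x" y] \<omega>[of x y]
      by (simp add: linear_map_smult[OF \<pi>(1)] S.bracket_simps S.linear_map_simps[OF p(1)] scalar_simps)
    fix c assume c: "c \<in> carrier T"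
    obtain z where z: "z \<in> carrier S" "c = \<pi> z" using surj[OF c] by auto
    show "f (\<omega> (a, b \<oplus> c)) = f (\<omega> (a, b)) + f (\<omega> (a, c))"
      using xy z f \<omega>[of x "y \<oplus>\<^bsub>S\<^esub> z"] \<omega>[of x y] \<omega>[of x z]
      by (simp add: linear_map_add[OF \<pi>(1)] S.bracket_simps S.linear_map_simps[OF p(1)] scalar_simps)
    show "f (\<omega> (a \<oplus> b, c)) = f (\<omega> (a, c)) + f (\<omega> (b, c))"
      using xy z f \<omega>[of "x \<oplus>\<^bsub>S\<^esub> y" z] \<omega>[of x z] \<omega>[of y z]
      by (simp add: linear_map_add[OF \<pi>(1)] S.bracket_simps S.linear_map_simps[OF p(1)] scalar_simps)
    show "f (\<omega> (lie_bracket T a b, c)) + f (\<omega> (lie_bracket T b c, a)) + f (\<omega> (lie_bracket T c a, b)) = 0"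
      using xy z S.jacobi_under_linear_map[OF p(1) f xy(1,3) z(1)]
        \<omega>[of "lie_bracket S x y" z] \<omega>[of "lie_bracket S y z" x] \<omega>[of "lie_bracket S z x" y]
      by (simp add: \<pi>(3))
  qed
  then have inv: "\<omega> \<in> invariant_cocycles T R"
    unfolding mem_invariant_cocycles_iff
  proof (intro conjI ballI)
    fix a b assume a: "a \<in> carrier T" and b: "b \<in> carrier T"
    obtain x y where xy: "x \<in> carrier S" "a = \<pi> x" "y \<in> carrier S" "b = \<pi> y"
      using surj[OF a] surj[OF b] by auto
    show "\<omega> (theta T a, theta T b) = \<ominus>\<^bsub>R\<^esub> \<omega> (a, b)"
      using xy \<omega>[of "theta S x" "theta S y"] \<omega>[of x y] p(3)[of "lie_bracket S x y"]
      by (simp add: \<pi>(6) S.theta_bracket)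
    show "\<omega> (dmap T a, b) \<oplus>\<^bsub>R\<^esub> \<omega> (a, dmap T b) = \<zero>\<^bsub>R\<^esub>"
      using xy \<omega>[of "dmap S x" y] \<omega>[of x "dmap S y"] p(2)[of "lie_bracket S x y"]
      by (simp add: \<pi>(5) S.dmap_derivation S.linear_map_simps[OF p(1)])
  qed
  have "bij_betw (\<lambda>x. (\<pi> x, p x)) (carrier S) (carrier T \<times> carrier R)"
    unfolding bij_betw_def
  proof
    show "inj_on (\<lambda>x. (\<pi> x, p x)) (carrier S)"
    proof (rule inj_onI)
      fix x y assume x: "x \<in> carrier S" and y: "y \<in> carrier S" and eq: "(\<pi> x, p x) = (\<pi> y, p y)"
      then have d: "x \<ominus>\<^bsub>S\<^esub> y \<in> ?N" using diff by simp
      have 0: "\<zero>\<^bsub>S\<^esub> \<in> ?N" using submodule.zero_closed[OF S.radical_submodule] .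
      have "p (x \<ominus>\<^bsub>S\<^esub> y) = \<zero>\<^bsub>R\<^esub>"
      proof (rule coeff_eqI)
        fix f assume "f \<in> dual R"
        then show "f (p (x \<ominus>\<^bsub>S\<^esub> y)) = f \<zero>\<^bsub>R\<^esub>"
          using x y eq by (simp add: a_minus_def S.linear_map_simps[OF p(1)] scalar_simps)
      qed (use x y in auto)
      moreover have "p \<zero>\<^bsub>S\<^esub> = \<zero>\<^bsub>R\<^esub>" by (rule S.linear_map_simps(4)[OF p(1)])
      ultimately have "\<rho> (x \<ominus>\<^bsub>S\<^esub> y) = \<rho> \<zero>\<^bsub>S\<^esub>" using p\<rho>[OF d] p\<rho>[OF 0] by simp
      then have "x \<ominus>\<^bsub>S\<^esub> y = \<zero>\<^bsub>S\<^esub>" using \<rho>bij d 0 by (auto simp: bij_betw_def inj_on_def)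
      then show "x = y" using x y by simp
    qed
    show "(\<lambda>x. (\<pi> x, p x)) ` carrier S = carrier T \<times> carrier R"
    proof (intro equalityI subsetI)
      fix v assume "v \<in> carrier T \<times> carrier R"
      then obtain a r where v: "v = (a, r)" "a \<in> carrier T" "r \<in> carrier R" by auto
      obtain x where x: "x \<in> carrier S" "a = \<pi> x" using surj[OF v(2)] by auto
      have "r \<oplus>\<^bsub>R\<^esub> \<ominus>\<^bsub>R\<^esub> p x \<in> \<rho> ` ?N" using \<rho>bij v x by (auto simp: bij_betw_def)
      then obtain n where n: "n \<in> ?N" "\<rho> n = r \<oplus>\<^bsub>R\<^esub> \<ominus>\<^bsub>R\<^esub> p x" by auto
      then have nS: "n \<in> carrier S" "\<pi> n = \<zero>" by (auto simp: N_iff)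
      have "p (x \<oplus>\<^bsub>S\<^esub> n) = r"
        by (rule coeff_eqI)
          (use x v nS p\<rho>[OF n(1)] n(2) in \<open>simp_all add: S.linear_map_simps[OF p(1)] scalar_simps\<close>)
      moreover have "\<pi> (x \<oplus>\<^bsub>S\<^esub> n) = a" using x nS by (simp add: linear_map_add[OF \<pi>(1)])
      ultimately show "v \<in> (\<lambda>x. (\<pi> x, p x)) ` carrier S"
        using x nS v(1) by (intro image_eqI[of _ _ "x \<oplus>\<^bsub>S\<^esub> n"]) auto
    qed auto
  qed
  then have "extension_model T R \<omega> S \<pi> p"
    using nondegenerate inv p(1-3) \<pi> \<omega>
    by (intro extension_model.intro[OF triple_with_coefficients_axioms] extension_model_axioms.intro)
      (simp_all add: S.vectorspace_axioms)
  then show ?thesis by (rule that)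
qed


section \<open>Isomorphisms between extensions\<close>

lemma mem_Aut:
  assumes "\<phi> \<in> carrier (Aut T)"
  shows "\<phi> \<in> triple_isos T T"
  using assms by (simp add: Aut_def)

lemma mem_GL:
  assumes "A \<in> carrier (GL R)"
  shows "A \<in> linear_maps R R" "bij_betw A (carrier R) (carrier R)"
  using assms by (auto simp: GL_def linear_isos_def)

lemma inverse_automorphism:
  assumes \<phi>: "\<phi> \<in> triple_isos T T"
  defines "\<psi> \<equiv> inv_into (carrier T) \<phi>"
  shows "\<psi> \<in> linear_maps T T"
    and "x \<in> carrier T \<Longrightarrow> \<psi> (\<phi> x) = x" and "x \<in> carrier T \<Longrightarrow> \<phi> (\<psi> x) = x"
    and "x \<in> carrier T \<Longrightarrow> y \<in> carrier T \<Longrightarrow> \<psi> (lie_bracket T x y) = lie_bracket T (\<psi> x) (\<psi> y)"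
    and "x \<in> carrier T \<Longrightarrow> \<psi> (dmap T x) = dmap T (\<psi> x)"
    and "x \<in> carrier T \<Longrightarrow> \<psi> (theta T x) = theta T (\<psi> x)"
proof -
  note \<phi>D = triple_isosD[OF \<phi>]
  show lin: "\<psi> \<in> linear_maps T T"
    unfolding \<psi>_def by (rule inv_into_linear[OF vectorspace_axioms \<phi>D(1,2)])
  note [simp] = linear_map_closed[OF lin]
  have left: "\<psi> (\<phi> x) = x" if "x \<in> carrier T" for x
    unfolding \<psi>_def using bij_betw_inv_into_left[OF \<phi>D(2) that] .
  have right [simp]: "\<phi> (\<psi> x) = x" if "x \<in> carrier T" for x
    unfolding \<psi>_def using bij_betw_inv_into_right[OF \<phi>D(2) that] .
  show "x \<in> carrier T \<Longrightarrow> \<psi> (\<phi> x) = x" "x \<in> carrier T \<Longrightarrow> \<phi> (\<psi> x) = x"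
    by (simp_all add: left)
  show "\<psi> (lie_bracket T x y) = lie_bracket T (\<psi> x) (\<psi> y)" if "x \<in> carrier T" "y \<in> carrier T"
    using left[of "lie_bracket T (\<psi> x) (\<psi> y)"] \<phi>D(3)[of "\<psi> x" "\<psi> y"] that by simp
  show "\<psi> (dmap T x) = dmap T (\<psi> x)" if "x \<in> carrier T"
    using left[of "dmap T (\<psi> x)"] \<phi>D(5)[of "\<psi> x"] that by simp
  show "\<psi> (theta T x) = theta T (\<psi> x)" if "x \<in> carrier T"
    using left[of "theta T (\<psi> x)"] \<phi>D(6)[of "\<psi> x"] that by simp
qed

text \<open>
  The action of \<open>(\<phi>, A)\<close> on representatives, \<open>A \<circ> (\<phi>\<^sup>-\<^sup>1)\<^sup>*\<omega>\<close>.
\<close>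
definition transform :: "('a \<Rightarrow> 'a) \<Rightarrow> ('r \<Rightarrow> 'r) \<Rightarrow> ('a \<times> 'a \<Rightarrow> 'r) \<Rightarrow> 'a \<times> 'a \<Rightarrow> 'r" where
  "transform \<phi> A \<omega> = (\<lambda>(x, y)\<in>carrier T \<times> carrier T.
    A (\<omega> (inv_into (carrier T) \<phi> x, inv_into (carrier T) \<phi> y)))"

lemma transform_cocycle:
  assumes "\<omega> \<in> cocycles T R" "\<phi> \<in> triple_isos T T" "A \<in> linear_maps R R"
  shows "transform \<phi> A \<omega> \<in> cocycles T R"
  unfolding transform_def
  using inverse_automorphism[OF assms(2)] by (intro transformed_cocycle[OF assms(1) _ assms(3)]) auto

lemma transform_invariant:
  assumes \<omega>: "\<omega> \<in> invariant_cocycles T R" and \<phi>: "\<phi> \<in> triple_isos T T" and A: "A \<in> linear_maps R R"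
  shows "transform \<phi> A \<omega> \<in> invariant_cocycles T R"
  unfolding mem_invariant_cocycles_iff
proof (intro conjI ballI)
  have c: "\<omega> \<in> cocycles T R" using \<omega> by (simp add: mem_invariant_cocycles_iff)
  then show "transform \<phi> A \<omega> \<in> cocycles T R" using \<phi> A by (rule transform_cocycle)
  note \<psi> = inverse_automorphism[OF \<phi>]
  note [simp] = linear_map_closed[OF \<psi>(1)] cocycle_simps(1)[OF c]
  fix x y assume xy: "x \<in> carrier T" "y \<in> carrier T"
  let ?x = "inv_into (carrier T) \<phi> x" and ?y = "inv_into (carrier T) \<phi> y"
  have 1: "\<omega> (theta T ?x, theta T ?y) = \<ominus>\<^bsub>R\<^esub> \<omega> (?x, ?y)"
    and 2: "\<omega> (dmap T ?x, ?y) \<oplus>\<^bsub>R\<^esub> \<omega> (?x, dmap T ?y) = \<zero>\<^bsub>R\<^esub>"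
    using \<omega> xy by (auto simp: mem_invariant_cocycles_iff)
  show "transform \<phi> A \<omega> (theta T x, theta T y) = \<ominus>\<^bsub>R\<^esub> transform \<phi> A \<omega> (x, y)"
    using xy 1 by (simp add: transform_def \<psi>(6) linear_map_uminus[OF A R_vectorspace R_vectorspace])
  have "A (\<omega> (dmap T ?x, ?y)) \<oplus>\<^bsub>R\<^esub> A (\<omega> (?x, dmap T ?y)) = A (\<omega> (dmap T ?x, ?y) \<oplus>\<^bsub>R\<^esub> \<omega> (?x, dmap T ?y))"
    using xy by (simp add: linear_map_add[OF A])
  also have "\<dots> = \<zero>\<^bsub>R\<^esub>" unfolding 2 by (rule linear_map_zero[OF A R_vectorspace R_vectorspace])
  finally show "transform \<phi> A \<omega> (dmap T x, y) \<oplus>\<^bsub>R\<^esub> transform \<phi> A \<omega> (x, dmap T y) = \<zero>\<^bsub>R\<^esub>"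
    using xy by (simp add: transform_def \<psi>(5))
qed

lemma cohomology_action_class:
  assumes \<omega>: "\<omega> \<in> cocycles T R" and \<phi>: "\<phi> \<in> triple_isos T T" and A: "A \<in> linear_maps R R"
  shows "cohomology_action T R (\<phi>, A) (cohomology_class T R \<omega>) = cohomology_class T R (transform \<phi> A \<omega>)"
proof -
  let ?\<psi> = "inv_into (carrier T) \<phi>"
  note \<psi> = inverse_automorphism[OF \<phi>]
  note [simp] = linear_map_closed[OF \<psi>(1)] linear_map_closed[OF A]
  have F: "(\<lambda>\<omega>. compose (carrier T \<times> carrier T) A (pullback T ?\<psi> \<omega>)) = transform \<phi> A"
    by (rule ext)+ (auto simp: compose_def pullback_def transform_def restrict_def)
  have "quot_map (Z2 T R) (B2 T R) (transform \<phi> A) (cohomology_class T R \<omega>) =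
      cohomology_class T R (transform \<phi> A \<omega>)"
  proof (rule quot_map_cohomology_class[OF \<omega>])
    show "transform \<phi> A \<in> cocycles T R \<rightarrow> cocycles T R" using transform_cocycle \<phi> A by blast
    fix \<omega>' assume \<omega>': "\<omega>' \<in> cocycles T R" and "cohomologous \<omega>' \<omega>"
    then obtain \<eta> where \<eta>: "\<eta> \<in> linear_maps T R"
      "\<forall>x\<in>carrier T. \<forall>y\<in>carrier T. \<omega> (x, y) = \<omega>' (x, y) \<oplus>\<^bsub>R\<^esub> \<eta> (lie_bracket T x y)"
      unfolding cohomologous_def by blast
    note [simp] = linear_map_closed[OF \<eta>(1)] cocycle_simps(1)[OF \<omega>']
    have "(\<lambda>x. A (\<eta> (?\<psi> x))) \<in> linear_maps T R"
      using linear_map_compose[OF linear_map_compose[OF \<psi>(1) \<eta>(1)] A] by (simp add: comp_def)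
    then show "cohomologous (transform \<phi> A \<omega>') (transform \<phi> A \<omega>)"
      unfolding cohomologous_def using \<eta>(2)
      by (intro bexI[of _ "\<lambda>x. A (\<eta> (?\<psi> x))"] ballI)
        (simp_all add: transform_def \<psi>(4) linear_map_add[OF A])
  qed
  then show ?thesis by (simp add: cohomology_action_def F)
qed

text \<open>
  If \<open>\<omega>' = A \<circ> (\<phi>\<^sup>-\<^sup>1)\<^sup>*\<omega> + \<eta> [\<cdot>, \<cdot>]\<close>, the isomorphism is \<open>(x, r) \<mapsto> (\<phi> x, A r + \<eta> (\<phi> x))\<close>. It
  commutes with \<open>D\<close> and \<open>\<theta>\<close> because \<open>\<eta>\<close> can be chosen to vanish on the image of \<open>D\<close> and to be
  skew under \<open>\<theta>\<close>.
\<close>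
lemma extension_isomorphism_from_classes:
  assumes \<omega>: "\<omega> \<in> invariant_cocycles T R" and \<omega>': "\<omega>' \<in> invariant_cocycles T R"
    and \<phi>: "\<phi> \<in> triple_isos T T" and A: "A \<in> linear_maps R R" "bij_betw A (carrier R) (carrier R)"
    and eq: "cohomology_class T R (transform \<phi> A \<omega>) = cohomology_class T R \<omega>'"
  shows "extension T R \<omega> \<cong>\<^sub>t extension T R \<omega>'"
proof -
  note \<phi>D = triple_isosD[OF \<phi>]
  note \<psi> = inverse_automorphism[OF \<phi>]
  have c: "\<omega> \<in> cocycles T R" using \<omega> by (simp add: mem_invariant_cocycles_iff)
  obtain \<eta> where \<eta>: "\<eta> \<in> linear_maps T R"
    "\<And>x. x \<in> carrier T \<Longrightarrow> \<eta> (dmap T x) = \<zero>\<^bsub>R\<^esub>"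
    "\<And>x. x \<in> carrier T \<Longrightarrow> \<eta> (theta T x) = \<ominus>\<^bsub>R\<^esub> \<eta> x"
    "\<And>x y. x \<in> carrier T \<Longrightarrow> y \<in> carrier T \<Longrightarrow>
      \<omega>' (x, y) = transform \<phi> A \<omega> (x, y) \<oplus>\<^bsub>R\<^esub> \<eta> (lie_bracket T x y)"
    using cohomologous_invariant_cocycles[OF transform_invariant[OF \<omega> \<phi> A(1)] \<omega>' eq] by blast
  note [simp] = linear_map_closed[OF \<phi>D(1)] linear_map_closed[OF A(1)] linear_map_closed[OF \<eta>(1)]
    cocycle_simps(1)[OF c]
  define h where "h v = (\<phi> (fst v), A (snd v) \<oplus>\<^bsub>R\<^esub> \<eta> (\<phi> (fst v)))" for v
  have A0: "A \<zero>\<^bsub>R\<^esub> = \<zero>\<^bsub>R\<^esub>" by (rule linear_map_zero[OF A(1) R_vectorspace R_vectorspace])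
  have "h \<in> triple_isos (extension T R \<omega>) (extension T R \<omega>')"
  proof (rule triple_isosI)
    show "h \<in> linear_maps (extension T R \<omega>) (extension T R \<omega>')"
    proof (rule linear_mapsI)
      fix u v assume uv: "u \<in> carrier (extension T R \<omega>)" "v \<in> carrier (extension T R \<omega>)"
      show "h (u \<oplus>\<^bsub>extension T R \<omega>\<^esub> v) = h u \<oplus>\<^bsub>extension T R \<omega>'\<^esub> h v"
        using uv by (auto simp: h_def extension_simps linear_map_add[OF \<phi>D(1)] linear_map_add[OF A(1)]
          linear_map_add[OF \<eta>(1)] scalar_simps intro!: coeff_eqI)
    next
      fix r u assume u: "u \<in> carrier (extension T R \<omega>)"
      show "h (r \<odot>\<^bsub>extension T R \<omega>\<^esub> u) = r \<odot>\<^bsub>extension T R \<omega>'\<^esub> h u"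
        using u by (auto simp: h_def extension_simps linear_map_smult[OF \<phi>D(1)] linear_map_smult[OF A(1)]
          linear_map_smult[OF \<eta>(1)] scalar_simps algebra_simps intro!: coeff_eqI)
    qed (auto simp: h_def extension_simps)
    show "bij_betw h (carrier (extension T R \<omega>)) (carrier (extension T R \<omega>'))"
      unfolding bij_betw_def extension_simps
    proof
      show "inj_on h (carrier T \<times> carrier R)"
      proof (rule inj_onI)
        fix u v assume uv: "u \<in> carrier T \<times> carrier R" "v \<in> carrier T \<times> carrier R" "h u = h v"
        have uvc: "fst u \<in> carrier T" "snd u \<in> carrier R" "fst v \<in> carrier T" "snd v \<in> carrier R"
          using uv(1,2) by auto
        have "\<phi> (fst u) = \<phi> (fst v)" using uv(3) by (simp add: h_def)
        then have fst: "fst u = fst v" using \<psi>(2)[OF uvc(1)] \<psi>(2)[OF uvc(3)] by metis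
        have "A (snd u) = A (snd v)"
        proof (rule coeff_eqI)
          fix f assume f: "f \<in> dual R"
          have "A (snd u) \<oplus>\<^bsub>R\<^esub> \<eta> (\<phi> (fst v)) = A (snd v) \<oplus>\<^bsub>R\<^esub> \<eta> (\<phi> (fst v))"
            using uv(3) fst by (simp add: h_def)
          from arg_cong[OF this, of f] show "f (A (snd u)) = f (A (snd v))"
            using f uvc by (simp add: scalar_simps)
        qed (use uvc in simp_all)
        then have "snd u = snd v" using A(2) uvc(2,4) unfolding bij_betw_def by (blast dest: inj_onD)
        with fst show "u = v" by (rule prod_eqI)
      qed
      show "h ` (carrier T \<times> carrier R) = carrier T \<times> carrier R"
      proof (intro equalityI subsetI)
        fix v assume v: "v \<in> carrier T \<times> carrier R"
        let ?x = "inv_into (carrier T) \<phi> (fst v)"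
        have x: "?x \<in> carrier T" "\<phi> ?x = fst v" using v \<psi>(3) linear_map_closed[OF \<psi>(1)] by auto
        have "snd v \<oplus>\<^bsub>R\<^esub> \<ominus>\<^bsub>R\<^esub> \<eta> (fst v) \<in> A ` carrier R" using v A(2) by (auto simp: bij_betw_def)
        then obtain r where r: "r \<in> carrier R" "A r = snd v \<oplus>\<^bsub>R\<^esub> \<ominus>\<^bsub>R\<^esub> \<eta> (fst v)" by auto
        have "A r \<oplus>\<^bsub>R\<^esub> \<eta> (fst v) = snd v"
          by (rule coeff_eqI) (use v r in \<open>auto simp: scalar_simps\<close>)
        then have "v = h (?x, r)" using x by (simp add: h_def prod_eq_iff)
        then show "v \<in> h ` (carrier T \<times> carrier R)" using x r by blast
      qed (auto simp: h_def)
    qed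
  next
    fix u v assume uv: "u \<in> carrier (extension T R \<omega>)" "v \<in> carrier (extension T R \<omega>)"
    then have uvc: "fst u \<in> carrier T" "snd u \<in> carrier R" "fst v \<in> carrier T" "snd v \<in> carrier R"
      by (auto simp: extension_simps)
    have "\<omega>' (\<phi> (fst u), \<phi> (fst v)) = A (\<omega> (fst u, fst v)) \<oplus>\<^bsub>R\<^esub> \<eta> (\<phi> (lie_bracket T (fst u) (fst v)))"
      using uvc by (simp add: \<eta>(4) transform_def \<psi>(2) \<phi>D(3))
    then show "h (lie_bracket (extension T R \<omega>) u v) = lie_bracket (extension T R \<omega>') (h u) (h v)"
      using uvc by (simp add: h_def extension_simps \<phi>D(3))
    show "form (extension T R \<omega>) u v = form (extension T R \<omega>') (h u) (h v)"
      using uvc by (simp add: h_def extension_simps \<phi>D(4))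
  next
    fix u assume "u \<in> carrier (extension T R \<omega>)"
    then have uc: "fst u \<in> carrier T" "snd u \<in> carrier R" by (auto simp: extension_simps)
    have "\<eta> (\<phi> (dmap T (fst u))) = \<zero>\<^bsub>R\<^esub>" using uc \<phi>D(5)[of "fst u"] \<eta>(2)[of "\<phi> (fst u)"] by simp
    then have "A \<zero>\<^bsub>R\<^esub> \<oplus>\<^bsub>R\<^esub> \<eta> (\<phi> (dmap T (fst u))) = \<zero>\<^bsub>R\<^esub>"
      unfolding A0 by (intro coeff_eqI) (simp_all add: scalar_simps)
    then show "dmap (extension T R \<omega>') (h u) = h (dmap (extension T R \<omega>) u)"
      using uc by (simp add: h_def extension_simps \<phi>D(5))
    have "\<eta> (\<phi> (theta T (fst u))) = \<ominus>\<^bsub>R\<^esub> \<eta> (\<phi> (fst u))"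
      using uc \<phi>D(6)[of "fst u"] \<eta>(3)[of "\<phi> (fst u)"] by simp
    then have "A (\<ominus>\<^bsub>R\<^esub> snd u) \<oplus>\<^bsub>R\<^esub> \<eta> (\<phi> (theta T (fst u))) = \<ominus>\<^bsub>R\<^esub> (A (snd u) \<oplus>\<^bsub>R\<^esub> \<eta> (\<phi> (fst u)))"
      using uc by (intro coeff_eqI)
        (simp_all add: scalar_simps linear_map_uminus[OF A(1) R_vectorspace R_vectorspace])
    then show "theta (extension T R \<omega>') (h u) = h (theta (extension T R \<omega>) u)"
      using uc by (simp add: h_def extension_simps \<phi>D(6))
  qed
  then show ?thesis by (auto simp: isomorphic_triples_def)
qed

text \<open>
  An isomorphism \<open>h\<close> preserves the metric radical \<open>{0} \<times> R\<close>. Hence it has the form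
  \<open>(x, r) \<mapsto> (\<phi> x, \<tau> x + A r)\<close>, and the second component of \<open>h [u, v] = [h u, h v]\<close> says that
  \<open>\<omega>'\<close> and \<open>A \<circ> (\<phi>\<^sup>-\<^sup>1)\<^sup>*\<omega>\<close> differ by the coboundary of \<open>\<tau> \<circ> \<phi>\<^sup>-\<^sup>1\<close>.
\<close>
lemma classes_from_extension_isomorphism:
  assumes \<omega>: "\<omega> \<in> invariant_cocycles T R" and \<omega>': "\<omega>' \<in> invariant_cocycles T R"
    and iso: "extension T R \<omega> \<cong>\<^sub>t extension T R \<omega>'"
  obtains \<phi> A where "\<phi> \<in> carrier (Aut T)" "A \<in> carrier (GL R)"
    "cohomology_class T R (transform \<phi> A \<omega>) = cohomology_class T R \<omega>'"
proof -
  let ?E = "extension T R \<omega>" and ?E' = "extension T R \<omega>'"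
  obtain h where h: "h \<in> triple_isos ?E ?E'" using iso by (auto simp: isomorphic_triples_def)
  note hD = triple_isosD[OF h]
  have c: "\<omega> \<in> cocycles T R" "\<omega>' \<in> cocycles T R" using \<omega> \<omega>' by (auto simp: mem_invariant_cocycles_iff)
  interpret M: extension_model T R \<omega> ?E fst snd by (rule extension_is_model[OF \<omega>])
  interpret M': extension_model T R \<omega>' ?E "\<lambda>x. fst (h x)" "\<lambda>x. snd (h x)"
    by (rule modelI[OF \<omega>' extension_vectorspace M.model_closed h])
  \<comment> \<open>Both \<open>fst\<close> and \<open>fst \<circ> h\<close> are projections of the same weak triple, so both vanish exactly on its
      metric radical.\<close>
  have kernel: "fst (h v) = \<zero> \<longleftrightarrow> fst v = \<zero>" if "v \<in> carrier T \<times> carrier R" for v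
    using M.mem_radical[of v] M'.mem_radical[of v] that by (simp add: extension_simps)
  define \<phi>' where "\<phi>' = (\<lambda>x. fst (h (x, \<zero>\<^bsub>R\<^esub>)))"
  define \<tau> where "\<tau> = (\<lambda>x. snd (h (x, \<zero>\<^bsub>R\<^esub>)))"
  define A' where "A' = (\<lambda>r. snd (h (\<zero>, r)))"
  have hc: "fst (h v) \<in> carrier T" "snd (h v) \<in> carrier R" if "v \<in> carrier T \<times> carrier R" for v
    using M'.\<pi>_simps(1)[of v] M'.p_simps(1)[of v] that by (simp_all add: extension_simps)
  have split: "fst (h (x, r)) = \<phi>' x" "snd (h (x, r)) = \<tau> x \<oplus>\<^bsub>R\<^esub> A' r"
    if xr: "x \<in> carrier T" "r \<in> carrier R" for x r
  proof -
    interpret R: real_vs R by (rule R_real_vs)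
    have e: "(x, r) = (x, \<zero>\<^bsub>R\<^esub>) \<oplus>\<^bsub>?E\<^esub> (\<zero>, r)" using xr by (simp add: extension_simps)
    have "fst (h (\<zero>, r)) = \<zero>" using kernel xr by simp
    then show "fst (h (x, r)) = \<phi>' x"
      using xr M'.\<pi>_simps(2)[of "(x, \<zero>\<^bsub>R\<^esub>)" "(\<zero>, r)", folded e] hc[of "(x, \<zero>\<^bsub>R\<^esub>)"]
      by (simp add: extension_simps \<phi>'_def)
    show "snd (h (x, r)) = \<tau> x \<oplus>\<^bsub>R\<^esub> A' r"
      using xr M'.p_simps(2)[of "(x, \<zero>\<^bsub>R\<^esub>)" "(\<zero>, r)", folded e]
      by (simp add: extension_simps \<tau>_def A'_def)
  qed
  have zero_simps: "\<zero>\<^bsub>R\<^esub> \<oplus>\<^bsub>R\<^esub> \<zero>\<^bsub>R\<^esub> = \<zero>\<^bsub>R\<^esub>" "c \<odot>\<^bsub>R\<^esub> \<zero>\<^bsub>R\<^esub> = \<zero>\<^bsub>R\<^esub>" "c \<odot> \<zero> = \<zero>" for c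
  proof -
    interpret R: real_vs R by (rule R_real_vs)
    show "\<zero>\<^bsub>R\<^esub> \<oplus>\<^bsub>R\<^esub> \<zero>\<^bsub>R\<^esub> = \<zero>\<^bsub>R\<^esub>" by simp
    show "c \<odot>\<^bsub>R\<^esub> \<zero>\<^bsub>R\<^esub> = \<zero>\<^bsub>R\<^esub>" using R.smult_r_null[of c] by simp
    show "c \<odot> \<zero> = \<zero>" using smult_r_null[of c] by simp
  qed
  have \<tau>: "\<tau> \<in> linear_maps T R" and \<phi>': "\<phi>' \<in> linear_maps T T"
  proof -
    have i: "(\<lambda>x. (x, \<zero>\<^bsub>R\<^esub>)) \<in> linear_maps T ?E"
      by (rule linear_mapsI) (simp_all add: extension_simps zero_simps)
    show "\<tau> \<in> linear_maps T R" "\<phi>' \<in> linear_maps T T"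
      using linear_map_compose[OF i M'.p_linear] linear_map_compose[OF i M'.\<pi>_linear]
      by (simp_all add: \<tau>_def \<phi>'_def comp_def)
  qed
  have A': "A' \<in> linear_maps R R"
  proof -
    have j: "(\<lambda>r. (\<zero>, r)) \<in> linear_maps R ?E"
      by (rule linear_mapsI) (simp_all add: extension_simps zero_simps)
    show ?thesis using linear_map_compose[OF j M'.p_linear] by (simp add: A'_def comp_def)
  qed
  \<comment> \<open>The groups \<^const>\<open>Aut\<close> and \<^const>\<open>GL\<close> consist of extensional functions.\<close>
  define \<phi> where "\<phi> = restrict \<phi>' (carrier T)"
  define A where "A = restrict A' (carrier R)"
  have \<phi>_eq [simp]: "\<phi> x = \<phi>' x" if "x \<in> carrier T" for x using that by (simp add: \<phi>_def)
  have A_eq [simp]: "A r = A' r" if "r \<in> carrier R" for r using that by (simp add: A_def)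
  note [simp] = linear_map_closed[OF \<phi>'] linear_map_closed[OF A'] linear_map_closed[OF \<tau>]
  have \<phi>_lin: "\<phi> \<in> linear_maps T T"
    by (rule linear_mapsI) (simp_all add: linear_map_add[OF \<phi>'] linear_map_smult[OF \<phi>'])
  have A_lin: "A \<in> linear_maps R R"
    by (rule linear_mapsI) (simp_all add: linear_map_add[OF A'] linear_map_smult[OF A'])
  have \<phi>_bij: "bij_betw \<phi> (carrier T) (carrier T)"
    unfolding bij_betw_def
  proof
    show "inj_on \<phi> (carrier T)"
    proof (rule inj_onI)
      fix x y assume xy: "x \<in> carrier T" "y \<in> carrier T" "\<phi> x = \<phi> y"
      have "fst (h (x \<ominus> y, \<zero>\<^bsub>R\<^esub>)) = \<phi>' (x \<ominus> y)" by (simp add: \<phi>'_def)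
      also have "\<dots> = \<phi>' x \<ominus> \<phi>' y"
        using xy by (simp add: a_minus_def linear_map_add[OF \<phi>']
            linear_map_uminus[OF \<phi>' vectorspace_axioms vectorspace_axioms])
      also have "\<dots> = \<zero>" using xy by simp
      finally have "x \<ominus> y = \<zero>" using kernel[of "(x \<ominus> y, \<zero>\<^bsub>R\<^esub>)"] xy by simp
      then show "x = y" using xy by simp
    qed
    show "\<phi> ` carrier T = carrier T"
    proof (intro equalityI subsetI)
      fix a assume "a \<in> carrier T"
      then obtain v where v: "v \<in> carrier ?E" "fst (h v) = a" by (rule M'.lift_zero)
      then have "a = \<phi> (fst v)" "fst v \<in> carrier T"
        using split(1)[of "fst v" "snd v"] by (auto simp: extension_simps)
      then show "a \<in> \<phi> ` carrier T" by blast
    qed auto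
  qed
  have A_bij: "bij_betw A (carrier R) (carrier R)"
    unfolding bij_betw_def
  proof
    show "inj_on A (carrier R)"
    proof (rule inj_onI)
      fix r s assume rs: "r \<in> carrier R" "s \<in> carrier R" "A r = A s"
      have "(\<zero>, r) = (\<zero>, s)"
        using rs kernel[of "(\<zero>, r)"] kernel[of "(\<zero>, s)"]
        by (intro M'.model_eqI) (simp_all add: extension_simps A'_def)
      then show "r = s" by simp
    qed
    show "A ` carrier R = carrier R"
    proof (intro equalityI subsetI)
      fix r assume "r \<in> carrier R"
      then obtain v where v: "v \<in> carrier ?E" "fst (h v) = \<zero>" "snd (h v) = r"
        using M'.model_lift[of "\<zero>" r] by auto
      then have "fst v = \<zero>" "snd v \<in> carrier R" using kernel[of v] by (auto simp: extension_simps)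
      moreover have "r = A' (snd v)" unfolding A'_def using v(3) \<open>fst v = \<zero>\<close> by (metis prod.collapse)
      ultimately show "r \<in> A ` carrier R" by auto
    qed auto
  qed
  have bracket_h: "\<phi>' (lie_bracket T x y) = lie_bracket T (\<phi>' x) (\<phi>' y)"
    "\<omega>' (\<phi>' x, \<phi>' y) = \<tau> (lie_bracket T x y) \<oplus>\<^bsub>R\<^esub> A' (\<omega> (x, y))"
    if xy: "x \<in> carrier T" "y \<in> carrier T" for x y
  proof -
    have "(x, \<zero>\<^bsub>R\<^esub>) \<in> carrier ?E" "(y, \<zero>\<^bsub>R\<^esub>) \<in> carrier ?E" using xy by (simp_all add: extension_simps)
    from M'.\<pi>_bracket[OF this] M'.p_bracket[OF this]
    show "\<phi>' (lie_bracket T x y) = lie_bracket T (\<phi>' x) (\<phi>' y)"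
      "\<omega>' (\<phi>' x, \<phi>' y) = \<tau> (lie_bracket T x y) \<oplus>\<^bsub>R\<^esub> A' (\<omega> (x, y))"
      using xy cocycle_simps(1)[OF c(1) xy] by (simp_all add: extension_simps split)
  qed
  have \<phi>_iso: "\<phi> \<in> triple_isos T T"
  proof (rule triple_isosI[OF \<phi>_lin \<phi>_bij])
    fix x assume x: "x \<in> carrier T"
    then have xE: "(x, \<zero>\<^bsub>R\<^esub>) \<in> carrier ?E" by (simp add: extension_simps)
    show "dmap T (\<phi> x) = \<phi> (dmap T x)"
      using M'.\<pi>_dmap[OF xE] x by (simp add: extension_simps split)
    show "theta T (\<phi> x) = \<phi> (theta T x)"
      using M'.\<pi>_theta[OF xE] x by (simp add: extension_simps split)
    fix y assume y: "y \<in> carrier T"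
    then have yE: "(y, \<zero>\<^bsub>R\<^esub>) \<in> carrier ?E" by (simp add: extension_simps)
    show "\<phi> (lie_bracket T x y) = lie_bracket T (\<phi> x) (\<phi> y)" using x y by (simp add: bracket_h)
    show "form T x y = form T (\<phi> x) (\<phi> y)"
      using M'.model_form[OF xE yE] x y by (simp add: extension_simps split)
  qed
  note \<psi> = inverse_automorphism[OF \<phi>_iso]
  let ?\<psi> = "inv_into (carrier T) \<phi>"
  have lin: "(\<lambda>x. \<tau> (?\<psi> x)) \<in> linear_maps T R"
    using linear_map_compose[OF \<psi>(1) \<tau>] by (simp add: comp_def)
  have "\<omega>' (x, y) = transform \<phi> A \<omega> (x, y) \<oplus>\<^bsub>R\<^esub> \<tau> (?\<psi> (lie_bracket T x y))"
    if xy: "x \<in> carrier T" "y \<in> carrier T" for x y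
  proof -
    interpret R: real_vs R by (rule R_real_vs)
    have \<psi>c: "?\<psi> x \<in> carrier T" "?\<psi> y \<in> carrier T" using xy linear_map_closed[OF \<psi>(1)] by auto
    have "\<phi>' (?\<psi> x) = x" "\<phi>' (?\<psi> y) = y" using \<psi>(3) xy \<psi>c by force+
    then show ?thesis
      using bracket_h(2)[OF \<psi>c] xy \<psi>c cocycle_simps(1)[OF c(1) \<psi>c]
      by (simp add: transform_def \<psi>(4) R.a_comm)
  qed
  then have "cohomologous (transform \<phi> A \<omega>) \<omega>'"
    unfolding cohomologous_def using lin by (intro bexI[of _ "\<lambda>x. \<tau> (?\<psi> x)"]) auto
  then have "cohomology_class T R (transform \<phi> A \<omega>) = cohomology_class T R \<omega>'"
    using cohomology_class_eq_iff[OF transform_cocycle[OF c(1) \<phi>_iso A_lin] c(2)] by simp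
  moreover have "\<phi> \<in> carrier (Aut T)"
    using \<phi>_iso \<phi>_bij by (simp add: Aut_def Bij_def \<phi>_def)
  moreover have "A \<in> carrier (GL R)"
    using A_lin A_bij by (simp add: GL_def Bij_def linear_isos_def A_def)
  ultimately show ?thesis using that by blast
qed

text \<open>
  An orbit can be recovered from the isomorphism class of the corresponding extension, which is why
  different orbits give non-isomorphic extensions.
\<close>
lemma orbit_of_class:
  assumes \<omega>: "\<omega> \<in> invariant_cocycles T R"
  shows "orbit (Aut T \<times>\<times> GL R) (cohomology_action T R) (cohomology_class T R \<omega>) =
    {cohomology_class T R \<omega>' | \<omega>'. \<omega>' \<in> invariant_cocycles T R \<and> extension T R \<omega> \<cong>\<^sub>t extension T R \<omega>'}"
proof (intro equalityI subsetI)
  have c: "\<omega> \<in> cocycles T R" using \<omega> by (simp add: mem_invariant_cocycles_iff)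
  {
    fix a assume "a \<in> orbit (Aut T \<times>\<times> GL R) (cohomology_action T R) (cohomology_class T R \<omega>)"
    then obtain \<phi> A where g: "\<phi> \<in> carrier (Aut T)" "A \<in> carrier (GL R)"
      and a: "a = cohomology_action T R (\<phi>, A) (cohomology_class T R \<omega>)"
      by (auto simp: orbit_def DirProd_def)
    let ?w = "transform \<phi> A \<omega>"
    have "?w \<in> invariant_cocycles T R" by (rule transform_invariant[OF \<omega> mem_Aut[OF g(1)] mem_GL(1)[OF g(2)]])
    moreover have "a = cohomology_class T R ?w"
      unfolding a by (rule cohomology_action_class[OF c mem_Aut[OF g(1)] mem_GL(1)[OF g(2)]])
    moreover have "extension T R \<omega> \<cong>\<^sub>t extension T R ?w"
      by (rule extension_isomorphism_from_classes[OF \<omega> calculation(1) mem_Aut[OF g(1)] mem_GL[OF g(2)] refl])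
    ultimately show "a \<in> {cohomology_class T R \<omega>' | \<omega>'. \<omega>' \<in> invariant_cocycles T R \<and>
        extension T R \<omega> \<cong>\<^sub>t extension T R \<omega>'}" by blast
  }
  {
    fix a assume "a \<in> {cohomology_class T R \<omega>' | \<omega>'. \<omega>' \<in> invariant_cocycles T R \<and>
        extension T R \<omega> \<cong>\<^sub>t extension T R \<omega>'}"
    then obtain \<omega>' where \<omega>': "\<omega>' \<in> invariant_cocycles T R" "extension T R \<omega> \<cong>\<^sub>t extension T R \<omega>'"
      "a = cohomology_class T R \<omega>'" by blast
    obtain \<phi> A where g: "\<phi> \<in> carrier (Aut T)" "A \<in> carrier (GL R)"
      "cohomology_class T R (transform \<phi> A \<omega>) = cohomology_class T R \<omega>'"
      using classes_from_extension_isomorphism[OF \<omega> \<omega>'(1,2)] by blast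
    have "a = cohomology_action T R (\<phi>, A) (cohomology_class T R \<omega>)"
      using g(3) \<omega>'(3) cohomology_action_class[OF c mem_Aut[OF g(1)] mem_GL(1)[OF g(2)]] by simp
    then show "a \<in> orbit (Aut T \<times>\<times> GL R) (cohomology_action T R) (cohomology_class T R \<omega>)"
      using g(1,2) by (auto simp: orbit_def DirProd_def)
  }
qed

end

section \<open>The classification\<close>

lemma model_in_weak_triples_over:
  fixes T0 :: "'a lie_triple" and S :: "'u lie_triple"
  assumes "extension_model T0 R \<omega> S \<pi> p"
  shows "S \<in> weak_triples_over T0 R"
proof -
  interpret extension_model T0 R \<omega> S \<pi> p by fact
  show ?thesis
    using model_weak_triple p_radical model_radical_quotient by (auto simp: weak_triples_over_def)
qed

lemma iso_class_eq_iff: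
  assumes "S \<in> weak_triples_over T0 R" "T \<in> weak_triples_over T0 R"
  shows "iso_relation (weak_triples_over T0 R) `` {S} = iso_relation (weak_triples_over T0 R) `` {T}
    \<longleftrightarrow> S \<cong>\<^sub>t T"
proof
  have sym: "T \<cong>\<^sub>t S" if "S \<cong>\<^sub>t T" "S \<in> weak_triples_over T0 R" for S T :: "'u lie_triple"
    using that pre_triple.isomorphic_triples_sym weak_extrinsic_symmetric_triple.axioms(1)
    by (auto simp: weak_triples_over_def)
  {
    assume "iso_relation (weak_triples_over T0 R) `` {S} = iso_relation (weak_triples_over T0 R) `` {T}"
    moreover have "T \<in> iso_relation (weak_triples_over T0 R) `` {T}"
      using assms(2) isomorphic_triples_refl by (auto simp: iso_relation_def)
    ultimately have "T \<in> iso_relation (weak_triples_over T0 R) `` {S}" by simp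
    then show "S \<cong>\<^sub>t T" by (simp add: iso_relation_def)
  }
  {
    assume "S \<cong>\<^sub>t T"
    then have "S \<cong>\<^sub>t U \<longleftrightarrow> T \<cong>\<^sub>t U" for U
      using sym[OF _ assms(1)] isomorphic_triples_trans by metis
    then show "iso_relation (weak_triples_over T0 R) `` {S} = iso_relation (weak_triples_over T0 R) `` {T}"
      using assms by (auto simp: iso_relation_def)
  }
qed

theorem proposition6p2:
  fixes T0 :: "'a lie_triple" and R :: "(real, 'r) module"
    and e :: "'a \<times> 'r \<Rightarrow> 'u"
  assumes "extrinsic_symmetric_triple T0"
    and "vectorspace \<R> R" and "vectorspace.fin_dim \<R> R"
    \<comment> \<open>the type \<open>'u\<close> is large enough to carry triples of the size in question\<close>
    and "inj_on e (carrier T0 \<times> carrier R)"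
  shows "(\<forall>\<omega>\<in>invariant_cocycles T0 R.
            extension T0 R \<omega> \<in> (weak_triples_over T0 R :: ('a \<times> 'r) lie_triple set)) \<and>
         bij_betw
           (\<lambda>\<Omega>. {T \<in> (weak_triples_over T0 R :: 'u lie_triple set).
                  \<exists>\<omega>\<in>invariant_cocycles T0 R. cohomology_class T0 R \<omega> \<in> \<Omega> \<and> T \<cong>\<^sub>t extension T0 R \<omega>})
           (orbits (Aut T0 \<times>\<times> GL R) (H2_D_minus T0 R) (cohomology_action T0 R))
           (weak_triples_over T0 R // iso_relation (weak_triples_over T0 R))"
proof -
  interpret extension_setting T0 R
    using assms(1-3)
    by (intro extension_setting.intro extension_setting_axioms.intro triple_with_coefficients.intro
        triple_with_coefficients_axioms.intro extrinsic_symmetric_triple.axioms(1)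
        extrinsic_symmetric_triple.nondegenerate)
  let ?I = "invariant_cocycles T0 R" and ?E = "extension T0 R" and ?c = "cohomology_class T0 R"
  let ?W = "weak_triples_over T0 R :: 'u lie_triple set"
  let ?orb = "\<lambda>\<omega>. orbit (Aut T0 \<times>\<times> GL R) (cohomology_action T0 R) (?c \<omega>)"
  let ?F = "\<lambda>\<Omega>. {T \<in> ?W. \<exists>\<omega>\<in>?I. ?c \<omega> \<in> \<Omega> \<and> T \<cong>\<^sub>t ?E \<omega>}"
  have E_sym: "S \<cong>\<^sub>t ?E \<omega>" if "?E \<omega> \<cong>\<^sub>t S" "\<omega> \<in> ?I" for \<omega> and S :: "('b, 'n) lie_triple_scheme"
    using pre_triple.isomorphic_triples_sym[OF extension_model.model_pre_triple[OF extension_is_model[OF that(2)]] that(1)] .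
  have W_sym: "?E \<omega> \<cong>\<^sub>t S" if "S \<cong>\<^sub>t ?E \<omega>" "S \<in> ?W" for S \<omega>
    using that pre_triple.isomorphic_triples_sym weak_extrinsic_symmetric_triple.axioms(1)
    by (auto simp: weak_triples_over_def)
  have model_of: "\<exists>\<omega>\<in>?I. S \<cong>\<^sub>t ?E \<omega>" if S: "S \<in> ?W" for S
  proof -
    obtain \<rho> where "weak_extrinsic_symmetric_triple S"
      "\<rho> \<in> linear_isos (S\<lparr>carrier := metric_radical S\<rparr>) R" "radical_quotient S \<cong>\<^sub>t T0"
      using S by (auto simp: weak_triples_over_def)
    then obtain \<omega> \<pi> p where "extension_model T0 R \<omega> S \<pi> p" by (rule weak_triple_is_model)
    then show ?thesis using model_isomorphic_extension extension_model.invariant by blast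
  qed
  have copy_of: "\<exists>S\<in>?W. S \<cong>\<^sub>t ?E \<omega>" if \<omega>: "\<omega> \<in> ?I" for \<omega>
  proof -
    obtain S :: "'u lie_triple" and \<pi> p where "extension_model T0 R \<omega> S \<pi> p"
      using copy_is_model[OF \<omega> assms(4)] by blast
    then show ?thesis using model_in_weak_triples_over model_isomorphic_extension by blast
  qed
  have orbits: "orbits (Aut T0 \<times>\<times> GL R) (H2_D_minus T0 R) (cohomology_action T0 R) = ?orb ` ?I"
  proof (intro equalityI subsetI)
    fix \<Omega> assume "\<Omega> \<in> orbits (Aut T0 \<times>\<times> GL R) (H2_D_minus T0 R) (cohomology_action T0 R)"
    then obtain a where a: "a \<in> H2_D_minus T0 R"
      "\<Omega> = orbit (Aut T0 \<times>\<times> GL R) (cohomology_action T0 R) a" by (auto simp: orbits_def)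
    obtain \<omega> where "\<omega> \<in> ?I" "?c \<omega> = a" using invariant_representative[OF a(1)] by blast
    then show "\<Omega> \<in> ?orb ` ?I" using a(2) by blast
  next
    fix \<Omega> assume "\<Omega> \<in> ?orb ` ?I"
    then show "\<Omega> \<in> orbits (Aut T0 \<times>\<times> GL R) (H2_D_minus T0 R) (cohomology_action T0 R)"
      using invariant_cocycle_class by (auto simp: orbits_def)
  qed
  \<comment> \<open>The correspondence sends the orbit of the class of \<open>\<omega>\<close> to the isomorphism class of any copy of
      the extension defined by \<open>\<omega>\<close>.\<close>
  have F_orbit: "?F (?orb \<omega>) = iso_relation ?W `` {S}"
    if \<omega>: "\<omega> \<in> ?I" and S: "S \<in> ?W" "S \<cong>\<^sub>t ?E \<omega>" for \<omega> S
  proof (intro equalityI subsetI)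
    fix T assume "T \<in> ?F (?orb \<omega>)"
    then obtain \<omega>' where T: "T \<in> ?W" "\<omega>' \<in> ?I" "?c \<omega>' \<in> ?orb \<omega>" "T \<cong>\<^sub>t ?E \<omega>'" by blast
    obtain \<phi> A where g: "\<phi> \<in> carrier (Aut T0)" "A \<in> carrier (GL R)"
      and "?c \<omega>' = cohomology_action T0 R (\<phi>, A) (?c \<omega>)"
      using T(3) by (auto simp: orbit_def DirProd_def)
    then have "?c (transform \<phi> A \<omega>) = ?c \<omega>'"
      using cohomology_action_class[OF _ mem_Aut[OF g(1)] mem_GL(1)[OF g(2)]] \<omega>
      by (simp add: mem_invariant_cocycles_iff)
    then have "?E \<omega> \<cong>\<^sub>t ?E \<omega>'"
      by (rule extension_isomorphism_from_classes[OF \<omega> T(2) mem_Aut[OF g(1)] mem_GL[OF g(2)]])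
    then have "S \<cong>\<^sub>t T"
      using S(2) W_sym[OF T(4,1)] isomorphic_triples_trans by metis
    then show "T \<in> iso_relation ?W `` {S}" using S(1) T(1) by (simp add: iso_relation_def)
  next
    fix T assume "T \<in> iso_relation ?W `` {S}"
    then have T: "T \<in> ?W" "S \<cong>\<^sub>t T" by (auto simp: iso_relation_def)
    have "T \<cong>\<^sub>t ?E \<omega>"
      using E_sym[OF isomorphic_triples_trans[OF W_sym[OF S(2,1)] T(2)] \<omega>] .
    moreover have "?c \<omega> \<in> ?orb \<omega>"
      unfolding orbit_of_class[OF \<omega>] using \<omega> isomorphic_triples_refl by blast
    ultimately show "T \<in> ?F (?orb \<omega>)" using T(1) \<omega> by blast
  qed
  have "bij_betw ?F (?orb ` ?I) (?W // iso_relation ?W)"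
    unfolding bij_betw_def
  proof
    show "inj_on ?F (?orb ` ?I)"
    proof (rule inj_onI)
      fix \<Omega> \<Omega>' assume "\<Omega> \<in> ?orb ` ?I" "\<Omega>' \<in> ?orb ` ?I" and eq: "?F \<Omega> = ?F \<Omega>'"
      then obtain \<omega> \<omega>' where \<omega>: "\<omega> \<in> ?I" "\<Omega> = ?orb \<omega>" and \<omega>': "\<omega>' \<in> ?I" "\<Omega>' = ?orb \<omega>'" by blast
      obtain S S' where S: "S \<in> ?W" "S \<cong>\<^sub>t ?E \<omega>" and S': "S' \<in> ?W" "S' \<cong>\<^sub>t ?E \<omega>'"
        using copy_of \<omega>(1) \<omega>'(1) by blast
      have "iso_relation ?W `` {S} = iso_relation ?W `` {S'}"
        using eq F_orbit[OF \<omega>(1) S] F_orbit[OF \<omega>'(1) S'] unfolding \<omega>(2) \<omega>'(2) by simp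
      then have "S \<cong>\<^sub>t S'" using iso_class_eq_iff[OF S(1) S'(1)] by simp
      then have iso: "?E \<omega> \<cong>\<^sub>t ?E \<omega>'"
        using W_sym[OF S(2,1)] S'(2) isomorphic_triples_trans by metis
      have iso': "?E \<omega>' \<cong>\<^sub>t ?E \<omega>" using E_sym[OF iso \<omega>(1)] .
      have "?E \<omega> \<cong>\<^sub>t ?E \<zeta> \<longleftrightarrow> ?E \<omega>' \<cong>\<^sub>t ?E \<zeta>" for \<zeta>
        using iso iso' isomorphic_triples_trans by metis
      then show "\<Omega> = \<Omega>'" unfolding \<omega>(2) \<omega>'(2) orbit_of_class[OF \<omega>(1)] orbit_of_class[OF \<omega>'(1)] by simp
    qed
    show "?F ` (?orb ` ?I) = ?W // iso_relation ?W"
    proof (intro equalityI subsetI)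
      fix X assume "X \<in> ?F ` (?orb ` ?I)"
      then obtain \<omega> where \<omega>: "\<omega> \<in> ?I" "X = ?F (?orb \<omega>)" by blast
      obtain S where S: "S \<in> ?W" "S \<cong>\<^sub>t ?E \<omega>" using copy_of[OF \<omega>(1)] by blast
      show "X \<in> ?W // iso_relation ?W"
        unfolding \<omega>(2) F_orbit[OF \<omega>(1) S] by (rule quotientI[OF S(1)])
    next
      fix X assume "X \<in> ?W // iso_relation ?W"
      then obtain S where S: "S \<in> ?W" "X = iso_relation ?W `` {S}" by (rule quotientE)
      obtain \<omega> where \<omega>: "\<omega> \<in> ?I" "S \<cong>\<^sub>t ?E \<omega>" using model_of[OF S(1)] by blast
      show "X \<in> ?F ` (?orb ` ?I)"
        unfolding S(2) F_orbit[OF \<omega>(1) S(1) \<omega>(2), symmetric] using \<omega>(1) by (intro imageI)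
    qed
  qed
  moreover have "\<forall>\<omega>\<in>?I. ?E \<omega> \<in> (weak_triples_over T0 R :: ('a \<times> 'r) lie_triple set)"
    using model_in_weak_triples_over[OF extension_is_model] by blast
  ultimately show ?thesis unfolding orbits by blast
qed

end
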